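(* Let $k>2$ be an integer and $\Gamma_k$ a non-abelian free group of rank $k$. There exists a quasi-isometric representation $\rho_k:\Gamma_k\to\mathrm{SL}_3(\mathbb{R})$ whose image is Zariski dense in $\mathrm{SL}_3(\mathbb{R})$, such that $\rho_k$ is not in the closure (in $\mathrm{Hom}(\Gamma_k,\mathrm{SL}_3(\mathbb{R}))$) of the set of Anosov representations, and such that $\rho_k$ is not robustly quasi-isometric.
   Context: $\mathrm{Hom}(\Gamma,\mathrm{SL}_3(\mathbb{R}))$ carries the topology of pointwise convergence; a property is robust at $\rho$ if it holds on an open neighborhood of $\rho$. Fix a finite symmetric generating set of $\Gamma$ with word length $|\cdot|$. A representation $\rho:\Gamma\to\mathrm{SL}_3(\mathbb{R})$ is quasi-isometric if it is a quasi-isometric embedding for the word metric and a left-invariant Riemannian metric on $\mathrm{SL}_3(\mathbb{R})$; equivalently, there exist $a\ge1,b\ge0$ with $\log s_1(\rho(\gamma))\ge a^{-1}|\gamma|-b$ for all $\gamma$, where $s_1\ge s_2\ge s_3$ are the singular values. $\rho$ is Anosov if there exist $c,d>0$ with $\log s_1(\rho(\gamma))-\log s_2(\rho(\gamma))\ge c|\gamma|-d$ for all $\gamma\in\Gamma$. *)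

theory Defs
  imports "HOL-Analysis.Analysis"
begin

type_synonym mat3 = "real^3^3"

definition SL3 :: "mat3 set" where
  "SL3 = {A. det A = 1}"

definition diag3 :: "real \<Rightarrow> real \<Rightarrow> real \<Rightarrow> mat3" where
  "diag3 a b c = (\<chi> i j. if i = j then (vector [a, b, c] :: real^3) $ i else 0)"

definition sing_vals :: "mat3 \<Rightarrow> real \<times> real \<times> real" where
  "sing_vals A = (SOME (s1, s2, s3). s1 \<ge> s2 \<and> s2 \<ge> s3 \<and> s3 \<ge> 0 \<and>
      (\<exists>U V. orthogonal_matrix U \<and> orthogonal_matrix V \<and> A = U ** diag3 s1 s2 s3 ** V))"

definition sv1 :: "mat3 \<Rightarrow> real" where "sv1 A = fst (sing_vals A)"
definition sv2 :: "mat3 \<Rightarrow> real" where "sv2 A = fst (snd (sing_vals A))"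
definition sv3 :: "mat3 \<Rightarrow> real" where "sv3 A = snd (snd (sing_vals A))"

text \<open>The free group \<Gamma>_k of rank k: reduced words in the letters (i, b), i < k,
where (i, False) is the generator a_i and (i, True) its inverse.  With respect to the
standard symmetric generating set {a_i, a_i^-1}, the word length of a reduced word is
its length.\<close>
type_synonym fword = "(nat \<times> bool) list"

definition letters_ok :: "nat \<Rightarrow> fword \<Rightarrow> bool" where
  "letters_ok k w \<longleftrightarrow> (\<forall>x \<in> set w. fst x < k)"

fun cancels :: "fword \<Rightarrow> bool" where
  "cancels (x # y # w) = ((fst x = fst y \<and> snd x \<noteq> snd y) \<or> cancels (y # w))"
| "cancels _ = False"

definition FreeGroup :: "nat \<Rightarrow> fword set" where
  "FreeGroup k = {w. letters_ok k w \<and> \<not> cancels w}"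

definition word_len :: "fword \<Rightarrow> nat" where
  "word_len w = length w"

text \<open>A homomorphism \<Gamma>_k \<rightarrow> SL_3(R) is determined freely by the images g 0, ..., g (k-1)
of the free generators (any tuple in SL_3(R)^k); its value on a reduced word is the
corresponding product.\<close>
definition hom_tuple :: "nat \<Rightarrow> (nat \<Rightarrow> mat3) \<Rightarrow> bool" where
  "hom_tuple k g \<longleftrightarrow> (\<forall>i < k. g i \<in> SL3)"

definition rep :: "(nat \<Rightarrow> mat3) \<Rightarrow> fword \<Rightarrow> mat3" where
  "rep g w = foldr (\<lambda>x M. (if snd x then matrix_inv (g (fst x)) else g (fst x)) ** M) w (mat 1)"

definition quasi_isometric :: "nat \<Rightarrow> (nat \<Rightarrow> mat3) \<Rightarrow> bool" where
  "quasi_isometric k g \<longleftrightarrow> (\<exists>a b. a \<ge> 1 \<and> b \<ge> 0 \<and>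
     (\<forall>\<gamma> \<in> FreeGroup k. ln (sv1 (rep g \<gamma>)) \<ge> real (word_len \<gamma>) / a - b))"

definition anosov :: "nat \<Rightarrow> (nat \<Rightarrow> mat3) \<Rightarrow> bool" where
  "anosov k g \<longleftrightarrow> (\<exists>c d. c > 0 \<and> d > 0 \<and>
     (\<forall>\<gamma> \<in> FreeGroup k. ln (sv1 (rep g \<gamma>)) - ln (sv2 (rep g \<gamma>)) \<ge> c * real (word_len \<gamma>) - d))"

text \<open>Basic open neighbourhoods of \<rho> in Hom(\<Gamma>_k, SL_3(R)) for the topology of pointwise
convergence: given by a finite set F of group elements and \<epsilon> > 0.\<close>
definition pw_nbhd :: "nat \<Rightarrow> (nat \<Rightarrow> mat3) \<Rightarrow> fword set \<Rightarrow> real \<Rightarrow> (nat \<Rightarrow> mat3) set" where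
  "pw_nbhd k g F \<epsilon> = {h. hom_tuple k h \<and> (\<forall>\<gamma> \<in> F. dist (rep h \<gamma>) (rep g \<gamma>) < \<epsilon>)}"

definition in_closure_anosov :: "nat \<Rightarrow> (nat \<Rightarrow> mat3) \<Rightarrow> bool" where
  "in_closure_anosov k g \<longleftrightarrow> (\<forall>F \<epsilon>. finite F \<and> F \<subseteq> FreeGroup k \<and> \<epsilon> > 0 \<longrightarrow>
      (\<exists>h \<in> pw_nbhd k g F \<epsilon>. anosov k h))"

definition robustly_quasi_isometric :: "nat \<Rightarrow> (nat \<Rightarrow> mat3) \<Rightarrow> bool" where
  "robustly_quasi_isometric k g \<longleftrightarrow> (\<exists>F \<epsilon>. finite F \<and> F \<subseteq> FreeGroup k \<and> \<epsilon> > 0 \<and>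
      (\<forall>h \<in> pw_nbhd k g F \<epsilon>. quasi_isometric k h))"

inductive poly_fun :: "(mat3 \<Rightarrow> real) \<Rightarrow> bool" where
  const: "poly_fun (\<lambda>A. c)"
| entry: "poly_fun (\<lambda>A. A $ i $ j)"
| add: "poly_fun p \<Longrightarrow> poly_fun q \<Longrightarrow> poly_fun (\<lambda>A. p A + q A)"
| mult: "poly_fun p \<Longrightarrow> poly_fun q \<Longrightarrow> poly_fun (\<lambda>A. p A * q A)"

definition zariski_dense_SL3 :: "mat3 set \<Rightarrow> bool" where
  "zariski_dense_SL3 S \<longleftrightarrow> S \<subseteq> SL3 \<and>
     (\<forall>p. poly_fun p \<and> (\<forall>A \<in> S. p A = 0) \<longrightarrow> (\<forall>A \<in> SL3. p A = 0))"

end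

theory Submission
  imports Defs
begin

text \<open>
  Let the first generator act as $a = \lambda R_{2\pi/3} \oplus \lambda^{-2}$ on $V \oplus L$,
  where $L$ is spanned by $(1,1,1)$ and $V = L^\perp$, and let the others be strongly proximal
  matrices $b_i$ whose eigenvectors are points of the conic $(1,x,x^2)$. As the rotation has order 3,
  the powers $a^n$ move the attracting points of the $b_i$ towards finitely many directions, all of
  them off the repelling planes. Ping-pong then gives exponential growth of norms, so the
  representation is quasi-isometric. The eigenvalues of $a$ are not real, which is an open condition
  and excludes the Anosov property.

  Changing $2\pi/3$ to a nearby angle makes the multiples of the rotation angle fill out the circle,
  and a small change of $c = b_2$ then produces $m, n$ with $a^{-n} c a^m$ fixing the line
  $b_1^{-1} L$. So $y = b_1 a^{-n} c a^m b_1^{-1}$ fixes $L$, the conjugates $a^j y a^{-j}$ stay bounded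
  as $j \to \infty$, and the perturbed representation is not quasi-isometric.

  For Zariski density, the Zariski closure contains the one-parameter group through $a^3$. Conjugating
  its generator by the powers of $b_1$ and separating the weights of $b_1$ yields all root vectors
  with respect to the eigenbasis of $b_1$.
\<close>

section \<open>Singular values\<close>

text \<open>The quasi-isometry condition sees only \<open>s_1\<close>, while Anosov needs a gap
  between \<open>s_1\<close> and \<open>s_2\<close>. On \<open>V\<close> the matrix \<open>a\<close>
  is a similarity: its powers grow but contract no projective direction inside \<open>V\<close>.
  Ping-pong therefore cannot treat \<open>a\<close> as proximal; it works only because a rotation of
  finite order leaves finitely many directions to keep off the repelling planes. That finiteness is
  lost under small changes of the angle. The axis (1,1,1) is chosen since the rotation of order 3
  about it is a cyclic permutation of coordinates. On the conic the dual eigenfunctionals are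
  Lagrange interpolation polynomials, so being off a repelling plane becomes an inequality between
  explicit polynomials; (1,1,1) is itself the conic point at 1. The constants are fixed in the order
  \<open>\<eta>\<close> (size of the neighbourhoods), \<open>N\<close> (strength of the
  \<open>b_i\<close>), \<open>l\<close> (the \<lambda> of \<open>a\<close>). Two hyperbolic
  generators have separate roles in the failure of robustness: \<open>b_1\<close> moves
  \<open>L\<close> to a line with a component in \<open>V\<close>, and \<open>b_2\<close> is the one
  that is perturbed. This is where k > 2 enters.\<close>

lemma max_norm_imp_orthogonal_images:
  fixes A :: mat3
  assumes le: "\<And>t. norm (A *v (u + t *\<^sub>R w)) \<le> norm (A *v u) * norm (u + t *\<^sub>R w)"
    and u: "norm u = 1" and w: "norm w = 1" and uw: "u \<bullet> w = 0"
  shows "(A *v u) \<bullet> (A *v w) = 0"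
proof (rule ccontr)
  let ?b = "(A *v u) \<bullet> (A *v w)"
  let ?c = "(norm (A *v u))\<^sup>2"
  assume nz: "?b \<noteq> 0"
  \<comment> \<open>First variation: in the maximality condition along the line through
    \<open>u\<close>, the term linear in \<open>t\<close> must be dominated by a quadratic one for
    every \<open>t\<close>.\<close>
  have key: "2 * t * ?b \<le> t\<^sup>2 * ?c" for t
  proof -
    have "(norm (A *v (u + t *\<^sub>R w)))\<^sup>2 \<le> (norm (A *v u) * norm (u + t *\<^sub>R w))\<^sup>2"
      using le by (intro power_mono) auto
    moreover have "(norm (A *v (u + t *\<^sub>R w)))\<^sup>2 = ?c + 2 * t * ?b + t\<^sup>2 * (norm (A *v w))\<^sup>2"
      by (simp only: power2_norm_eq_inner)
        (simp add: matrix_vector_right_distrib matrix_vector_mult_scaleR inner_add inner_commute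
          algebra_simps power2_eq_square)
    moreover have "(norm (u + t *\<^sub>R w))\<^sup>2 = 1 + t\<^sup>2"
    proof -
      have "u \<bullet> u = 1" "w \<bullet> w = 1" using u w by (simp_all add: norm_eq_1)
      then show ?thesis
        by (simp only: power2_norm_eq_inner)
          (simp add: inner_add uw inner_commute power2_eq_square)
    qed
    ultimately have "?c + 2 * t * ?b + t\<^sup>2 * (norm (A *v w))\<^sup>2 \<le> ?c * (1 + t\<^sup>2)"
      by (simp add: power_mult_distrib)
    moreover have "0 \<le> t\<^sup>2 * (norm (A *v w))\<^sup>2" by simp
    moreover have "?c * (1 + t\<^sup>2) = ?c + t\<^sup>2 * ?c" by (simp add: algebra_simps)
    ultimately show ?thesis by linarith
  qed
  \<comment> \<open>A \<open>t\<close> with the sign of \<open>?b\<close> and small enough for the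
    linear term to win; the summand 1 keeps the denominator positive.\<close>
  define t where "t = ?b / (?c + 1)"
  have c: "?c \<ge> 0" by simp
  have "2 * t * ?b \<le> t\<^sup>2 * ?c" by (rule key)
  then have "2 * ?b\<^sup>2 * (?c + 1) \<le> ?b\<^sup>2 * ?c"
    using c by (simp add: t_def power2_eq_square divide_simps split: if_splits)
  moreover have False if "2 * x * (y + 1) \<le> x * y" "x > 0" "y \<ge> 0" for x y :: real
  proof -
    have "0 \<le> x * y" using that by simp
    moreover have "2 * x * (y + 1) = 2 * (x * y) + 2 * x" by (simp add: algebra_simps)
    ultimately show False using that by linarith
  qed
  moreover have "?b\<^sup>2 > 0" using nz by simp
  ultimately show False using c by blast
qed

lemma orthonormal_rows_orthogonal_matrix:
  fixes u v w :: "real^3"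
  assumes "norm u = 1" "norm v = 1" "norm w = 1" "u \<bullet> v = 0" "u \<bullet> w = 0" "v \<bullet> w = 0"
  shows "orthogonal_matrix (vector [u, v, w] :: mat3)"
proof -
  have "orthogonal_matrix (vector [u, v, w] :: mat3) \<longleftrightarrow>
      (\<forall>i. norm (row i (vector [u, v, w] :: mat3)) = 1) \<and>
      (\<forall>i j. i \<noteq> j \<longrightarrow> orthogonal (row i (vector [u, v, w] :: mat3)) (row j (vector [u, v, w])))"
    by (rule orthogonal_matrix_orthonormal_rows)
  moreover have "row i (vector [u, v, w] :: mat3) = (vector [u, v, w] :: mat3) $ i" for i
    by (simp add: row_def vec_eq_iff)
  ultimately show ?thesis using assms
    by (simp add: forall_3 orthogonal_def inner_commute)
qed

text \<open>Greedy construction: \<open>v1\<close> maximises the stretch on the unit sphere,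
  \<open>v2\<close> on the unit circle orthogonal to \<open>v1\<close>, and \<open>v3\<close>
  completes the frame by a cross product. Maximality makes the images orthogonal; the nonzero
  determinant allows them to be normalised.\<close>

lemma singular_value_decomposition_3:
  fixes A :: mat3
  assumes "det A \<noteq> 0"
  shows "\<exists>s1 s2 s3 U V. s1 \<ge> s2 \<and> s2 \<ge> s3 \<and> s3 \<ge> 0 \<and> orthogonal_matrix U \<and> orthogonal_matrix V
    \<and> A = U ** diag3 s1 s2 s3 ** V"
proof -
  let ?f = "\<lambda>v. norm (A *v v)"
  have cont: "continuous_on S ?f" for S
    by (intro continuous_intros linear_continuous_on linear_conv_bounded_linear[THEN iffD1]) simp
  have inj: "A *v v \<noteq> 0" if "v \<noteq> 0" for v
    using assms that invertible_det_nz[of A] by (metis matrix_left_invertible_ker invertible_left_inverse)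
  have "\<exists>v1\<in>sphere 0 1. \<forall>v\<in>sphere 0 1. ?f v \<le> ?f v1"
    by (rule continuous_attains_sup) (auto intro: cont)
  then obtain v1 where v1: "norm v1 = 1" and m1: "\<And>v. norm v = 1 \<Longrightarrow> ?f v \<le> ?f v1" by auto
  let ?S = "sphere 0 1 \<inter> {v. v1 \<bullet> v = 0}"
  have "closed {v. v1 \<bullet> v = 0}" by (rule closed_hyperplane)
  then have "compact ?S" by (intro compact_Int_closed) auto
  moreover have "\<exists>x. x \<in> ?S"
  proof -
    obtain x where x: "x \<noteq> 0" "orthogonal v1 x"
      using orthogonal_to_vector_exists[of v1] by auto
    then show ?thesis by (intro exI[of _ "x /\<^sub>R norm x"]) (auto simp: orthogonal_def)
  qed
  ultimately have "\<exists>v2\<in>?S. \<forall>v\<in>?S. ?f v \<le> ?f v2"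
    by (intro continuous_attains_sup) (auto intro: cont)
  then obtain v2 where v2: "norm v2 = 1" and v12: "v1 \<bullet> v2 = 0"
    and m2: "\<And>v. norm v = 1 \<Longrightarrow> v1 \<bullet> v = 0 \<Longrightarrow> ?f v \<le> ?f v2" by auto
  define v3 where "v3 = cross3 v1 v2"
  have v13: "v1 \<bullet> v3 = 0" and v23: "v2 \<bullet> v3 = 0" by (auto simp: v3_def dot_cross_self)
  have v3: "norm v3 = 1"
    using v1 v2 v12 norm_cross_dot[of v1 v2] norm_ge_zero[of v3] unfolding v3_def[symmetric]
    by (simp only: power2_eq_1_iff) (auto simp: power2_eq_1_iff)
  have scale1: "?f v \<le> ?f v1 * norm v" for v
  proof (cases "v = 0")
    case False
    have "?f (v /\<^sub>R norm v) \<le> ?f v1" using False by (intro m1) simp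
    then show ?thesis using False by (simp add: matrix_vector_mult_scaleR field_simps)
  qed simp
  have scale2: "?f v \<le> ?f v2 * norm v" if "v1 \<bullet> v = 0" for v
  proof (cases "v = 0")
    case False
    have "?f (v /\<^sub>R norm v) \<le> ?f v2" using False that by (intro m2) simp_all
    then show ?thesis using False by (simp add: matrix_vector_mult_scaleR field_simps)
  qed simp
  have o12: "(A *v v1) \<bullet> (A *v v2) = 0" and o13: "(A *v v1) \<bullet> (A *v v3) = 0"
    using v1 v2 v3 v12 v13 scale1 by (auto intro!: max_norm_imp_orthogonal_images)
  have o23: "(A *v v2) \<bullet> (A *v v3) = 0"
    using v2 v3 v23 v12 v13 scale2 by (auto intro!: max_norm_imp_orthogonal_images simp: inner_add)
  define s1 s2 s3 where "s1 = ?f v1" and "s2 = ?f v2" and "s3 = ?f v3"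
  have pos: "s1 > 0" "s2 > 0" "s3 > 0"
    unfolding s1_def s2_def s3_def zero_less_norm_iff using v1 v2 v3 by (auto intro!: inj)
  have ord: "s1 \<ge> s2" "s2 \<ge> s3"
    using m1 v2 m2 v3 v13 by (auto simp: s1_def s2_def s3_def)
  define u1 u2 u3 where "u1 = (A *v v1) /\<^sub>R s1" and "u2 = (A *v v2) /\<^sub>R s2" and "u3 = (A *v v3) /\<^sub>R s3"
  \<comment> \<open>The frames are stored as rows, so the left factor of the decomposition is
    \<open>transpose U\<close>.\<close>
  define V :: mat3 where "V = vector [v1, v2, v3]"
  define U :: mat3 where "U = vector [u1, u2, u3]"
  have oV: "orthogonal_matrix V"
    unfolding V_def using v1 v2 v3 v12 v13 v23 by (intro orthonormal_rows_orthogonal_matrix)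
  have oU: "orthogonal_matrix U"
    unfolding U_def using pos o12 o13 o23
    by (intro orthonormal_rows_orthogonal_matrix)
      (auto simp: u1_def u2_def u3_def s1_def s2_def s3_def)
  have "A ** transpose V = transpose U ** diag3 s1 s2 s3"
  proof -
    have "A ** transpose V = transpose (vector [A *v v1, A *v v2, A *v v3])"
      by (simp add: vec_eq_iff forall_3 matrix_matrix_mult_def transpose_def sum_3 V_def
          matrix_vector_mult_def)
    also have "\<dots> = transpose (vector [s1 *\<^sub>R u1, s2 *\<^sub>R u2, s3 *\<^sub>R u3])"
      using pos by (simp add: u1_def u2_def u3_def)
    also have "\<dots> = transpose U ** diag3 s1 s2 s3"
      by (simp add: vec_eq_iff forall_3 matrix_matrix_mult_def transpose_def diag3_def sum_3 U_def)
    finally show ?thesis .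
  qed
  then have "A ** (transpose V ** V) = transpose U ** diag3 s1 s2 s3 ** V"
    by (simp add: matrix_mul_assoc)
  then have "A = transpose U ** diag3 s1 s2 s3 ** V"
    using oV by (simp add: orthogonal_matrix)
  moreover have "orthogonal_matrix (transpose U)" using oU by simp
  moreover have "s3 \<ge> 0" using pos by simp
  ultimately show ?thesis using oV ord by blast
qed

lemma norm_orthogonal_matrix_mult:
  fixes U :: "real^'n^'n"
  assumes "orthogonal_matrix U" shows "norm (U *v x) = norm x"
  using assms orthogonal_transformation_matrix[of "(*v) U"] orthogonal_transformation_norm[of "(*v) U"]
  by simp

lemma sing_vals_decomposition:
  assumes "det A \<noteq> 0"
  obtains U V where "sv1 A \<ge> sv2 A" "sv2 A \<ge> sv3 A" "sv3 A \<ge> 0"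
    "orthogonal_matrix U" "orthogonal_matrix V" "A = U ** diag3 (sv1 A) (sv2 A) (sv3 A) ** V"
proof -
  let ?P = "\<lambda>(s1, s2, s3). s1 \<ge> s2 \<and> s2 \<ge> s3 \<and> s3 \<ge> 0 \<and>
      (\<exists>U V. orthogonal_matrix U \<and> orthogonal_matrix V \<and> A = U ** diag3 s1 s2 s3 ** V)"
  have "\<exists>t. ?P t" using singular_value_decomposition_3[OF assms] by auto
  then have "?P (sing_vals A)" unfolding sing_vals_def by (rule someI_ex)
  then show ?thesis using that by (auto simp: sv1_def sv2_def sv3_def split: prod.splits)
qed

lemma diag3_vec: "diag3 a b c *v x = vector [a * x$1, b * x$2, c * x$3]"
  by (simp add: vec_eq_iff forall_3 matrix_vector_mult_def diag3_def sum_3)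

lemma det_diag3: "det (diag3 a b c) = a * b * c"
  by (simp add: det_3 diag3_def)

lemma norm_vec3: "(norm (x :: real^3))\<^sup>2 = (x$1)\<^sup>2 + (x$2)\<^sup>2 + (x$3)\<^sup>2"
  by (simp only: power2_norm_eq_inner) (simp add: inner_vec_def sum_3 power2_eq_square)

lemma norm_diag3_bounds:
  assumes "a \<ge> b" "b \<ge> c" "c \<ge> 0"
  shows "norm (diag3 a b c *v x) \<le> a * norm x" and "c * norm x \<le> norm (diag3 a b c *v x)"
proof -
  have sq: "c\<^sup>2 \<le> a\<^sup>2" "b\<^sup>2 \<le> a\<^sup>2" "c\<^sup>2 \<le> b\<^sup>2" using assms by (auto intro!: power_mono)
  have "(norm (diag3 a b c *v x))\<^sup>2 \<le> (a * norm x)\<^sup>2"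
    unfolding diag3_vec norm_vec3 power_mult_distrib
    using sq by (simp add: power_mult_distrib distrib_left add_mono mult_right_mono)
  then show "norm (diag3 a b c *v x) \<le> a * norm x"
    using assms by (auto intro: power2_le_imp_le)
  have "(c * norm x)\<^sup>2 \<le> (norm (diag3 a b c *v x))\<^sup>2"
    unfolding diag3_vec norm_vec3 power_mult_distrib
    using sq by (simp add: power_mult_distrib distrib_left add_mono mult_right_mono)
  then show "c * norm x \<le> norm (diag3 a b c *v x)"
    by (auto intro: power2_le_imp_le)
qed

lemma norm_mult_le_sv1:
  assumes "det A \<noteq> 0" shows "norm (A *v x) \<le> sv1 A * norm x"
proof -
  obtain U V where *: "sv1 A \<ge> sv2 A" "sv2 A \<ge> sv3 A" "sv3 A \<ge> 0"
    "orthogonal_matrix U" "orthogonal_matrix V" "A = U ** diag3 (sv1 A) (sv2 A) (sv3 A) ** V"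
    using sing_vals_decomposition[OF assms] by blast
  have "A *v x = U *v (diag3 (sv1 A) (sv2 A) (sv3 A) *v (V *v x))"
    by (subst *(6)) (simp add: matrix_vector_mul_assoc matrix_mul_assoc)
  then show ?thesis using norm_diag3_bounds(1)[OF *(1-3), of "V *v x"] *(4,5)
    by (simp add: norm_orthogonal_matrix_mult)
qed

lemma sv3_le_norm_mult:
  assumes "det A \<noteq> 0" shows "sv3 A * norm x \<le> norm (A *v x)"
proof -
  obtain U V where *: "sv1 A \<ge> sv2 A" "sv2 A \<ge> sv3 A" "sv3 A \<ge> 0"
    "orthogonal_matrix U" "orthogonal_matrix V" "A = U ** diag3 (sv1 A) (sv2 A) (sv3 A) ** V"
    using sing_vals_decomposition[OF assms] by blast
  have "A *v x = U *v (diag3 (sv1 A) (sv2 A) (sv3 A) *v (V *v x))"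
    by (subst *(6)) (simp add: matrix_vector_mul_assoc matrix_mul_assoc)
  then show ?thesis using norm_diag3_bounds(2)[OF *(1-3), of "V *v x"] *(4,5)
    by (simp add: norm_orthogonal_matrix_mult)
qed

text \<open>The bound is tested on the unit vector \<open>transpose V *v e\<close>, which is
  stretched by exactly \<open>sv1 A\<close>.\<close>

lemma sv1_le:
  assumes "det A \<noteq> 0" and C: "\<And>x. norm (A *v x) \<le> C * norm x" shows "sv1 A \<le> C"
proof -
  obtain U V where *: "sv1 A \<ge> sv2 A" "sv2 A \<ge> sv3 A" "sv3 A \<ge> 0"
    "orthogonal_matrix U" "orthogonal_matrix V" "A = U ** diag3 (sv1 A) (sv2 A) (sv3 A) ** V"
    using sing_vals_decomposition[OF assms(1)] by blast
  define e :: "real^3" where "e = vector [1, 0, 0]"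
  have ne: "norm e = 1"
    using norm_vec3[of e] by (simp add: e_def) (metis norm_ge_zero power2_eq_1_iff abs_of_nonneg real_sqrt_abs real_sqrt_one)
  have VV: "V *v (transpose V *v e) = e"
    using *(5) unfolding matrix_vector_mul_assoc orthogonal_matrix_def by simp
  have "A *v (transpose V *v e) = U *v (diag3 (sv1 A) (sv2 A) (sv3 A) *v (V *v (transpose V *v e)))"
    by (subst *(6)) (simp add: matrix_vector_mul_assoc matrix_mul_assoc)
  also have "\<dots> = U *v (sv1 A *\<^sub>R e)"
  proof -
    have "diag3 (sv1 A) (sv2 A) (sv3 A) *v e = sv1 A *\<^sub>R e"
      by (simp add: diag3_vec e_def vec_eq_iff forall_3)
    then show ?thesis unfolding VV by simp
  qed
  finally have "norm (A *v (transpose V *v e)) = sv1 A"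
    using * ne by (simp add: norm_orthogonal_matrix_mult)
  moreover have "norm (transpose V *v e) = 1"
    using norm_orthogonal_matrix_mult[of "transpose V" e] *(5) ne by simp
  ultimately show ?thesis using C[of "transpose V *v e"] by simp
qed

lemma sing_vals_SL3:
  assumes "A \<in> SL3"
  shows "sv1 A * sv2 A * sv3 A = 1" "sv1 A > 0" "sv2 A > 0" "sv3 A > 0"
proof -
  have d: "det A = 1" using assms by (simp add: SL3_def)
  obtain U V where *: "sv1 A \<ge> sv2 A" "sv2 A \<ge> sv3 A" "sv3 A \<ge> 0"
    "orthogonal_matrix U" "orthogonal_matrix V" "A = U ** diag3 (sv1 A) (sv2 A) (sv3 A) ** V"
    using sing_vals_decomposition[of A] d by auto
  have "\<bar>det U\<bar> = 1" "\<bar>det V\<bar> = 1" using det_orthogonal_matrix *(4,5) by (metis abs_1 abs_minus_cancel)+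
  moreover have "det A = det U * (sv1 A * sv2 A * sv3 A) * det V"
    by (subst *(6)) (simp add: det_mul det_diag3)
  ultimately have "\<bar>sv1 A * sv2 A * sv3 A\<bar> = 1"
    using d by (metis abs_1 abs_mult mult.left_neutral mult.right_neutral)
  moreover have "sv1 A * sv2 A * sv3 A \<ge> 0" using * by simp
  ultimately show 1: "sv1 A * sv2 A * sv3 A = 1" by simp
  show "sv3 A > 0" using 1 *(3) by (cases "sv3 A = 0") auto
  then show "sv2 A > 0" "sv1 A > 0" using *(1,2) by auto
qed

section \<open>Free groups and representations\<close>

lemma
  fixes A :: "real^'n^'n"
  assumes "invertible A"
  shows matrix_inv_right: "A ** matrix_inv A = mat 1" and matrix_inv_left: "matrix_inv A ** A = mat 1"
proof -
  have "\<exists>A'. A ** A' = mat 1 \<and> A' ** A = mat 1" using assms by (simp add: invertible_def)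
  from someI_ex[OF this] show "A ** matrix_inv A = mat 1" "matrix_inv A ** A = mat 1"
    by (simp_all add: matrix_inv_def)
qed

lemma matrix_inv_eqI:
  fixes A B :: "real^'n^'n"
  assumes "A ** B = mat 1"
  shows "matrix_inv A = B"
proof -
  have BA: "B ** A = mat 1" using assms matrix_left_right_inverse by blast
  then have "invertible A" using assms invertible_def by blast
  then have "A ** matrix_inv A = mat 1" by (rule matrix_inv_right)
  then have "B ** (A ** matrix_inv A) = B" by simp
  then show ?thesis by (simp add: matrix_mul_assoc BA)
qed

lemma SL3_invertible: "A \<in> SL3 \<Longrightarrow> invertible A"
  by (simp add: SL3_def invertible_det_nz)

lemma SL3_mult: "A \<in> SL3 \<Longrightarrow> B \<in> SL3 \<Longrightarrow> A ** B \<in> SL3"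
  by (simp add: SL3_def det_mul)

lemma SL3_matrix_inv: assumes "A \<in> SL3" shows "matrix_inv A \<in> SL3"
proof -
  have "A ** matrix_inv A = mat 1" using assms by (intro matrix_inv_right SL3_invertible)
  then have "det A * det (matrix_inv A) = 1" by (metis det_mul det_I)
  then show ?thesis using assms by (simp add: SL3_def)
qed

definition letter_mat :: "(nat \<Rightarrow> mat3) \<Rightarrow> nat \<times> bool \<Rightarrow> mat3" where
  "letter_mat g x = (if snd x then matrix_inv (g (fst x)) else g (fst x))"

lemma rep_Nil [simp]: "rep g [] = mat 1"
  by (simp add: rep_def)

lemma rep_Cons [simp]: "rep g (x # w) = letter_mat g x ** rep g w"
  by (simp add: rep_def letter_mat_def)

lemma rep_append: "rep g (u @ w) = rep g u ** rep g w"
  by (induction u) (simp_all add: matrix_mul_assoc)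

lemma letters_ok_simps [simp]:
  "letters_ok k []" "letters_ok k (x # w) \<longleftrightarrow> fst x < k \<and> letters_ok k w"
  "letters_ok k (u @ w) \<longleftrightarrow> letters_ok k u \<and> letters_ok k w"
  by (auto simp: letters_ok_def)

lemma letters_ok_replicate: "fst x < k \<Longrightarrow> letters_ok k (replicate n x)"
  by (auto simp: letters_ok_def)

lemma letter_mat_SL3: "hom_tuple k g \<Longrightarrow> fst x < k \<Longrightarrow> letter_mat g x \<in> SL3"
  by (simp add: letter_mat_def hom_tuple_def SL3_matrix_inv)

lemma rep_SL3: "hom_tuple k g \<Longrightarrow> letters_ok k w \<Longrightarrow> rep g w \<in> SL3"
proof (induction w)
  case Nil then show ?case by (simp add: SL3_def)
next
  case (Cons x w) then show ?case by (auto intro: SL3_mult letter_mat_SL3)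
qed

lemma letter_mat_cancel:
  assumes "hom_tuple k g" "fst x < k" "fst x = fst y" "snd x \<noteq> snd y"
  shows "letter_mat g x ** letter_mat g y = mat 1"
proof -
  have "invertible (g (fst x))" using assms by (intro SL3_invertible) (simp add: hom_tuple_def)
  then show ?thesis using assms(3,4)
    by (cases "snd x"; cases "snd y") (auto simp: letter_mat_def matrix_inv_left matrix_inv_right)
qed

lemma cancels_Cons:
  "cancels (x # w) \<longleftrightarrow> (\<exists>y v. w = y # v \<and> fst x = fst y \<and> snd x \<noteq> snd y) \<or> cancels w"
  by (cases w) auto

lemma cancels_append:
  "cancels (u @ w) \<longleftrightarrow> cancels u \<or> cancels w \<or>
     (u \<noteq> [] \<and> w \<noteq> [] \<and> fst (last u) = fst (hd w) \<and> snd (last u) \<noteq> snd (hd w))"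
proof (induction u)
  case (Cons x u) then show ?case by (cases u; cases w) (auto simp: cancels_Cons)
qed simp

lemma not_cancels_replicate: "\<not> cancels (replicate n x)"
proof (induction n)
  case (Suc n) then show ?case by (cases n) auto
qed simp

text \<open>Reduced words are not closed under concatenation, arbitrary words are. Cancelling does
  not change the value of \<open>rep\<close>, so the image can be computed with arbitrary words,
  where closure under products is immediate.\<close>

lemma rep_reduced_word:
  assumes "hom_tuple k g"
  shows "letters_ok k w \<Longrightarrow> \<exists>v\<in>FreeGroup k. rep g v = rep g w"
proof (induction w)
  case Nil then show ?case by (intro bexI[of _ "[]"]) (auto simp: FreeGroup_def)
next
  case (Cons x w)
  then obtain v where v: "v \<in> FreeGroup k" "rep g v = rep g w" by auto
  show ?case
  proof (cases "cancels (x # v)")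
    case False
    then show ?thesis using v Cons.prems by (intro bexI[of _ "x # v"]) (auto simp: FreeGroup_def)
  next
    case True
    then have "\<exists>y u. v = y # u \<and> fst x = fst y \<and> snd x \<noteq> snd y"
      using v(1) unfolding cancels_Cons[of x v] FreeGroup_def by blast
    then obtain y u where u: "v = y # u" "fst x = fst y" "snd x \<noteq> snd y" by blast
    have "letter_mat g x ** letter_mat g y = mat 1"
      using letter_mat_cancel[OF assms _ u(2,3)] Cons.prems by simp
    then have "rep g u = letter_mat g x ** rep g v"
      unfolding u(1) rep_Cons by (simp add: matrix_mul_assoc)
    then show ?thesis using v u by (intro bexI[of _ u]) (auto simp: FreeGroup_def cancels_Cons)
  qed
qed

lemma rep_image_FreeGroup:
  assumes "hom_tuple k g"
  shows "rep g ` FreeGroup k = rep g ` {w. letters_ok k w}"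
proof
  show "rep g ` FreeGroup k \<subseteq> rep g ` {w. letters_ok k w}" by (auto simp: FreeGroup_def)
  show "rep g ` {w. letters_ok k w} \<subseteq> rep g ` FreeGroup k"
    using rep_reduced_word[OF assms] by (metis (no_types, lifting) image_iff image_subsetI mem_Collect_eq)
qed

section \<open>Continuity of a representation in the images of the generators\<close>

definition adj3 :: "mat3 \<Rightarrow> mat3" where
  "adj3 A = vector
    [vector [A$2$2 * A$3$3 - A$2$3 * A$3$2, A$1$3 * A$3$2 - A$1$2 * A$3$3, A$1$2 * A$2$3 - A$1$3 * A$2$2],
     vector [A$2$3 * A$3$1 - A$2$1 * A$3$3, A$1$1 * A$3$3 - A$1$3 * A$3$1, A$1$3 * A$2$1 - A$1$1 * A$2$3],
     vector [A$2$1 * A$3$2 - A$2$2 * A$3$1, A$1$2 * A$3$1 - A$1$1 * A$3$2, A$1$1 * A$2$2 - A$1$2 * A$2$1]]"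

lemma mult_adj3: "A ** adj3 A = det A *\<^sub>R mat 1"
  by (simp add: vec_eq_iff forall_3 matrix_matrix_mult_def sum_3 adj3_def det_3 mat_def algebra_simps)

text \<open>\<open>matrix_inv\<close> is a choice operator; on SL_3 it agrees with the adjugate,
  which is polynomial in the entries and therefore continuous.\<close>

lemma matrix_inv_eq_adj3: assumes "A \<in> SL3" shows "matrix_inv A = adj3 A"
  using assms mult_adj3[of A] by (intro matrix_inv_eqI) (simp add: SL3_def)

lemma tendsto_mat3_iff:
  fixes f :: "'a \<Rightarrow> mat3"
  shows "(f \<longlongrightarrow> A) F \<longleftrightarrow> (\<forall>i j. ((\<lambda>x. f x $ i $ j) \<longlongrightarrow> A $ i $ j) F)"
  by (auto intro: vec_tendstoI tendsto_vec_nth)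

lemma tendsto_matrix_mult:
  fixes f g :: "'a \<Rightarrow> mat3"
  assumes "(f \<longlongrightarrow> A) F" "(g \<longlongrightarrow> B) F"
  shows "((\<lambda>x. f x ** g x) \<longlongrightarrow> A ** B) F"
  using assms unfolding tendsto_mat3_iff matrix_matrix_mult_def
  by (auto intro!: tendsto_sum tendsto_mult)

lemma tendsto_adj3:
  assumes "(f \<longlongrightarrow> A) F" shows "((\<lambda>x. adj3 (f x)) \<longlongrightarrow> adj3 A) F"
  using assms unfolding tendsto_mat3_iff forall_3 adj3_def
  by (auto intro!: tendsto_diff tendsto_mult)

lemma tendsto_rep:
  assumes g: "hom_tuple k g" and h: "\<And>n. hom_tuple k (h n)"
    and lim: "\<And>i. i < k \<Longrightarrow> (\<lambda>n. h n i) \<longlonglongrightarrow> g i"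
  shows "letters_ok k w \<Longrightarrow> (\<lambda>n. rep (h n) w) \<longlonglongrightarrow> rep g w"
proof (induction w)
  case (Cons x w)
  have "(\<lambda>n. letter_mat (h n) x) \<longlonglongrightarrow> letter_mat g x"
  proof (cases "snd x")
    case True
    have "h n (fst x) \<in> SL3" "g (fst x) \<in> SL3" for n
      using g h Cons.prems by (auto simp: hom_tuple_def)
    then show ?thesis using True lim[of "fst x"] Cons.prems
      by (simp add: letter_mat_def matrix_inv_eq_adj3 tendsto_adj3)
  next
    case False
    then show ?thesis using lim Cons.prems by (simp add: letter_mat_def)
  qed
  then show ?case using Cons by (auto intro: tendsto_matrix_mult)
qed simp

lemma not_robustly_quasi_isometricI:
  assumes g: "hom_tuple k g" and h: "\<And>n. hom_tuple k (h n)"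
    and lim: "\<And>i. i < k \<Longrightarrow> (\<lambda>n. h n i) \<longlonglongrightarrow> g i"
    and nqi: "eventually (\<lambda>n. \<not> quasi_isometric k (h n)) sequentially"
  shows "\<not> robustly_quasi_isometric k g"
proof
  assume "robustly_quasi_isometric k g"
  then obtain F \<epsilon> where F: "finite F" "F \<subseteq> FreeGroup k" "\<epsilon> > 0"
    and qi: "\<And>h. h \<in> pw_nbhd k g F \<epsilon> \<Longrightarrow> quasi_isometric k h"
    unfolding robustly_quasi_isometric_def by blast
  have "\<forall>\<^sub>F n in sequentially. \<forall>\<gamma>\<in>F. dist (rep (h n) \<gamma>) (rep g \<gamma>) < \<epsilon>"
  proof (rule eventually_ball_finite[OF F(1)], rule ballI)
    fix \<gamma> assume "\<gamma> \<in> F"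
    then have "letters_ok k \<gamma>" using F by (auto simp: FreeGroup_def)
    then show "\<forall>\<^sub>F n in sequentially. dist (rep (h n) \<gamma>) (rep g \<gamma>) < \<epsilon>"
      using tendsto_rep[OF g h lim] F(3) tendstoD by blast
  qed
  then have "eventually (\<lambda>n. False) sequentially"
    using nqi by eventually_elim (use qi h in \<open>auto simp: pw_nbhd_def\<close>)
  then show False by simp
qed

section \<open>Non-real eigenvalues and the Anosov property\<close>

definition tr3 :: "mat3 \<Rightarrow> real" where
  "tr3 A = A$1$1 + A$2$2 + A$3$3"

text \<open>Sum of the principal 2x2 minors, the coefficient of the linear term of the
  characteristic polynomial.\<close>

definition minors3 :: "mat3 \<Rightarrow> real" where
  "minors3 A = (A$1$1 * A$2$2 - A$1$2 * A$2$1) + (A$1$1 * A$3$3 - A$1$3 * A$3$1)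
    + (A$2$2 * A$3$3 - A$2$3 * A$3$2)"

text \<open>The adjugate equals
  \<open>A ** A - tr3 A *\<^sub>R A + minors3 A *\<^sub>R mat 1\<close>; multiplying by
  \<open>A\<close> turns the left side into the determinant.\<close>

lemma cayley_hamilton_3:
  fixes A :: mat3
  shows "A *v (A *v (A *v x)) = tr3 A *\<^sub>R (A *v (A *v x)) - minors3 A *\<^sub>R (A *v x) + det A *\<^sub>R x"
proof -
  have "adj3 A = A ** A - tr3 A *\<^sub>R A + minors3 A *\<^sub>R mat 1"
    by (simp add: vec_eq_iff forall_3 matrix_matrix_mult_def sum_3 adj3_def tr3_def minors3_def mat_def
        algebra_simps)
  then have "adj3 A *v x = A *v (A *v x) - tr3 A *\<^sub>R (A *v x) + minors3 A *\<^sub>R x"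
    by (simp add: matrix_vector_mult_diff_rdistrib matrix_vector_mult_add_rdistrib
        scaleR_matrix_vector_assoc[symmetric] matrix_vector_mul_assoc)
  then have "A *v (A *v (A *v x) - tr3 A *\<^sub>R (A *v x) + minors3 A *\<^sub>R x) = (A ** adj3 A) *v x"
    by (simp add: matrix_vector_mul_assoc[symmetric])
  also have "\<dots> = det A *\<^sub>R x"
    by (simp add: mult_adj3 scaleR_matrix_vector_assoc[symmetric])
  finally show ?thesis
    by (simp add: matrix_vector_right_distrib matrix_vector_mult_diff_distrib matrix_vector_mult_scaleR
        algebra_simps)
qed

lemma char_poly_root_eigenvector:
  fixes A :: mat3
  assumes "v^3 - tr3 A * v^2 + minors3 A * v - det A = 0"
  obtains u where "u \<noteq> 0" "A *v u = v *\<^sub>R u"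
proof -
  have "det (A - v *\<^sub>R mat 1) = - (v^3 - tr3 A * v^2 + minors3 A * v - det A)"
    by (simp add: det_3 mat_def tr3_def minors3_def power2_eq_square power3_eq_cube algebra_simps)
  then have "det (A - v *\<^sub>R mat 1) = 0" using assms by simp
  then have "\<not> (\<exists>B. B ** (A - v *\<^sub>R mat 1) = mat 1)"
    by (metis invertible_det_nz invertible_left_inverse)
  then obtain u where "u \<noteq> 0" "(A - v *\<^sub>R mat 1) *v u = 0"
    unfolding matrix_left_invertible_ker by blast
  then have "A *v u = v *\<^sub>R u"
    by (simp add: matrix_vector_mult_diff_rdistrib scaleR_matrix_vector_assoc[symmetric])
  with \<open>u \<noteq> 0\<close> show ?thesis by (rule that)
qed

text \<open>For a real quadratic with non-real roots the form
  $|x_{n+1}|^2 - \sigma \langle x_{n+1}, x_n\rangle + \tau |x_n|^2$ is positive definite and is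
  multiplied by $\tau$ under the recursion $x_{n+2} = \sigma x_{n+1} - \tau x_n$.\<close>

lemma recurrence_complex_roots_bound:
  fixes x :: "nat \<Rightarrow> 'a::real_inner"
  assumes rec: "\<And>n. x (Suc (Suc n)) = s *\<^sub>R x (Suc n) - t *\<^sub>R x n"
    and st: "s\<^sup>2 < 4 * t"
  shows "\<exists>C\<ge>0. \<forall>n. (norm (x n))\<^sup>2 \<le> C * t ^ n"
proof -
  define E where "E n = x (Suc n) \<bullet> x (Suc n) - s * (x (Suc n) \<bullet> x n) + t * (x n \<bullet> x n)" for n
  have step: "E (Suc n) = t * E n" for n
    by (simp add: E_def rec inner_diff_left inner_diff_right inner_commute algebra_simps)
  have En: "E n = t ^ n * E 0" for n
    by (induction n) (simp_all add: step)
  define d where "d = t - s\<^sup>2 / 4"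
  have d: "d > 0" using st by (simp add: d_def)
  have lower: "d * (norm (x n))\<^sup>2 \<le> E n" for n
  proof -
    have "E n - d * (norm (x n))\<^sup>2 = (x (Suc n) - (s/2) *\<^sub>R x n) \<bullet> (x (Suc n) - (s/2) *\<^sub>R x n)"
      by (simp only: power2_norm_eq_inner)
        (simp add: E_def d_def inner_diff_left inner_diff_right inner_commute algebra_simps power2_eq_square)
    then show ?thesis using inner_ge_zero[of "x (Suc n) - (s/2) *\<^sub>R x n"] by linarith
  qed
  have "0 \<le> d * (norm (x 0))\<^sup>2" using d by simp
  then have "E 0 \<ge> 0" using lower[of 0] by (rule order_trans)
  moreover have "(norm (x n))\<^sup>2 \<le> (E 0 / d) * t ^ n" for n
  proof -
    have "(norm (x n))\<^sup>2 \<le> E n / d" using lower[of n] d by (simp only: pos_le_divide_eq mult.commute)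
    also have "E n / d = (E 0 / d) * t ^ n" by (subst En) simp
    finally show ?thesis .
  qed
  ultimately show ?thesis using d by (intro exI[of _ "E 0 / d"]) auto
qed

text \<open>The hypotheses say that the characteristic polynomial is (X - v)(X^2 - sX + t) with
  non-real roots in the second factor. Applying that factor to \<open>x\<close> gives
  \<open>w\<close> in the eigenspace of \<open>v\<close>; subtracting \<open>w / ?q\<close>, with
  \<open>?q\<close> the value of the factor at \<open>v\<close>, leaves a \<open>y\<close> obeying
  the two-term recurrence. As v \<le> 1 \<le> t, the eigenvector part is also dominated by
  \<open>sqrt t ^ n\<close>.\<close>

lemma power_growth_complex_eigenvalues:
  fixes A :: mat3
  assumes A: "det A = 1" and tr: "tr3 A = v + s" and mi: "minors3 A = v * s + t"
    and vt: "v * t = 1" and t: "t \<ge> 1" and st: "s\<^sup>2 < 4 * t"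
  shows "\<exists>C\<ge>0. \<forall>n. norm (((*v) A ^^ n) x) \<le> C * sqrt t ^ n"
proof -
  have v: "0 < v" "v \<le> 1"
  proof -
    have "v = 1 / t" using vt t by (simp add: field_simps)
    then show "0 < v" "v \<le> 1" using t by simp_all
  qed
  let ?q = "v\<^sup>2 - s * v + t"
  have "4 * ?q = (2 * v - s)\<^sup>2 + (4 * t - s\<^sup>2)" by (simp add: power2_eq_square algebra_simps)
  then have q: "?q > 0" using st by (smt (verit) zero_le_power2)
  define w where "w = A *v (A *v x) - s *\<^sub>R (A *v x) + t *\<^sub>R x"
  have Aw: "A *v w = v *\<^sub>R w"
    unfolding w_def using cayley_hamilton_3[of A x] vt
    by (simp add: matrix_vector_mult_scaleR matrix_vector_right_distrib matrix_vector_mult_diff_distrib A tr mi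
        algebra_simps)
  define y where "y = x - (1 / ?q) *\<^sub>R w"
  have y0: "A *v (A *v y) = s *\<^sub>R (A *v y) - t *\<^sub>R y"
  proof -
    have "A *v (A *v y) - s *\<^sub>R (A *v y) + t *\<^sub>R y
      = w - (1 / ?q) *\<^sub>R (A *v (A *v w) - s *\<^sub>R (A *v w) + t *\<^sub>R w)"
      by (simp add: y_def w_def matrix_vector_mult_scaleR matrix_vector_right_distrib
          matrix_vector_mult_diff_distrib algebra_simps)
    also have "A *v (A *v w) - s *\<^sub>R (A *v w) + t *\<^sub>R w = ?q *\<^sub>R w"
      by (simp add: Aw matrix_vector_mult_scaleR algebra_simps power2_eq_square)
    also have "w - (1 / ?q) *\<^sub>R (?q *\<^sub>R w) = 0" using q by simp
    finally show ?thesis by (simp add: algebra_simps)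
  qed
  have pw: "((*v) A ^^ n) w = v ^ n *\<^sub>R w" for n
    by (induction n) (simp_all add: Aw matrix_vector_mult_scaleR)
  have lin: "((*v) A ^^ n) (a + b) = ((*v) A ^^ n) a + ((*v) A ^^ n) b" for n a b
    by (induction n) (simp_all add: matrix_vector_right_distrib)
  have lin2: "((*v) A ^^ n) (c *\<^sub>R b) = c *\<^sub>R ((*v) A ^^ n) b" for n c b
    by (induction n) (simp_all add: matrix_vector_mult_scaleR)
  have rec: "((*v) A ^^ Suc (Suc n)) y = s *\<^sub>R ((*v) A ^^ Suc n) y - t *\<^sub>R ((*v) A ^^ n) y" for n
  proof (induction n)
    case 0 then show ?case using y0 by simp
  next
    case (Suc n)
    have "((*v) A ^^ Suc (Suc (Suc n))) y = A *v (((*v) A ^^ Suc (Suc n)) y)" by simp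
    also have "\<dots> = s *\<^sub>R ((*v) A ^^ Suc (Suc n)) y - t *\<^sub>R ((*v) A ^^ Suc n) y"
      by (subst Suc) (simp add: matrix_vector_mult_scaleR matrix_vector_mult_diff_distrib)
    finally show ?case .
  qed
  obtain C where C: "C \<ge> 0" "\<And>n. (norm (((*v) A ^^ n) y))\<^sup>2 \<le> C * t ^ n"
    using recurrence_complex_roots_bound[of "\<lambda>n. ((*v) A ^^ n) y", OF rec st] by blast
  have ny: "norm (((*v) A ^^ n) y) \<le> sqrt C * sqrt t ^ n" for n
    using real_sqrt_le_mono[OF C(2)[of n]] by (simp add: real_sqrt_mult real_sqrt_power)
  have "norm (((*v) A ^^ n) x) \<le> (sqrt C + norm w / ?q) * sqrt t ^ n" for n
  proof -
    have "y + (1 / ?q) *\<^sub>R w = x" by (simp add: y_def)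
    then have "((*v) A ^^ n) x = ((*v) A ^^ n) y + (1 / ?q) *\<^sub>R (v ^ n *\<^sub>R w)"
      using lin[of n y "(1 / ?q) *\<^sub>R w"] by (simp only: lin2 pw)
    then have "norm (((*v) A ^^ n) x) \<le> norm (((*v) A ^^ n) y) + norm ((1 / ?q) *\<^sub>R (v ^ n *\<^sub>R w))"
      by (simp only: norm_triangle_ineq)
    also have "norm ((1 / ?q) *\<^sub>R (v ^ n *\<^sub>R w)) = (norm w / ?q) * v ^ n" using q v by simp
    also have "\<dots> \<le> (norm w / ?q) * sqrt t ^ n"
    proof (rule mult_left_mono)
      have "v ^ n \<le> 1" "1 \<le> sqrt t ^ n" using v t by (auto intro: power_le_one one_le_power)
      then show "v ^ n \<le> sqrt t ^ n" by linarith
    qed (use q in simp)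
    finally show ?thesis using ny[of n] by (simp add: distrib_right)
  qed
  then show ?thesis using C q by (intro exI[of _ "sqrt C + norm w / ?q"]) auto
qed

lemma rep_replicate_apply: "rep h (replicate n x) *v v = ((*v) (letter_mat h x) ^^ n) v"
  by (induction n) (simp_all add: matrix_vector_mul_assoc[symmetric])

lemma vec3_expansion:
  fixes x :: "real^3"
  shows "x = x$1 *\<^sub>R axis 1 1 + x$2 *\<^sub>R axis 2 1 + x$3 *\<^sub>R axis 3 1"
  by (simp add: vec_eq_iff forall_3 axis_def)

text \<open>For the powers of the first generator, s_1 is at most a constant times t^(n/2), and s_3
  is at most v^n = t^(-n) by the real eigenvector. Since s_1 s_2 s_3 = 1, the ratio s_1/s_2 = s_1^2
  s_3 stays bounded while the word length grows.\<close>

lemma complex_eigenvalues_not_anosov: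
  fixes h :: "nat \<Rightarrow> mat3"
  assumes h: "hom_tuple k h" and k: "k > 0"
    and tr: "tr3 (h 0) = v + s" and mi: "minors3 (h 0) = v * s + t"
    and vt: "v * t = 1" and t: "t \<ge> 1" and st: "s\<^sup>2 < 4 * t"
  shows "\<not> anosov k h"
proof
  assume "anosov k h"
  then obtain c d where c: "c > 0"
    and an: "\<And>\<gamma>. \<gamma> \<in> FreeGroup k \<Longrightarrow>
      ln (sv1 (rep h \<gamma>)) - ln (sv2 (rep h \<gamma>)) \<ge> c * real (word_len \<gamma>) - d"
    unfolding anosov_def by blast
  let ?A = "h 0" and ?w = "\<lambda>n. replicate n (0 :: nat, False)"
  have A: "det ?A = 1" using h k by (simp add: hom_tuple_def SL3_def)
  have v: "v > 0"
  proof -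
    have "v = 1 / t" using vt t by (simp add: field_simps)
    then show ?thesis using t by simp
  qed
  have lA: "letter_mat h (0, False) = ?A" by (simp add: letter_mat_def)
  have "\<exists>C. \<forall>x. C x \<ge> 0 \<and> (\<forall>n. norm (((*v) ?A ^^ n) x) \<le> C x * sqrt t ^ n)"
    by (rule choice) (use power_growth_complex_eigenvalues[OF A tr mi vt t st] in blast)
  then obtain C where C: "\<And>x. C x \<ge> 0" "\<And>x n. norm (((*v) ?A ^^ n) x) \<le> C x * sqrt t ^ n" by blast
  define D where "D = C (axis 1 1) + C (axis 2 1) + C (axis 3 1) + 1"
  have D: "D > 0" using C(1) by (simp add: D_def add_nonneg_pos)
  have bound: "norm (rep h (?w n) *v x) \<le> D * sqrt t ^ n * norm x" for n x
  proof -
    have e: "norm (rep h (?w n) *v axis i 1) \<le> C (axis i 1) * sqrt t ^ n" for i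
      using C(2) by (simp add: rep_replicate_apply lA)
    let ?M = "rep h (?w n)"
    have "?M *v x = x$1 *\<^sub>R (?M *v axis 1 1) + x$2 *\<^sub>R (?M *v axis 2 1) + x$3 *\<^sub>R (?M *v axis 3 1)"
      by (subst vec3_expansion[of x]) (simp only: matrix_vector_right_distrib matrix_vector_mult_scaleR)
    then have "norm (?M *v x) \<le> norm (x$1 *\<^sub>R (?M *v axis 1 1)) + norm (x$2 *\<^sub>R (?M *v axis 2 1))
        + norm (x$3 *\<^sub>R (?M *v axis 3 1))"
      by (simp only:) (intro norm_triangle_mono norm_triangle_ineq order_refl)
    also have "\<dots> \<le> norm x * (C (axis 1 1) * sqrt t ^ n) + norm x * (C (axis 2 1) * sqrt t ^ n)
        + norm x * (C (axis 3 1) * sqrt t ^ n)"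
      unfolding norm_scaleR
      by (intro add_mono mult_mono e) (auto simp: component_le_norm_cart)
    also have "\<dots> \<le> D * sqrt t ^ n * norm x"
      using t by (simp add: D_def algebra_simps)
    finally show ?thesis .
  qed
  obtain u where u: "u \<noteq> 0" "?A *v u = v *\<^sub>R u"
  proof (rule char_poly_root_eigenvector[of v ?A])
    show "v ^ 3 - tr3 ?A * v\<^sup>2 + minors3 ?A * v - det ?A = 0"
      using vt by (simp add: tr mi A power2_eq_square power3_eq_cube algebra_simps)
  qed (use that in blast)
  have eig: "rep h (?w n) *v u = v ^ n *\<^sub>R u" for n
    unfolding rep_replicate_apply lA
    by (induction n) (simp_all add: u matrix_vector_mult_scaleR)
  have ineq: "c * real n - d \<le> ln (D\<^sup>2)" for n
  proof -
    have ok: "letters_ok k (?w n)" using k by (simp add: letters_ok_replicate)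
    then have fg: "?w n \<in> FreeGroup k" by (simp add: FreeGroup_def not_cancels_replicate)
    have SL: "rep h (?w n) \<in> SL3" using rep_SL3[OF h ok] .
    then have dn: "det (rep h (?w n)) \<noteq> 0" by (simp add: SL3_def)
    note sv = sing_vals_SL3[OF SL]
    let ?s1 = "sv1 (rep h (?w n))" and ?s2 = "sv2 (rep h (?w n))" and ?s3 = "sv3 (rep h (?w n))"
    have s1: "?s1 \<le> D * sqrt t ^ n" using sv1_le[OF dn] bound by blast
    have s3: "?s3 \<le> v ^ n" using sv3_le_norm_mult[OF dn, of u] u v by (simp add: eig)
    have "?s1 / ?s2 = ?s1\<^sup>2 * ?s3"
    proof -
      have "?s1\<^sup>2 * ?s3 * ?s2 = ?s1 * (?s1 * ?s2 * ?s3)" by (simp add: power2_eq_square algebra_simps)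
      then show ?thesis using sv by (simp add: field_simps)
    qed
    also have "\<dots> \<le> (D * sqrt t ^ n)\<^sup>2 * v ^ n"
      using s1 s3 sv by (intro mult_mono power_mono) auto
    also have "\<dots> = D\<^sup>2 * ((sqrt t)\<^sup>2 * v) ^ n" by (simp add: power_mult_distrib power_mult[symmetric] mult.commute)
    also have "\<dots> = D\<^sup>2" using vt t by (simp add: mult.commute)
    finally have le: "?s1 / ?s2 \<le> D\<^sup>2" .
    have "ln (?s1 / ?s2) \<le> ln (D\<^sup>2)"
      using le D sv by (intro ln_le_cancel_iff[THEN iffD2]) auto
    moreover have "ln (?s1 / ?s2) = ln ?s1 - ln ?s2" using sv by (simp add: ln_div)
    ultimately show ?thesis using an[OF fg] by (simp add: word_len_def)
  qed
  obtain n :: nat where "real n > (ln (D\<^sup>2) + d) / c" using reals_Archimedean2 by blast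
  then show False using ineq[of n] c by (simp add: field_simps)
qed

text \<open>Openness without continuity of eigenvalues: the characteristic polynomial changes sign
  across the simple root \<open>v\<close>, so nearby polynomials have a root close to
  \<open>v\<close> by the intermediate value theorem. That root then plays the role of
  \<open>v\<close> in the preceding lemma.\<close>

lemma complex_eigenvalues_not_in_closure_anosov:
  assumes g: "hom_tuple k g" and k: "k > 0"
    and tr: "tr3 (g 0) = v + s" and mi: "minors3 (g 0) = v * s + t"
    and vt: "v * t = 1" and t: "t > 1" and st: "s\<^sup>2 < 4 * t"
  shows "\<not> in_closure_anosov k g"
proof
  assume cl: "in_closure_anosov k g"
  have "\<exists>h. hom_tuple k h \<and> dist (h 0) (g 0) < inverse (real (Suc n)) \<and> anosov k h" for n
  proof -
    have "[(0, False)] \<in> FreeGroup k" using k by (simp add: FreeGroup_def)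
    then have "\<exists>h\<in>pw_nbhd k g {[(0, False)]} (inverse (real (Suc n))). anosov k h"
      using cl unfolding in_closure_anosov_def by (metis empty_subsetI finite.emptyI finite.insertI
          insert_subset inverse_positive_iff_positive of_nat_0_less_iff zero_less_Suc)
    then show ?thesis by (auto simp: pw_nbhd_def letter_mat_def)
  qed
  then obtain h where h: "\<And>n. hom_tuple k (h n)" "\<And>n. dist (h n 0) (g 0) < inverse (real (Suc n))"
    and an: "\<And>n. anosov k (h n)" by metis
  have lim: "(\<lambda>n. h n 0) \<longlonglongrightarrow> g 0"
  proof (rule LIMSEQ_I)
    fix r :: real assume "r > 0"
    then obtain N where N: "inverse (real (Suc N)) < r" using reals_Archimedean by blast
    have "norm (h n 0 - g 0) < r" if "n \<ge> N" for n
    proof -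
      have "inverse (real (Suc n)) \<le> inverse (real (Suc N))" using that by simp
      then show ?thesis using h(2)[of n] N unfolding dist_norm by linarith
    qed
    then show "\<exists>N. \<forall>n\<ge>N. norm (h n 0 - g 0) < r" by blast
  qed
  have comp: "(\<lambda>n. h n 0 $ i $ j) \<longlonglongrightarrow> g 0 $ i $ j" for i j
    using lim by (intro tendsto_vec_nth)
  have ltr: "(\<lambda>n. tr3 (h n 0)) \<longlonglongrightarrow> tr3 (g 0)"
    unfolding tr3_def by (intro tendsto_intros comp)
  have lmi: "(\<lambda>n. minors3 (h n 0)) \<longlonglongrightarrow> minors3 (g 0)"
    unfolding minors3_def by (intro tendsto_intros comp)
  have v: "0 < v" "v < 1"
  proof -
    have "v = 1 / t" using vt t by (simp add: field_simps)
    then show "0 < v" "v < 1" using t by simp_all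
  qed
  \<comment> \<open>A pair holds the trace and a real eigenvalue x. The complementary quadratic
    factor has coefficients s = trace - x and t = 1/x, so \<open>?f < 0\<close> says that its roots
    are not real.\<close>
  let ?z = "(v + s, v)" and ?f = "\<lambda>z::real \<times> real. (fst z - snd z)\<^sup>2 - 4 / snd z"
  have ls: "(snd \<longlongrightarrow> v) (nhds ?z)" and l1: "(fst \<longlongrightarrow> v + s) (nhds ?z)"
    using tendsto_snd[OF filterlim_ident[of "nhds ?z"]] tendsto_fst[OF filterlim_ident[of "nhds ?z"]]
    by simp_all
  have lf: "(?f \<longlongrightarrow> (v + s - v)\<^sup>2 - 4 / v) (nhds ?z)"
    using v by (rule_tac tendsto_diff[OF tendsto_power[OF tendsto_diff[OF l1 ls]]
          tendsto_divide[OF tendsto_const ls]]) simp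
  have "4 * t = 4 / v" using vt v by (simp add: field_simps)
  then have e1: "\<forall>\<^sub>F z in nhds ?z. ?f z < 0"
    using st by (intro order_tendstoD(2)[OF lf]) simp
  have "\<forall>\<^sub>F z in nhds ?z. 0 < snd z" "\<forall>\<^sub>F z in nhds ?z. snd z < 1"
    using v by (auto intro!: order_tendstoD[OF ls])
  with e1 have "\<forall>\<^sub>F z in nhds (v + s, v). (fst z - snd z)\<^sup>2 < 4 / snd z \<and> 0 < snd z \<and> snd z < 1"
    by eventually_elim auto
  then obtain e where e: "e > 0"
    and good: "\<And>z. dist z (v + s, v) < e \<Longrightarrow> (fst z - snd z)\<^sup>2 < 4 / snd z \<and> 0 < snd z \<and> snd z < 1"
    unfolding eventually_nhds_metric by blast
  define p where "p a b x = x^3 - a * x\<^sup>2 + b * x - 1" for a b x :: real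
  have pfac: "p (v + s) (v * s + t) x = (x - v) * (x\<^sup>2 - s * x + t)" for x
    using vt by (simp add: p_def power2_eq_square power3_eq_cube algebra_simps)
  have qpos: "x\<^sup>2 - s * x + t > 0" for x
  proof -
    have "4 * (x\<^sup>2 - s * x + t) = (2 * x - s)\<^sup>2 + (4 * t - s\<^sup>2)"
      by (simp add: power2_eq_square algebra_simps)
    then show ?thesis using st by (smt (verit) zero_le_power2)
  qed
  have lp: "(\<lambda>n. p (tr3 (h n 0)) (minors3 (h n 0)) x) \<longlonglongrightarrow> p (v + s) (v * s + t) x" for x
    unfolding p_def using ltr lmi tr mi by (intro tendsto_intros) auto
  have neg: "p (v + s) (v * s + t) (v - e/2) < 0"
    using e qpos[of "v - e/2"] unfolding pfac by (intro mult_neg_pos) auto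
  have pos: "p (v + s) (v * s + t) (v + e/2) > 0"
    using e qpos[of "v + e/2"] unfolding pfac by (intro mult_pos_pos) auto
  have "\<forall>\<^sub>F n in sequentially. \<bar>tr3 (h n 0) - (v + s)\<bar> < e/2"
    using tendstoD[OF ltr, of "e/2"] e tr by (simp add: dist_real_def)
  moreover note order_tendstoD(2)[OF lp neg] order_tendstoD(1)[OF lp pos]
  ultimately have "\<forall>\<^sub>F n in sequentially. False"
  proof eventually_elim
    case (elim n)
    let ?a = "tr3 (h n 0)" and ?b = "minors3 (h n 0)"
    have "\<exists>x\<ge>v - e/2. x \<le> v + e/2 \<and> p ?a ?b x = 0"
    proof (rule IVT')
      show "continuous_on {v - e/2..v + e/2} (p ?a ?b)"
        unfolding p_def by (intro continuous_intros)
    qed (use elim e in auto)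
    then obtain x where x': "v - e/2 \<le> x" "x \<le> v + e/2" and x0: "p ?a ?b x = 0" by blast
    have x: "\<bar>x - v\<bar> \<le> e/2" using x' by linarith
    have "dist (?a, x) (v + s, v) \<le> \<bar>?a - (v + s)\<bar> + \<bar>x - v\<bar>"
      using sqrt_sum_squares_le_sum_abs[of "?a - (v + s)" "x - v"]
      unfolding dist_Pair_Pair dist_real_def power2_abs .
    also have "\<dots> < e / 2 + e / 2" by (rule add_less_le_mono[OF elim(1) x])
    finally have "dist (?a, x) (v + s, v) < e" by simp
    from good[OF this] have gx: "(?a - x)\<^sup>2 < 4 / x" "0 < x" "x < 1" by auto
    have "\<not> anosov k (h n)"
    proof (rule complex_eigenvalues_not_anosov[OF h(1) k, of n x "?a - x" "1 / x"])
      have "?b * x = 1 + ?a * x\<^sup>2 - x ^ 3" using x0 by (simp add: p_def algebra_simps)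
      then show "?b = x * (?a - x) + 1 / x"
        using gx by (simp add: field_simps power2_eq_square power3_eq_cube)
    qed (use gx in auto)
    then show False using an by blast
  qed
  then show False by simp
qed

section \<open>Spiral and hyperbolic matrices\<close>

definition conic_pt :: "real \<Rightarrow> real^3" where
  "conic_pt x = vector [1, x, x\<^sup>2]"

definition axis_vec :: "real^3" where
  "axis_vec = vector [1, 1, 1]"

text \<open>The general real circulant matrix, with eigenvalue \<open>z\<close> on (1,1,1) and x
  \<plusminus> i u sqrt 3 on the complement. Scaling \<open>u\<close> this way keeps the entries
  rational in the parameters, so that identities are plain polynomial algebra; the root enters only
  in \<open>spiral\<close>.\<close>

definition circulant :: "real \<Rightarrow> real \<Rightarrow> real \<Rightarrow> mat3" where
  "circulant x u z = vector
    [vector [(2*x + z)/3, (z - x)/3 - u, (z - x)/3 + u],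
     vector [(z - x)/3 + u, (2*x + z)/3, (z - x)/3 - u],
     vector [(z - x)/3 - u, (z - x)/3 + u, (2*x + z)/3]]"

text \<open>In an orthonormal basis adapted to the line spanned by $(1,1,1)$ and its orthogonal
  complement, \<open>spiral x y z\<close> is multiplication by the complex number $x + iy$ on the complement
  and by $z$ on the line.\<close>

definition spiral :: "real \<Rightarrow> real \<Rightarrow> real \<Rightarrow> mat3" where
  "spiral x y z = circulant x (y / sqrt 3) z"

abbreviation "projL \<equiv> spiral 0 0 1"
abbreviation "projV \<equiv> spiral 1 0 0"

lemma circulant_mult:
  "circulant x u z ** circulant x' u' z' = circulant (x*x' - 3*u*u') (x*u' + u*x') (z*z')"
proof -
  define C :: "real \<Rightarrow> real \<Rightarrow> real \<Rightarrow> mat3"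
    where "C d f g = vector [vector [d, f, g], vector [g, d, f], vector [f, g, d]]" for d f g
  have C: "circulant x u z = C ((2*x + z)/3) ((z - x)/3 - u) ((z - x)/3 + u)" for x u z
    by (simp add: circulant_def C_def)
  have "C d f g ** C d' f' g' = C (d*d' + f*g' + g*f') (d*f' + f*d' + g*g') (d*g' + f*f' + g*d')"
    for d f g d' f' g'
    by (simp add: C_def vec_eq_iff forall_3 matrix_matrix_mult_def sum_3)
  moreover have
    "(2*x + z)/3 * ((2*x' + z')/3) + ((z - x)/3 - u) * ((z' - x')/3 + u') + ((z - x)/3 + u) * ((z' - x')/3 - u')
      = (2 * (x*x' - 3*u*u') + z*z')/3"
    "(2*x + z)/3 * ((z' - x')/3 - u') + ((z - x)/3 - u) * ((2*x' + z')/3) + ((z - x)/3 + u) * ((z' - x')/3 + u')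
      = (z*z' - (x*x' - 3*u*u'))/3 - (x*u' + u*x')"
    "(2*x + z)/3 * ((z' - x')/3 + u') + ((z - x)/3 - u) * ((z' - x')/3 - u') + ((z - x)/3 + u) * ((2*x' + z')/3)
      = (z*z' - (x*x' - 3*u*u'))/3 + (x*u' + u*x')"
    by (simp_all add: field_simps)
  ultimately show ?thesis unfolding C by (simp only:)
qed

lemma spiral_mult: "spiral x y z ** spiral x' y' z' = spiral (x*x' - y*y') (x*y' + y*x') (z*z')"
proof -
  have "3 * (y / sqrt 3) * (y' / sqrt 3) = y * y'" by simp
  moreover have "x * (y' / sqrt 3) + y / sqrt 3 * x' = (x*y' + y*x') / sqrt 3"
    by (simp add: add_divide_distrib)
  ultimately show ?thesis unfolding spiral_def circulant_mult by simp
qed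

lemma spiral_one: "spiral 1 0 1 = mat 1"
  by (simp add: spiral_def circulant_def vec_eq_iff forall_3 mat_def)

lemma spiral_add: "spiral x y z + spiral x' y' z' = spiral (x + x') (y + y') (z + z')"
  by (simp add: spiral_def circulant_def vec_eq_iff forall_3 add_divide_distrib diff_divide_distrib)

lemma spiral_scale: "c *\<^sub>R spiral x y z = spiral (c * x) (c * y) (c * z)"
  by (simp add: spiral_def circulant_def vec_eq_iff forall_3 algebra_simps)

lemma det_spiral: "det (spiral x y z) = (x\<^sup>2 + y\<^sup>2) * z"
proof -
  have "det (circulant x u z) = (x\<^sup>2 + 3 * u\<^sup>2) * z" for u
    by (simp add: circulant_def det_3 field_simps power2_eq_square)
  then show ?thesis by (simp add: spiral_def power_divide)
qed

lemma tr3_spiral: "tr3 (spiral x y z) = z + 2 * x"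
  by (simp add: tr3_def spiral_def circulant_def field_simps)

lemma minors3_spiral: "minors3 (spiral x y z) = z * (2 * x) + (x\<^sup>2 + y\<^sup>2)"
proof -
  have "minors3 (circulant x u z) = z * (2 * x) + (x\<^sup>2 + 3 * u\<^sup>2)" for u
    by (simp add: circulant_def minors3_def field_simps power2_eq_square)
  then show ?thesis by (simp add: spiral_def power_divide)
qed

lemma spiral_axis_vec: "spiral x y z *v axis_vec = z *\<^sub>R axis_vec"
proof -
  have "circulant x u z *v axis_vec = z *\<^sub>R axis_vec" for u
    by (simp add: circulant_def axis_vec_def vec_eq_iff forall_3 matrix_vector_mult_def sum_3 field_simps)
  then show ?thesis by (simp add: spiral_def)
qed

lemma projL_vec: "projL *v v = ((v$1 + v$2 + v$3) / 3) *\<^sub>R axis_vec"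
  by (simp add: spiral_def circulant_def axis_vec_def vec_eq_iff forall_3 matrix_vector_mult_def sum_3
      field_simps)

lemma norm_spiral:
  "(norm (spiral x y z *v v))\<^sup>2 = (x\<^sup>2 + y\<^sup>2) * (norm (projV *v v))\<^sup>2 + z\<^sup>2 * (norm (projL *v v))\<^sup>2"
proof -
  \<comment> \<open>Coordinates adapted to the splitting: \<open>m\<close> is the component along
    (1,1,1), and \<open>a\<close>, \<open>b\<close> determine the component in the complement, whose
    coordinates sum to zero.\<close>
  define m a b where "m = (v$1 + v$2 + v$3) / 3" and "a = v$1 - m" and "b = v$2 - m"
  have v: "v$1 = a + m" "v$2 = b + m" "v$3 = m - a - b" by (simp_all add: m_def a_def b_def field_simps)
  have form: "circulant x u z *v v = vector [x * a + u * (- a - b - b) + z * m,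
      x * b + u * (a + a + b) + z * m, x * (- a - b) + u * (b - a) + z * m]" for x u z
    by (simp add: circulant_def vec_eq_iff forall_3 matrix_vector_mult_def sum_3 v field_simps)
  have "(norm (circulant x u z *v v))\<^sup>2
      = (x\<^sup>2 + 3 * u\<^sup>2) * (norm (circulant 1 0 0 *v v))\<^sup>2 + z\<^sup>2 * (norm (circulant 0 0 1 *v v))\<^sup>2" for u
    unfolding norm_vec3 form by (simp add: power2_eq_square algebra_simps)
  then show ?thesis by (simp add: spiral_def power_divide)
qed

lemma norm_spiral_le:
  assumes "x\<^sup>2 + y\<^sup>2 \<le> c\<^sup>2" "z\<^sup>2 \<le> c\<^sup>2" "c \<ge> 0"
  shows "norm (spiral x y z *v v) \<le> c * norm v"
proof -
  have "(norm v)\<^sup>2 = (norm (projV *v v))\<^sup>2 + (norm (projL *v v))\<^sup>2"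
    using norm_spiral[of 1 0 1 v] by (simp add: spiral_one)
  moreover have "(x\<^sup>2 + y\<^sup>2) * (norm (projV *v v))\<^sup>2 \<le> c\<^sup>2 * (norm (projV *v v))\<^sup>2"
    using assms(1) by (intro mult_right_mono) auto
  moreover have "z\<^sup>2 * (norm (projL *v v))\<^sup>2 \<le> c\<^sup>2 * (norm (projL *v v))\<^sup>2"
    using assms(2) by (intro mult_right_mono) auto
  ultimately have "(norm (spiral x y z *v v))\<^sup>2 \<le> (c * norm v)\<^sup>2"
    unfolding norm_spiral[of x y z] power_mult_distrib by (simp only: distrib_left add_mono)
  then show ?thesis
    by (rule power2_le_imp_le) (rule mult_nonneg_nonneg[OF assms(3) norm_ge_zero])
qed

definition spin :: "real \<Rightarrow> real \<Rightarrow> mat3" where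
  "spin l \<theta> = spiral (l * cos \<theta>) (l * sin \<theta>) (1 / l\<^sup>2)"

lemma spin_SL3: "l > 0 \<Longrightarrow> spin l \<theta> \<in> SL3"
  by (simp add: SL3_def spin_def det_spiral power_mult_distrib flip: distrib_left)

lemma spin_inverse:
  assumes "l > 0"
  shows "matrix_inv (spin l \<theta>) = spiral (cos \<theta> / l) (- sin \<theta> / l) (l\<^sup>2)"
proof (rule matrix_inv_eqI)
  have "cos \<theta> * cos \<theta> + sin \<theta> * sin \<theta> = 1" using sin_cos_squared_add3 by simp
  then show "spin l \<theta> ** spiral (cos \<theta> / l) (- sin \<theta> / l) (l\<^sup>2) = mat 1"
    using assms by (simp add: spin_def spiral_mult flip: spiral_one)
qed

lemma rep_spin_power:
  assumes "h 0 = spin l \<theta>"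
  shows "rep h (replicate n (0, False)) = spiral (l^n * cos (n * \<theta>)) (l^n * sin (n * \<theta>)) (1 / l^(2*n))"
proof (induction n)
  case 0 then show ?case by (simp add: spiral_one)
next
  case (Suc n)
  have "real (Suc n) * \<theta> = \<theta> + n * \<theta>" by (simp add: algebra_simps)
  then show ?case using Suc assms
    by (simp add: letter_mat_def spin_def spiral_mult cos_add sin_add algebra_simps power2_eq_square)
qed

lemma rep_spin_inverse_power:
  assumes "h 0 = spin l \<theta>" "l > 0"
  shows "rep h (replicate n (0, True)) = spiral (cos (n * \<theta>) / l^n) (- sin (n * \<theta>) / l^n) (l^(2*n))"
proof (induction n)
  case 0 then show ?case by (simp add: spiral_one)
next
  case (Suc n)
  have "real (Suc n) * \<theta> = \<theta> + n * \<theta>" by (simp add: algebra_simps)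
  then show ?case using Suc assms
    by (simp add: letter_mat_def spin_inverse spiral_mult cos_add sin_add power2_eq_square field_simps)
qed

text \<open>The rows of \<open>lag_mat s r t\<close> are the Lagrange interpolation functionals at the nodes
  $s$, $r$, $t$ on quadratic polynomials, dual to the points \<open>conic_pt s\<close>, \<open>conic_pt r\<close>, \<open>conic_pt t\<close>.\<close>

definition node_mat :: "real \<Rightarrow> real \<Rightarrow> real \<Rightarrow> mat3" where
  "node_mat s r t = transpose (vector [conic_pt s, conic_pt r, conic_pt t])"

definition lag :: "real \<Rightarrow> real \<Rightarrow> real \<Rightarrow> real^3" where
  "lag s r t = (1 / ((s - r) * (s - t))) *\<^sub>R vector [r * t, - (r + t), 1]"

definition lag_mat :: "real \<Rightarrow> real \<Rightarrow> real \<Rightarrow> mat3" where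
  "lag_mat s r t = vector [lag s r t, lag r s t, lag t s r]"

lemma lag_conic_pt: "lag s r t \<bullet> conic_pt x = (x - r) * (x - t) / ((s - r) * (s - t))"
proof -
  have "vector [r * t, - (r + t), 1] \<bullet> conic_pt x = (x - r) * (x - t)"
    by (simp add: conic_pt_def inner_vec_def sum_3 power2_eq_square algebra_simps)
  then show ?thesis by (simp add: lag_def)
qed

lemma lag_node_mat:
  assumes "s \<noteq> r" "s \<noteq> t" "r \<noteq> t"
  shows "lag_mat s r t ** node_mat s r t = mat 1"
proof -
  have "(lag_mat s r t ** node_mat s r t) $ i $ j = lag_mat s r t $ i \<bullet> transpose (node_mat s r t) $ j" for i j
    by (simp add: matrix_matrix_mult_def inner_vec_def transpose_def)
  then show ?thesis using assms
    by (simp add: vec_eq_iff forall_3 lag_mat_def node_mat_def lag_conic_pt mat_def)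
qed

lemma node_lag_mat:
  assumes "s \<noteq> r" "s \<noteq> t" "r \<noteq> t"
  shows "node_mat s r t ** lag_mat s r t = mat 1"
  using lag_node_mat[OF assms] matrix_left_right_inverse by blast

definition hyp_mat :: "real \<Rightarrow> real \<Rightarrow> real \<Rightarrow> real \<Rightarrow> real \<Rightarrow> real \<Rightarrow> mat3" where
  "hyp_mat s r t a b c = node_mat s r t ** diag3 a b c ** lag_mat s r t"

lemma diag3_mult: "diag3 a b c ** diag3 a' b' c' = diag3 (a * a') (b * b') (c * c')"
  by (simp add: vec_eq_iff forall_3 matrix_matrix_mult_def diag3_def sum_3)

lemma diag3_one: "diag3 1 1 1 = mat 1"
  by (simp add: vec_eq_iff forall_3 diag3_def mat_def)

lemma hyp_mult:
  assumes "s \<noteq> r" "s \<noteq> t" "r \<noteq> t"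
  shows "hyp_mat s r t a b c ** hyp_mat s r t a' b' c' = hyp_mat s r t (a * a') (b * b') (c * c')"
proof -
  have "hyp_mat s r t a b c ** hyp_mat s r t a' b' c'
    = node_mat s r t ** diag3 a b c ** (lag_mat s r t ** node_mat s r t) ** diag3 a' b' c' ** lag_mat s r t"
    unfolding hyp_mat_def by (simp only: matrix_mul_assoc)
  also have "\<dots> = node_mat s r t ** (diag3 a b c ** diag3 a' b' c') ** lag_mat s r t"
    by (simp add: lag_node_mat[OF assms] matrix_mul_assoc)
  finally show ?thesis by (simp add: hyp_mat_def diag3_mult)
qed

lemma hyp_one:
  assumes "s \<noteq> r" "s \<noteq> t" "r \<noteq> t"
  shows "hyp_mat s r t 1 1 1 = mat 1"
  by (simp add: hyp_mat_def diag3_one node_lag_mat[OF assms])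

lemma det_hyp:
  assumes "s \<noteq> r" "s \<noteq> t" "r \<noteq> t"
  shows "det (hyp_mat s r t a b c) = a * b * c"
proof -
  have "det (node_mat s r t) * det (lag_mat s r t) = 1"
    by (metis node_lag_mat[OF assms] det_mul det_I)
  then show ?thesis by (simp add: hyp_mat_def det_mul det_diag3)
qed

lemma hyp_vec:
  "hyp_mat s r t a b c *v v = (a * (lag s r t \<bullet> v)) *\<^sub>R conic_pt s + (b * (lag r s t \<bullet> v)) *\<^sub>R conic_pt r
    + (c * (lag t s r \<bullet> v)) *\<^sub>R conic_pt t"
proof -
  have "lag_mat s r t *v v = vector [lag s r t \<bullet> v, lag r s t \<bullet> v, lag t s r \<bullet> v]"
    by (simp add: vec_eq_iff forall_3 lag_mat_def matrix_vector_mult_def inner_vec_def)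
  moreover have "node_mat s r t *v w = w$1 *\<^sub>R conic_pt s + w$2 *\<^sub>R conic_pt r + w$3 *\<^sub>R conic_pt t" for w
    by (simp add: vec_eq_iff forall_3 node_mat_def transpose_def matrix_vector_mult_def sum_3 mult.commute)
  ultimately show ?thesis
    by (simp add: hyp_mat_def diag3_vec flip: matrix_vector_mul_assoc)
qed

text \<open>Puts the inverse of a hyperbolic generator, whose dominant eigenvector is the old
  weakest one, into the same form with the dominant eigenvalue first.\<close>

lemma hyp_swap: "hyp_mat s r t a b c = hyp_mat t r s c b a"
proof -
  have "hyp_mat s r t a b c *v v = hyp_mat t r s c b a *v v" for v
  proof -
    have "lag u v w = lag u w v" for u v w :: real by (simp add: lag_def mult.commute add.commute)
    then show ?thesis by (simp add: hyp_vec add.commute add.left_commute)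
  qed
  then show ?thesis by (simp add: matrix_eq)
qed

section \<open>Contraction estimates\<close>

text \<open>Generator i \<ge> 1 has its eigenvectors at the conic parameters 3i+10, 3i+11, 3i+12;
  its inverse has the same ones in reverse order. All parameters are at least 10 because the
  inequalities in \<open>quadratic_form_estimates\<close> need it. Those in use start at 13, which
  leaves 10 free for the starting vector.\<close>

definition attr_node :: "nat \<times> bool \<Rightarrow> real" where
  "attr_node x = (if snd x then 3 * real (fst x) + 12 else 3 * real (fst x) + 10)"

definition opp :: "nat \<times> bool \<Rightarrow> nat \<times> bool" where
  "opp x = (fst x, \<not> snd x)"

definition mid_node :: "nat \<times> bool \<Rightarrow> real" where
  "mid_node x = 3 * real (fst x) + 11"

text \<open>The exponents 5, -1, -4 sum to zero, and their differences 6, 9, 3 and negatives are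
  distinct and nonzero, which later separates the root spaces. The matrix and its inverse both have
  a dominant eigenvalue, with ratio at least N^3 to the next.\<close>

definition spin_rep :: "real \<Rightarrow> real \<Rightarrow> nat \<Rightarrow> mat3" where
  "spin_rep N l i = (if i = 0 then spin l (2 * pi / 3)
    else hyp_mat (3 * real i + 10) (3 * real i + 11) (3 * real i + 12) (N^5) (1/N) (1/N^4))"

lemma hyp_inverse:
  assumes "s \<noteq> r" "s \<noteq> t" "r \<noteq> t" "a \<noteq> 0" "b \<noteq> 0" "c \<noteq> 0"
  shows "matrix_inv (hyp_mat s r t a b c) = hyp_mat s r t (1/a) (1/b) (1/c)"
  using assms by (intro matrix_inv_eqI) (simp add: hyp_mult hyp_one)

lemma spin_rep_letter:
  assumes "fst x > 0" "N > 0"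
  obtains a b c where "letter_mat (spin_rep N l) x = hyp_mat (attr_node x) (mid_node x) (attr_node (opp x)) a b c"
    "a \<in> {N^4, N^5}" "b \<in> {N, 1/N}" "c \<in> {1/N^4, 1/N^5}"
proof (cases "snd x")
  case False
  show ?thesis
    by (rule that[of "N^5" "1/N" "1/N^4"])
      (use False assms in \<open>auto simp: letter_mat_def spin_rep_def attr_node_def mid_node_def opp_def field_simps\<close>)
next
  case True
  let ?i = "real (fst x)"
  have "letter_mat (spin_rep N l) x = hyp_mat (3 * ?i + 10) (3 * ?i + 11) (3 * ?i + 12) (1/N^5) (1/(1/N)) (1/(1/N^4))"
    using True assms by (simp add: letter_mat_def spin_rep_def hyp_inverse)
  also have "\<dots> = hyp_mat (3 * ?i + 12) (3 * ?i + 11) (3 * ?i + 10) (N^4) N (1/N^5)"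
    by (subst hyp_swap) simp
  finally show ?thesis
    by (intro that[of "N^4" N "1/N^5"]) (use True in \<open>auto simp: attr_node_def mid_node_def opp_def\<close>)
qed

lemma spin_rep_hom_tuple: assumes "N > 0" "l > 0" shows "hom_tuple k (spin_rep N l)"
  unfolding hom_tuple_def
proof (intro allI impI)
  fix i
  have "N^5 * (1/N) * (1/N^4) = 1" using assms by (simp add: eval_nat_numeral)
  then show "spin_rep N l i \<in> SL3"
    using assms spin_SL3 by (cases "i = 0") (simp_all add: spin_rep_def SL3_def det_hyp)
qed

text \<open>A neighbourhood of a projective point that also remembers the scale
  \<open>\<tau>\<close>, so that one relation controls both direction and growth.\<close>

definition near :: "real \<Rightarrow> real \<Rightarrow> real^3 \<Rightarrow> real^3 \<Rightarrow> bool" where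
  "near \<eta> \<tau> w v \<longleftrightarrow> norm (v - \<tau> *\<^sub>R w) \<le> \<eta> * \<bar>\<tau>\<bar>"

lemma near_mono: "near \<eta> \<tau> w v \<Longrightarrow> \<eta> \<le> \<eta>' \<Longrightarrow> near \<eta>' \<tau> w v"
  unfolding near_def by (meson abs_ge_zero mult_right_mono order_trans)

lemma near_norm_le: assumes "near \<eta> \<tau> w v" shows "norm v \<le> (norm w + \<eta>) * \<bar>\<tau>\<bar>"
proof -
  have "norm v \<le> norm (v - \<tau> *\<^sub>R w) + norm (\<tau> *\<^sub>R w)"
    using norm_triangle_ineq[of "v - \<tau> *\<^sub>R w" "\<tau> *\<^sub>R w"] by simp
  then show ?thesis using assms by (simp add: near_def algebra_simps)
qed

lemma near_norm_ge: assumes "near \<eta> \<tau> w v" shows "(norm w - \<eta>) * \<bar>\<tau>\<bar> \<le> norm v"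
proof -
  have "norm (\<tau> *\<^sub>R w) \<le> norm (v - \<tau> *\<^sub>R w) + norm v"
    using norm_triangle_ineq4[of v "v - \<tau> *\<^sub>R w"] by simp
  then show ?thesis using assms by (simp add: near_def algebra_simps)
qed

lemma near_inner_ge:
  assumes "near \<eta> \<tau> w v" shows "(\<bar>f \<bullet> w\<bar> - norm f * \<eta>) * \<bar>\<tau>\<bar> \<le> \<bar>f \<bullet> v\<bar>"
proof -
  have "\<bar>f \<bullet> (v - \<tau> *\<^sub>R w)\<bar> \<le> norm f * norm (v - \<tau> *\<^sub>R w)" by (rule Cauchy_Schwarz_ineq2)
  also have "\<dots> \<le> norm f * (\<eta> * \<bar>\<tau>\<bar>)" using assms by (intro mult_left_mono) (auto simp: near_def)
  finally have "\<bar>f \<bullet> v - \<tau> * (f \<bullet> w)\<bar> \<le> norm f * \<eta> * \<bar>\<tau>\<bar>"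
    by (simp add: inner_diff_right mult.assoc)
  moreover have "\<bar>\<tau> * (f \<bullet> w)\<bar> = \<bar>f \<bullet> w\<bar> * \<bar>\<tau>\<bar>" by (simp add: abs_mult)
  ultimately show ?thesis unfolding left_diff_distrib by linarith
qed

text \<open>The coordinate along the attracting eigenvector is at least
  \<open>\<kappa> * \<bar>\<tau>\<bar>\<close> near \<open>w\<close> and is multiplied by
  \<open>a\<close>; the other two are smaller by a factor \<open>B\<close>. The radius is halved
  because a following block of powers of the spiral generator consumes the gain. Stating it with
  \<open>at_right 0\<close> lets finitely many such conditions be intersected.\<close>

lemma hyp_contracts:
  assumes "lag s r t \<bullet> w \<noteq> 0"
  shows "\<forall>\<^sub>F \<eta> in at_right 0. \<exists>B\<ge>1. \<forall>a b c v \<tau>. B \<le> a \<longrightarrow> B * \<bar>b\<bar> \<le> a \<longrightarrow> B * \<bar>c\<bar> \<le> a \<longrightarrow>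
    near \<eta> \<tau> w v \<longrightarrow> (\<exists>\<tau>'. near (\<eta>/2) \<tau>' (conic_pt s) (hyp_mat s r t a b c *v v) \<and> 2 * \<bar>\<tau>\<bar> \<le> \<bar>\<tau>'\<bar>)"
proof -
  let ?f = "lag s r t"
  define \<kappa> where "\<kappa> = \<bar>?f \<bullet> w\<bar> / 2"
  have \<kappa>: "\<kappa> > 0" using assms by (simp add: \<kappa>_def)
  have "\<forall>\<^sub>F \<eta> in at_right 0. \<eta> < \<kappa> / (norm ?f + 1)"
    using \<kappa> by (intro order_tendstoD(2)[OF tendsto_ident_at]) (simp add: add_nonneg_pos)
  moreover have "\<forall>\<^sub>F \<eta> in at_right 0. (\<eta>::real) > 0" by (rule eventually_at_right_less)
  ultimately show ?thesis
  proof eventually_elim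
    case (elim \<eta>)
    have fe: "norm ?f * \<eta> \<le> \<kappa>"
    proof -
      have "\<eta> * (norm ?f + 1) < \<kappa>"
        using elim(1) by (simp add: pos_less_divide_eq add_nonneg_pos)
      moreover have "\<eta> * (norm ?f + 1) = norm ?f * \<eta> + \<eta>" by (simp add: algebra_simps)
      ultimately show ?thesis using elim(2) by linarith
    qed
    define C where "C = (norm (lag r s t) * norm (conic_pt r) + norm (lag t s r) * norm (conic_pt t)) * (norm w + \<eta>)"
    have C: "C \<ge> 0" using elim(2) by (simp add: C_def)
    \<comment> \<open>The term \<open>2 / \<kappa>\<close> yields the doubling of the scale, and the
      last term brings the error down to radius \<open>\<eta>/2\<close>.\<close>
    define B where "B = max 1 (max (2 / \<kappa>) (2 * C / (\<eta> * \<kappa>)))"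
    have B: "B \<ge> 1" "2 \<le> B * \<kappa>" "2 * C \<le> B * (\<eta> * \<kappa>)"
    proof -
      show "B \<ge> 1" by (simp add: B_def)
      have "2 / \<kappa> \<le> B" "2 * C / (\<eta> * \<kappa>) \<le> B" by (simp_all add: B_def)
      then show "2 \<le> B * \<kappa>" "2 * C \<le> B * (\<eta> * \<kappa>)"
        using \<kappa> elim(2) by (simp_all add: pos_divide_le_eq)
    qed
    show ?case
    proof (rule exI[of _ B], intro conjI allI impI)
      show "1 \<le> B" by fact
      fix a b c v \<tau>
      assume abc: "B \<le> a" "B * \<bar>b\<bar> \<le> a" "B * \<bar>c\<bar> \<le> a" and nr: "near \<eta> \<tau> w v"
      have a: "a > 0" using abc B by linarith
      have fv: "\<kappa> * \<bar>\<tau>\<bar> \<le> \<bar>?f \<bullet> v\<bar>"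
      proof -
        have "\<kappa> * \<bar>\<tau>\<bar> \<le> (\<bar>?f \<bullet> w\<bar> - norm ?f * \<eta>) * \<bar>\<tau>\<bar>"
          using fe by (intro mult_right_mono) (auto simp: \<kappa>_def)
        then show ?thesis using near_inner_ge[OF nr, of ?f] by linarith
      qed
      let ?t = "a * (?f \<bullet> v)"
      have ta: "\<bar>?t\<bar> = a * \<bar>?f \<bullet> v\<bar>" using a by (simp add: abs_mult)
      have big: "a * (\<kappa> * \<bar>\<tau>\<bar>) \<le> \<bar>?t\<bar>" unfolding ta using fv a by (intro mult_left_mono) auto
      have nv: "norm v \<le> (norm w + \<eta>) * \<bar>\<tau>\<bar>" by (rule near_norm_le[OF nr])
      have rest: "norm (hyp_mat s r t a b c *v v - ?t *\<^sub>R conic_pt s)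
        \<le> \<bar>b\<bar> * (norm (lag r s t) * norm v) * norm (conic_pt r) + \<bar>c\<bar> * (norm (lag t s r) * norm v) * norm (conic_pt t)"
      proof -
        have "hyp_mat s r t a b c *v v - ?t *\<^sub>R conic_pt s
            = (b * (lag r s t \<bullet> v)) *\<^sub>R conic_pt r + (c * (lag t s r \<bullet> v)) *\<^sub>R conic_pt t"
          by (simp add: hyp_vec)
        then have "norm (hyp_mat s r t a b c *v v - ?t *\<^sub>R conic_pt s)
          \<le> norm ((b * (lag r s t \<bullet> v)) *\<^sub>R conic_pt r) + norm ((c * (lag t s r \<bullet> v)) *\<^sub>R conic_pt t)"
          by (simp only: norm_triangle_ineq)
        also have "\<dots> \<le> \<bar>b\<bar> * (norm (lag r s t) * norm v) * norm (conic_pt r)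
            + \<bar>c\<bar> * (norm (lag t s r) * norm v) * norm (conic_pt t)"
          unfolding norm_scaleR abs_mult
          by (intro add_mono mult_right_mono mult_left_mono Cauchy_Schwarz_ineq2) auto
        finally show ?thesis .
      qed
      have "B * norm (hyp_mat s r t a b c *v v - ?t *\<^sub>R conic_pt s)
        \<le> (B * \<bar>b\<bar>) * (norm (lag r s t) * norm v * norm (conic_pt r))
          + (B * \<bar>c\<bar>) * (norm (lag t s r) * norm v * norm (conic_pt t))"
        using mult_left_mono[OF rest, of B] B(1) by (simp add: algebra_simps)
      also have "\<dots> \<le> a * (norm (lag r s t) * norm v * norm (conic_pt r))
          + a * (norm (lag t s r) * norm v * norm (conic_pt t))"
        using abc by (intro add_mono mult_right_mono) auto
      also have "\<dots> = a * ((norm (lag r s t) * norm (conic_pt r) + norm (lag t s r) * norm (conic_pt t)) * norm v)"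
        by (simp add: algebra_simps)
      also have "\<dots> \<le> a * (C * \<bar>\<tau>\<bar>)"
        unfolding C_def mult.assoc using nv a by (intro mult_left_mono) auto
      also have "\<dots> \<le> a * ((B * (\<eta> * \<kappa>) / 2) * \<bar>\<tau>\<bar>)"
        using B(3) a by (intro mult_left_mono mult_right_mono) auto
      also have "\<dots> = B * (\<eta> / 2 * (a * (\<kappa> * \<bar>\<tau>\<bar>)))" by (simp add: algebra_simps)
      also have "\<dots> \<le> B * (\<eta> / 2 * \<bar>?t\<bar>)"
        using big B(1) elim(2) by (intro mult_left_mono) auto
      finally have "norm (hyp_mat s r t a b c *v v - ?t *\<^sub>R conic_pt s) \<le> \<eta> / 2 * \<bar>?t\<bar>"
        using B(1) by simp
      moreover have "2 * \<bar>\<tau>\<bar> \<le> \<bar>?t\<bar>"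
      proof -
        have "2 * \<bar>\<tau>\<bar> \<le> (B * \<kappa>) * \<bar>\<tau>\<bar>" using B(2) by (intro mult_right_mono) auto
        also have "\<dots> \<le> (a * \<kappa>) * \<bar>\<tau>\<bar>" using abc(1) \<kappa> by (intro mult_right_mono) auto
        finally show ?thesis using big by (simp add: mult.assoc)
      qed
      ultimately show "\<exists>\<tau>'. near (\<eta>/2) \<tau>' (conic_pt s) (hyp_mat s r t a b c *v v) \<and> 2 * \<bar>\<tau>\<bar> \<le> \<bar>\<tau>'\<bar>"
        unfolding near_def by blast
    qed
  qed
qed

definition functional :: "nat \<times> bool \<Rightarrow> real^3" where
  "functional x = lag (attr_node x) (mid_node x) (attr_node (opp x))"

lemma letter_contracts:
  assumes "fst x > 0" "functional x \<bullet> w \<noteq> 0"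
  shows "\<forall>\<^sub>F \<eta> in at_right 0. \<forall>\<^sub>F N in at_top. \<forall>l v \<tau>. near \<eta> \<tau> w v \<longrightarrow>
    (\<exists>\<tau>'. near (\<eta>/2) \<tau>' (conic_pt (attr_node x)) (letter_mat (spin_rep N l) x *v v) \<and> 2 * \<bar>\<tau>\<bar> \<le> \<bar>\<tau>'\<bar>)"
  using hyp_contracts[OF assms(2)[unfolded functional_def]]
proof eventually_elim
  case (elim \<eta>)
  then obtain B where B: "B \<ge> 1" and con: "\<And>a b c v \<tau>. B \<le> a \<Longrightarrow> B * \<bar>b\<bar> \<le> a \<Longrightarrow> B * \<bar>c\<bar> \<le> a \<Longrightarrow>
    near \<eta> \<tau> w v \<Longrightarrow> (\<exists>\<tau>'. near (\<eta>/2) \<tau>' (conic_pt (attr_node x))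
      (hyp_mat (attr_node x) (mid_node x) (attr_node (opp x)) a b c *v v) \<and> 2 * \<bar>\<tau>\<bar> \<le> \<bar>\<tau>'\<bar>)"
    by blast
  have "\<forall>\<^sub>F N in at_top. N \<ge> B" by (rule eventually_ge_at_top)
  then show ?case
  proof eventually_elim
    case (elim N)
    have N: "N \<ge> 1" using elim B by linarith
    show ?case
    proof (intro allI impI)
      fix l v \<tau> assume nr: "near \<eta> \<tau> w v"
      obtain a b c where abc: "letter_mat (spin_rep N l) x = hyp_mat (attr_node x) (mid_node x) (attr_node (opp x)) a b c"
        "a \<in> {N^4, N^5}" "b \<in> {N, 1/N}" "c \<in> {1/N^4, 1/N^5}"
        using spin_rep_letter[OF assms(1), of N l] N by auto
      have Na: "N^2 \<le> a"
        using abc(2) N power_increasing[of 2 4 N] power_increasing[of 2 5 N] by auto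
      have q: "N * N \<le> a" using Na by (simp add: power2_eq_square)
      have "1 * N \<le> N * N" using N by (intro mult_right_mono) auto
      then have Ba: "B \<le> a" using elim q by linarith
      have bN: "\<bar>b\<bar> \<le> N"
      proof -
        have "\<bar>1 / N\<bar> \<le> 1" using N by simp
        then have "\<bar>1 / N\<bar> \<le> N" using N by (rule order_trans)
        moreover have "\<bar>N\<bar> \<le> N" using N by simp
        ultimately show ?thesis using abc(3) by blast
      qed
      have cN: "\<bar>c\<bar> \<le> N"
      proof -
        have "\<bar>1 / N^4\<bar> \<le> 1" "\<bar>1 / N^5\<bar> \<le> 1" using N by simp_all
        then have "\<bar>1 / N^4\<bar> \<le> N" "\<bar>1 / N^5\<bar> \<le> N" using N by (blast intro: order_trans)+
        then show ?thesis using abc(4) by blast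
      qed
      have "B * \<bar>b\<bar> \<le> N * N" using elim bN B by (intro mult_mono) auto
      moreover have "B * \<bar>c\<bar> \<le> N * N" using elim cN B by (intro mult_mono) auto
      ultimately show "\<exists>\<tau>'. near (\<eta>/2) \<tau>' (conic_pt (attr_node x)) (letter_mat (spin_rep N l) x *v v) \<and> 2 * \<bar>\<tau>\<bar> \<le> \<bar>\<tau>'\<bar>"
        unfolding abc(1) using q Ba by (intro con[OF _ _ _ nr]) auto
    qed
  qed
qed

definition params :: "nat \<Rightarrow> real set" where
  "params k = insert 10 (attr_node ` ({1..<k} \<times> UNIV))"

lemma finite_params: "finite (params k)"
  by (simp add: params_def)

lemma params_ge: "y \<in> params k \<Longrightarrow> y \<ge> 10"
  by (auto simp: params_def attr_node_def)

lemma attr_params: "0 < fst x \<Longrightarrow> fst x < k \<Longrightarrow> attr_node x \<in> params k"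
  by (cases x) (auto simp: params_def)

text \<open>The limit direction of a^j applied to a conic point: the component along the axis is
  dropped, since it becomes negligible against the growing planar component.\<close>

definition rotated :: "nat \<Rightarrow> real \<Rightarrow> real^3" where
  "rotated j y = spiral (cos (j * (2 * pi / 3))) (sin (j * (2 * pi / 3))) 0 *v conic_pt y"

lemma rotated_mod_3: "rotated n y = rotated (n mod 3) y"
proof -
  have "real n = real (3 * (n div 3) + n mod 3)" by simp
  also have "\<dots> = 3 * real (n div 3) + real (n mod 3)" by (simp only: of_nat_add of_nat_mult of_nat_numeral)
  finally have n: "real n * (2 * pi / 3) = real (n mod 3) * (2 * pi / 3) + 2 * pi * real (n div 3)"
    by (simp add: algebra_simps)
  have per: "cos (2 * pi * real m) = 1" "sin (2 * pi * real m) = 0" for m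
    using cos_2npi[of m] sin_2npi[of m] by (simp_all add: mult.commute mult.left_commute)
  have "cos (real n * (2 * pi / 3)) = cos (real (n mod 3) * (2 * pi / 3))"
    "sin (real n * (2 * pi / 3)) = sin (real (n mod 3) * (2 * pi / 3))"
    unfolding n cos_add sin_add per by simp_all
  then show ?thesis by (simp add: rotated_def)
qed

text \<open>With p(x) = (x - r)(x - t), the factor (r - 1)(t - 1) is p(1) and 1 + x + x^2 is the
  coordinate sum of the conic point. The three left sides are 3 times the functional of p on the
  cyclic shifts of (1, x, x^2), so the differences are its values on the rotated planar parts. For
  parameters at least 10 the right side lies between 0.8 and 1.2 times x^2 r t: more than the first
  two left sides, less than the third.\<close>

lemma quadratic_form_estimates:
  fixes r t x :: real
  assumes "r \<ge> 10" "t \<ge> 10" "x \<ge> 10"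
  shows "3 * ((x - r) * (x - t)) < (1 + x + x\<^sup>2) * ((r - 1) * (t - 1))"
    and "3 * (r * t * x - (r + t) * x\<^sup>2 + 1) < (1 + x + x\<^sup>2) * ((r - 1) * (t - 1))"
    and "3 * (r * t * x\<^sup>2 - (r + t) + x) > (1 + x + x\<^sup>2) * ((r - 1) * (t - 1))"
proof -
  define S T where "S = (r - 1) * (t - 1)" and "T = 1 + x + x\<^sup>2"
  have rt: "r * t \<ge> 10 * r" "r * t \<ge> 10 * t" using assms by (simp_all add: mult.commute)
  have S1: "S \<ge> (8 / 10) * (r * t)" and S2: "S \<le> r * t" and S3: "S \<ge> 80"
  proof -
    have e: "S = r * t - r - t + 1" by (simp add: S_def algebra_simps)
    show "S \<ge> (8 / 10) * (r * t)" using rt unfolding e by linarith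
    show "S \<le> r * t" using assms unfolding e by linarith
    show "S \<ge> 80" using rt assms unfolding e by linarith
  qed
  have xx: "x\<^sup>2 \<ge> 10 * x" using assms by (simp add: power2_eq_square)
  have T1: "T \<ge> x\<^sup>2" "T \<ge> 100" and T2: "T \<le> (12 / 10) * x\<^sup>2"
    using xx assms by (simp_all add: T_def)
  have rt0: "r * t \<ge> 100" using rt assms by linarith
  have xrt: "x\<^sup>2 * (r * t) \<ge> 10 * (x * (r * t))"
    using mult_right_mono[OF xx, of "r * t"] rt0 by (simp add: mult.assoc)
  have xrt0: "x * (r * t) \<ge> 10 * (r * t)" using assms rt0 by (intro mult_right_mono) auto
  have TS: "T * S \<ge> x\<^sup>2 * ((8 / 10) * (r * t))"
    using T1 S1 rt0 by (intro mult_mono) auto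
  have TS1: "T * S \<ge> x\<^sup>2 * 80" using T1 S3 by (intro mult_mono) auto
  have "x * r \<ge> 0" "x * t \<ge> 0" using assms by auto
  then have "3 * ((x - r) * (x - t)) \<le> 3 * x\<^sup>2 + 3 * (r * t)"
    by (simp add: algebra_simps power2_eq_square)
  also have "\<dots> < T * S" using TS TS1 xrt xrt0 rt0 xx assms by linarith
  finally show "3 * ((x - r) * (x - t)) < (1 + x + x\<^sup>2) * ((r - 1) * (t - 1))"
    by (simp only: T_def S_def)
  have "(r + t) * x\<^sup>2 \<ge> 0" using assms by auto
  then have "3 * (r * t * x - (r + t) * x\<^sup>2 + 1) \<le> 3 * (x * (r * t)) + 3"
    by (simp add: algebra_simps)
  also have "\<dots> < T * S" using TS xrt xrt0 rt0 by linarith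
  finally show "3 * (r * t * x - (r + t) * x\<^sup>2 + 1) < (1 + x + x\<^sup>2) * ((r - 1) * (t - 1))"
    by (simp only: T_def S_def)
  have "T * S \<le> ((12 / 10) * x\<^sup>2) * (r * t)" using T2 S2 S3 by (intro mult_mono) auto
  also have "\<dots> < 3 * (r * t * x\<^sup>2 - (r + t) + x)"
  proof -
    have "(12 / 10) * (x\<^sup>2 * (r * t)) < 3 * (x\<^sup>2 * (r * t) - (r + t) + x)"
      using xrt xrt0 rt assms by argo
    then show ?thesis by (simp add: ac_simps)
  qed
  finally show "3 * (r * t * x\<^sup>2 - (r + t) + x) > (1 + x + x\<^sup>2) * ((r - 1) * (t - 1))"
    by (simp only: T_def S_def)
qed

text \<open>A rotation by a multiple of 2\<pi>/3 permutes the coordinates cyclically and the missing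
  axis component subtracts their mean; \<open>quadratic_form_estimates\<close> treats the three
  shifts.\<close>

lemma lag_rotated_nonzero:
  assumes "s \<noteq> r" "s \<noteq> t" "r \<ge> 10" "t \<ge> 10" "y \<ge> 10" "j < 3"
  shows "lag s r t \<bullet> rotated j y \<noteq> 0"
proof -
  define f :: "real^3" where "f = vector [r * t, - (r + t), 1]"
  have c1: "cos (2 * pi / 3) = - 1 / 2" "sin (2 * pi / 3) = sqrt 3 / 2"
    using cos_120 sin_120 by (simp_all add: mult.commute)
  have "cos (2 * (2 * pi / 3)) = - 1 / 2" "sin (2 * (2 * pi / 3)) = - sqrt 3 / 2"
    by (simp_all only: cos_double sin_double c1) (simp_all add: power2_eq_square)
  then have c2: "cos (4 * pi / 3) = - 1 / 2" "sin (4 * pi / 3) = - sqrt 3 / 2" by simp_all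
  have "j = 0 \<or> j = 1 \<or> j = 2" using assms by auto
  then have "rotated j y = circulant 1 0 0 *v conic_pt y \<or> rotated j y = circulant (- 1/2) (1/2) 0 *v conic_pt y
      \<or> rotated j y = circulant (- 1/2) (- 1/2) 0 *v conic_pt y"
    by (elim disjE) (simp_all add: rotated_def spiral_def c1 c2)
  moreover note e = quadratic_form_estimates[OF assms(3-5)]
  have "3 * (f \<bullet> (circulant 1 0 0 *v conic_pt y)) = 3 * ((y - r) * (y - t)) - (1 + y + y\<^sup>2) * ((r - 1) * (t - 1))"
    "3 * (f \<bullet> (circulant (- 1/2) (- 1/2) 0 *v conic_pt y))
      = 3 * (r * t * y - (r + t) * y\<^sup>2 + 1) - (1 + y + y\<^sup>2) * ((r - 1) * (t - 1))"
    "3 * (f \<bullet> (circulant (- 1/2) (1/2) 0 *v conic_pt y))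
      = 3 * (r * t * y\<^sup>2 - (r + t) + y) - (1 + y + y\<^sup>2) * ((r - 1) * (t - 1))"
    by (simp_all add: f_def inner_vec_def sum_3 circulant_def conic_pt_def matrix_vector_mult_def
        field_simps power2_eq_square)
  ultimately have "f \<bullet> rotated j y \<noteq> 0" using e by auto
  then show ?thesis using assms by (simp add: lag_def f_def)
qed

section \<open>Quasi-isometry by ping-pong\<close>

text \<open>For each hyperbolic letter, the directions a vector may have when that letter is applied
  to it: the start vector or the attracting point of a letter that does not cancel, the axis after
  negative powers of the spiral, or a rotated conic point after positive powers.\<close>

definition pairs :: "nat \<Rightarrow> ((nat \<times> bool) \<times> (real^3)) set" where
  "pairs k = (SIGMA x:{1..<k} \<times> UNIV. conic_pt ` (params k - {attr_node (opp x)}) \<union> {axis_vec}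
     \<union> (\<Union>j\<in>{..<3}. rotated j ` params k))"

lemma finite_pairs: "finite (pairs k)"
  unfolding pairs_def using finite_params by (intro finite_SigmaI) auto

text \<open>Modulo 3 the attracting parameters of generators, the middle parameters and the
  attracting parameters of inverses are 1, 2 and 0.\<close>

lemma attr_inj: "attr_node x = attr_node y \<Longrightarrow> x = y"
proof -
  assume "attr_node x = attr_node y"
  then have "real (3 * fst x + (if snd x then 12 else 10)) = real (3 * fst y + (if snd y then 12 else 10))"
    by (auto simp: attr_node_def split: if_splits)
  then have "3 * fst x + (if snd x then 12 else 10) = 3 * fst y + (if snd y then 12 else (10::nat))"
    by (simp only: of_nat_eq_iff)
  then show "x = y" by (cases x; cases y) (auto split: if_splits; presburger)
qed

lemma attr_neq_mid: "attr_node x \<noteq> mid_node y"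
proof
  assume "attr_node x = mid_node y"
  then have "real (3 * fst x + (if snd x then 12 else 10)) = real (3 * fst y + 11)"
    by (auto simp: attr_node_def mid_node_def split: if_splits)
  then have "3 * fst x + (if snd x then 12 else 10) = 3 * fst y + (11::nat)"
    by (simp only: of_nat_eq_iff)
  then show False by (auto split: if_splits; presburger)
qed

lemma functional_pairs_nonzero:
  assumes "(x, w) \<in> pairs k"
  shows "fst x > 0" "functional x \<bullet> w \<noteq> 0"
proof -
  show x: "fst x > 0" using assms by (auto simp: pairs_def)
  have d: "attr_node x \<noteq> mid_node x" "attr_node x \<noteq> attr_node (opp x)" "mid_node x \<ge> 10" "attr_node (opp x) \<ge> 10"
    using attr_neq_mid attr_inj[of x "opp x"] by (auto simp: mid_node_def attr_node_def opp_def)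
  consider y where "w = conic_pt y" "y \<in> params k" "y \<noteq> attr_node (opp x)" | "w = axis_vec"
    | j y where "w = rotated j y" "j < 3" "y \<in> params k"
    using assms by (auto simp: pairs_def)
  then show "functional x \<bullet> w \<noteq> 0"
  proof cases
    case 1
    from 1(2) consider "y = 10" | z where "y = attr_node z" by (auto simp: params_def)
    then have "y \<noteq> mid_node x"
      by cases (simp_all add: attr_neq_mid, simp add: mid_node_def)
    then show ?thesis using 1 d by (simp add: functional_def lag_conic_pt)
  next
    case 2
    \<comment> \<open>The axis is the conic point at 1, below all eigenvector parameters, so no
      Lagrange polynomial vanishes there.\<close>
    then have "w = conic_pt 1" by (simp add: axis_vec_def conic_pt_def)
    then show ?thesis using d by (simp add: functional_def lag_conic_pt)
  next
    case 3
    then show ?thesis using d params_ge unfolding functional_def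
      by (simp add: lag_rotated_nonzero)
  qed
qed

text \<open>Positive powers turn the error \<open>\<eta>/2\<close> in the plane isometrically up to
  the factor \<open>l^n\<close>; the axis part is bounded and costs another \<open>\<eta>/2\<close>
  once \<open>l\<close> is large. Negative powers favour the axis, where the conic point has the
  component (1 + y + y^2)/3 \<ge> 1. Since \<open>l \<le> l^n\<close>, one \<open>l\<close> serves
  all n \<ge> 1, and \<open>N\<close> does not enter the spiral generator at all.\<close>

lemma spin_contracts:
  assumes y: "y \<ge> 10" and \<eta>: "\<eta> > 0"
  shows "\<forall>\<^sub>F l in at_top. \<forall>N n v \<tau>. n \<ge> 1 \<longrightarrow> near (\<eta>/2) \<tau> (conic_pt y) v \<longrightarrow>
    near \<eta> (\<tau> * l^n) (rotated n y) (rep (spin_rep N l) (replicate n (0, False)) *v v) \<and>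
    (\<exists>\<tau>'. near \<eta> \<tau>' axis_vec (rep (spin_rep N l) (replicate n (0, True)) *v v) \<and> \<bar>\<tau>\<bar> * l^n \<le> \<bar>\<tau>'\<bar>)"
proof -
  define C where "C = norm (conic_pt y) + \<eta>"
  have C: "C > 0" using \<eta> by (simp add: C_def add_nonneg_pos)
  have "\<forall>\<^sub>F l in at_top. l \<ge> max 1 (2 * C / \<eta>)" by (rule eventually_ge_at_top)
  then show ?thesis
  proof eventually_elim
    case (elim l)
    have l: "l \<ge> 1" "C \<le> \<eta> / 2 * l"
      using elim \<eta> by (auto simp: pos_divide_le_eq mult.commute)
    show ?case
    proof (intro allI impI)
      fix N v \<tau> and n :: nat assume n: "n \<ge> 1" and nr: "near (\<eta>/2) \<tau> (conic_pt y) v"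
      let ?\<theta> = "real n * (2 * pi / 3)"
      have ex0: "spin_rep N l 0 = spin l (2 * pi / 3)" by (simp add: spin_rep_def)
      define e where "e = v - \<tau> *\<^sub>R conic_pt y"
      have e: "norm e \<le> \<eta> / 2 * \<bar>\<tau>\<bar>" using nr by (simp add: near_def e_def)
      have v: "v = \<tau> *\<^sub>R conic_pt y + e" by (simp add: e_def)
      have nv: "norm v \<le> C * \<bar>\<tau>\<bar>"
      proof -
        have "norm v \<le> (norm (conic_pt y) + \<eta>/2) * \<bar>\<tau>\<bar>" by (rule near_norm_le[OF nr])
        also have "\<dots> \<le> C * \<bar>\<tau>\<bar>" using \<eta> unfolding C_def by (intro mult_right_mono) auto
        finally show ?thesis .
      qed
      have l0: "l > 0" using l by simp
      have ln: "l \<le> l^n" using l n by (simp add: self_le_power)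
      have ln1: "1 \<le> l^n" using l by simp
      have l3: "C \<le> \<eta> / 2 * l^n"
        using l(2) mult_left_mono[OF ln, of "\<eta>/2"] \<eta> by linarith
      have l2n: "l^(2*n) = l^n * l^n" by (simp add: mult_2 power_add)
      have cs: "(cos ?\<theta>)\<^sup>2 + (sin ?\<theta>)\<^sup>2 = 1" by simp
      have inv1: "1 / l^n \<le> 1" using ln1 by simp
      have "near \<eta> (\<tau> * l^n) (rotated n y) (rep (spin_rep N l) (replicate n (0, False)) *v v)"
      proof -
        let ?R = "spiral (cos ?\<theta>) (sin ?\<theta>) 0"
        have split: "spiral (l^n * cos ?\<theta>) (l^n * sin ?\<theta>) (1 / l^(2*n))
            = l^n *\<^sub>R ?R + (1 / l^(2*n)) *\<^sub>R projL"
          by (simp add: spiral_scale spiral_add)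
        have "rep (spin_rep N l) (replicate n (0, False)) *v v - (\<tau> * l^n) *\<^sub>R rotated n y
            = l^n *\<^sub>R (?R *v e) + (1 / l^(2*n)) *\<^sub>R (projL *v v)"
          unfolding rep_spin_power[where h = "spin_rep N l", OF ex0] split rotated_def
            matrix_vector_mult_add_rdistrib scaleR_matrix_vector_assoc[symmetric]
          by (simp add: e_def matrix_vector_mult_diff_distrib matrix_vector_mult_scaleR scaleR_diff_right mult.commute)
        then have "norm (rep (spin_rep N l) (replicate n (0, False)) *v v - (\<tau> * l^n) *\<^sub>R rotated n y)
            \<le> norm (l^n *\<^sub>R (?R *v e)) + norm ((1 / l^(2*n)) *\<^sub>R (projL *v v))"
          by (simp only: norm_triangle_ineq)
        also have "\<dots> = l^n * norm (?R *v e) + (1 / l^(2*n)) * norm (projL *v v)"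
          using l by simp
        also have "\<dots> \<le> l^n * (\<eta> / 2 * \<bar>\<tau>\<bar>) + 1 * (C * \<bar>\<tau>\<bar>)"
        proof (intro add_mono mult_mono)
          show "norm (?R *v e) \<le> \<eta> / 2 * \<bar>\<tau>\<bar>"
            using norm_spiral_le[of "cos ?\<theta>" "sin ?\<theta>" 1 0 e] e by simp
          show "norm (projL *v v) \<le> C * \<bar>\<tau>\<bar>"
            using norm_spiral_le[of 0 0 1 1 v] nv by simp
          show "1 / l^(2*n) \<le> 1" using l by simp
        qed (use l \<eta> in auto)
        also have "\<dots> \<le> l^n * (\<eta> / 2 * \<bar>\<tau>\<bar>) + (\<eta> / 2 * l^n) * \<bar>\<tau>\<bar>"
          using l3 unfolding mult_1 by (intro add_left_mono mult_right_mono) auto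
        also have "\<dots> = \<eta> * \<bar>\<tau> * l^n\<bar>" using l by (simp add: abs_mult)
        finally show ?thesis by (simp only: near_def)
      qed
      moreover have "near \<eta> (\<tau> * l^(2*n) * ((1 + y + y\<^sup>2) / 3)) axis_vec
          (rep (spin_rep N l) (replicate n (0, True)) *v v)"
      proof -
        let ?R = "spiral (cos ?\<theta>) (- sin ?\<theta>) 0"
        define m where "m = (1 + y + y\<^sup>2) / 3"
        have m: "m \<ge> 1" using y zero_le_power2[of y] unfolding m_def by argo
        have pc: "projL *v conic_pt y = m *\<^sub>R axis_vec" by (simp add: projL_vec conic_pt_def m_def)
        have split: "spiral (cos ?\<theta> / l^n) (- sin ?\<theta> / l^n) (l^(2*n))
            = (1 / l^n) *\<^sub>R ?R + l^(2*n) *\<^sub>R projL"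
          by (simp add: spiral_scale spiral_add)
        have "rep (spin_rep N l) (replicate n (0, True)) *v v - (\<tau> * l^(2*n) * m) *\<^sub>R axis_vec
            = l^(2*n) *\<^sub>R (projL *v e) + (1 / l^n) *\<^sub>R (?R *v v)"
          unfolding rep_spin_inverse_power[where h = "spin_rep N l", OF ex0 l0] split
            matrix_vector_mult_add_rdistrib scaleR_matrix_vector_assoc[symmetric]
          by (simp add: e_def matrix_vector_mult_diff_distrib matrix_vector_mult_scaleR scaleR_diff_right
              mult.commute pc)
        then have "norm (rep (spin_rep N l) (replicate n (0, True)) *v v - (\<tau> * l^(2*n) * m) *\<^sub>R axis_vec)
            \<le> norm (l^(2*n) *\<^sub>R (projL *v e)) + norm ((1 / l^n) *\<^sub>R (?R *v v))"
          by (simp only: norm_triangle_ineq)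
        also have "\<dots> = l^(2*n) * norm (projL *v e) + (1 / l^n) * norm (?R *v v)"
          using l by simp
        also have "\<dots> \<le> l^(2*n) * (\<eta> / 2 * \<bar>\<tau>\<bar>) + 1 * (C * \<bar>\<tau>\<bar>)"
        proof (intro add_mono mult_mono)
          show "norm (?R *v v) \<le> C * \<bar>\<tau>\<bar>"
            using norm_spiral_le[of "cos ?\<theta>" "- sin ?\<theta>" 1 0 v] nv by simp
          show "norm (projL *v e) \<le> \<eta> / 2 * \<bar>\<tau>\<bar>"
            using norm_spiral_le[of 0 0 1 1 e] e by simp
        qed (use l \<eta> inv1 in auto)
        also have "\<dots> \<le> l^(2*n) * (\<eta> / 2 * \<bar>\<tau>\<bar>) + (\<eta> / 2 * l^(2*n)) * \<bar>\<tau>\<bar>"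
        proof -
          have "l^n \<le> l^(2*n)" using l by (intro power_increasing) auto
          then have "\<eta> / 2 * l^n \<le> \<eta> / 2 * l^(2*n)" using \<eta> by (intro mult_left_mono) auto
          then have "C \<le> \<eta> / 2 * l^(2*n)" using l3 by linarith
          then show ?thesis unfolding mult_1 by (intro add_left_mono mult_right_mono) auto
        qed
        also have "\<dots> = \<eta> * (\<bar>\<tau>\<bar> * l^(2*n)) * 1" by simp
        also have "\<dots> \<le> \<eta> * (\<bar>\<tau>\<bar> * l^(2*n)) * m"
          using m \<eta> l by (intro mult_left_mono) auto
        also have "\<dots> = \<eta> * \<bar>\<tau> * l^(2*n) * m\<bar>" using l m by (simp add: abs_mult)
        finally show ?thesis by (simp only: near_def m_def)
      qed
      moreover have "\<bar>\<tau>\<bar> * l^n \<le> \<bar>\<tau> * l^(2*n) * ((1 + y + y\<^sup>2) / 3)\<bar>"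
      proof -
        have "(1 + y + y\<^sup>2) / 3 \<ge> 1" using y zero_le_power2[of y] by argo
        moreover have "l^n \<le> l^(2*n)" using l by (intro power_increasing) auto
        ultimately have "\<bar>\<tau>\<bar> * l^n * 1 \<le> \<bar>\<tau>\<bar> * l^(2*n) * ((1 + y + y\<^sup>2) / 3)"
          using l by (intro mult_mono) auto
        also have "\<dots> \<le> \<bar>\<tau> * l^(2*n) * ((1 + y + y\<^sup>2) / 3)\<bar>"
          using l y by (simp add: abs_mult)
        finally show ?thesis by simp
      qed
      ultimately show "near \<eta> (\<tau> * l^n) (rotated n y) (rep (spin_rep N l) (replicate n (0, False)) *v v) \<and>
        (\<exists>\<tau>'. near \<eta> \<tau>' axis_vec (rep (spin_rep N l) (replicate n (0, True)) *v v) \<and> \<bar>\<tau>\<bar> * l^n \<le> \<bar>\<tau>'\<bar>)"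
        by blast
    qed
  qed
qed

text \<open>The vector \<open>conic_pt 10\<close> lies on none of the repelling planes, so it serves as the start of the orbit.\<close>

definition ping_pong :: "nat \<Rightarrow> real \<Rightarrow> real \<Rightarrow> real \<Rightarrow> bool" where
  "ping_pong k \<eta> N l \<longleftrightarrow> \<eta> > 0 \<and> N > 1 \<and> l \<ge> 2 \<and>
    (\<forall>(x, w)\<in>pairs k. 2 * \<eta> \<le> norm w \<and> (\<forall>v \<tau>. near \<eta> \<tau> w v \<longrightarrow>
      (\<exists>\<tau>'. near (\<eta>/2) \<tau>' (conic_pt (attr_node x)) (letter_mat (spin_rep N l) x *v v) \<and> 2 * \<bar>\<tau>\<bar> \<le> \<bar>\<tau>'\<bar>))) \<and>
    (\<forall>y\<in>params k. 2 * \<eta> \<le> norm (conic_pt y) \<and> (\<forall>n v \<tau>. n \<ge> 1 \<longrightarrow> near (\<eta>/2) \<tau> (conic_pt y) v \<longrightarrow>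
      near \<eta> (\<tau> * l^n) (rotated n y) (rep (spin_rep N l) (replicate n (0, False)) *v v) \<and>
      (\<exists>\<tau>'. near \<eta> \<tau>' axis_vec (rep (spin_rep N l) (replicate n (0, True)) *v v) \<and> \<bar>\<tau>\<bar> * l^n \<le> \<bar>\<tau>'\<bar>)))"

text \<open>There are finitely many conditions, each holding eventually: \<open>\<eta>\<close> is
  fixed first, then \<open>N\<close> and \<open>l\<close> depending on it. Keeping the target
  vectors longer than \<open>2 * \<eta>\<close> converts nearness into a lower bound for
  norms.\<close>

lemma exists_ping_pong: "\<exists>\<eta> N l. ping_pong k \<eta> N l"
proof -
  have small: "\<forall>\<^sub>F \<eta> in at_right 0. 2 * \<eta> \<le> norm w" if "w \<noteq> 0" for w :: "real^3"
  proof -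
    have "\<forall>\<^sub>F \<eta> in at_right 0. \<eta> < norm w / 2"
      using that by (intro order_tendstoD(2)[OF tendsto_ident_at]) simp
    then show ?thesis by eventually_elim simp
  qed
  have "\<forall>\<^sub>F \<eta> in at_right 0. \<forall>z\<in>pairs k. 2 * \<eta> \<le> norm (snd z) \<and> (\<forall>\<^sub>F N in at_top. \<forall>l v \<tau>. near \<eta> \<tau> (snd z) v \<longrightarrow>
    (\<exists>\<tau>'. near (\<eta>/2) \<tau>' (conic_pt (attr_node (fst z))) (letter_mat (spin_rep N l) (fst z) *v v) \<and> 2 * \<bar>\<tau>\<bar> \<le> \<bar>\<tau>'\<bar>))"
  proof (rule eventually_ball_finite[OF finite_pairs], rule ballI)
    fix z assume "z \<in> pairs k"
    then have nz: "fst (fst z) > 0" "functional (fst z) \<bullet> snd z \<noteq> 0"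
      using functional_pairs_nonzero[of "fst z" "snd z" k] by auto
    then have "snd z \<noteq> 0" by auto
    from small[OF this] letter_contracts[OF nz]
    show "\<forall>\<^sub>F \<eta> in at_right 0. 2 * \<eta> \<le> norm (snd z) \<and> (\<forall>\<^sub>F N in at_top. \<forall>l v \<tau>. near \<eta> \<tau> (snd z) v \<longrightarrow>
      (\<exists>\<tau>'. near (\<eta>/2) \<tau>' (conic_pt (attr_node (fst z))) (letter_mat (spin_rep N l) (fst z) *v v) \<and> 2 * \<bar>\<tau>\<bar> \<le> \<bar>\<tau>'\<bar>))"
      by (rule eventually_conj)
  qed
  moreover have "\<forall>\<^sub>F \<eta> in at_right 0. \<forall>y\<in>params k. 2 * \<eta> \<le> norm (conic_pt y)"
  proof (rule eventually_ball_finite[OF finite_params], rule ballI)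
    fix y
    have "conic_pt y \<noteq> 0" by (auto simp: conic_pt_def vec_eq_iff forall_3)
    then show "\<forall>\<^sub>F \<eta> in at_right 0. 2 * \<eta> \<le> norm (conic_pt y)" by (rule small)
  qed
  moreover have "\<forall>\<^sub>F \<eta> in at_right 0. (\<eta>::real) > 0" by (rule eventually_at_right_less)
  ultimately have "\<forall>\<^sub>F \<eta> in at_right 0. \<exists>N l. ping_pong k \<eta> N l"
  proof eventually_elim
    case (elim \<eta>)
    have "\<forall>\<^sub>F N in at_top. \<forall>z\<in>pairs k. \<forall>l v \<tau>. near \<eta> \<tau> (snd z) v \<longrightarrow>
      (\<exists>\<tau>'. near (\<eta>/2) \<tau>' (conic_pt (attr_node (fst z))) (letter_mat (spin_rep N l) (fst z) *v v) \<and> 2 * \<bar>\<tau>\<bar> \<le> \<bar>\<tau>'\<bar>)"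
      using elim(1) by (intro eventually_ball_finite finite_pairs) blast
    moreover have "\<forall>\<^sub>F N in at_top. (N::real) > 1" by (rule eventually_gt_at_top)
    ultimately have "\<forall>\<^sub>F N in at_top. N > 1 \<and> (\<forall>z\<in>pairs k. \<forall>l v \<tau>. near \<eta> \<tau> (snd z) v \<longrightarrow>
      (\<exists>\<tau>'. near (\<eta>/2) \<tau>' (conic_pt (attr_node (fst z))) (letter_mat (spin_rep N l) (fst z) *v v) \<and> 2 * \<bar>\<tau>\<bar> \<le> \<bar>\<tau>'\<bar>))"
      by eventually_elim blast
    from eventually_happens'[OF _ this] obtain N where N: "N > 1" "\<forall>z\<in>pairs k. \<forall>l v \<tau>. near \<eta> \<tau> (snd z) v \<longrightarrow>
      (\<exists>\<tau>'. near (\<eta>/2) \<tau>' (conic_pt (attr_node (fst z))) (letter_mat (spin_rep N l) (fst z) *v v) \<and> 2 * \<bar>\<tau>\<bar> \<le> \<bar>\<tau>'\<bar>)"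
      by auto
    have "\<forall>\<^sub>F l in at_top. \<forall>y\<in>params k. \<forall>N n v \<tau>. n \<ge> 1 \<longrightarrow> near (\<eta>/2) \<tau> (conic_pt y) v \<longrightarrow>
      near \<eta> (\<tau> * l^n) (rotated n y) (rep (spin_rep N l) (replicate n (0, False)) *v v) \<and>
      (\<exists>\<tau>'. near \<eta> \<tau>' axis_vec (rep (spin_rep N l) (replicate n (0, True)) *v v) \<and> \<bar>\<tau>\<bar> * l^n \<le> \<bar>\<tau>'\<bar>)"
      by (intro eventually_ball_finite finite_params ballI spin_contracts params_ge) (use elim in auto)
    moreover have "\<forall>\<^sub>F l in at_top. (l::real) \<ge> 2" by (rule eventually_ge_at_top)
    ultimately have "\<forall>\<^sub>F l in at_top. l \<ge> 2 \<and> (\<forall>y\<in>params k. \<forall>N n v \<tau>. n \<ge> 1 \<longrightarrow> near (\<eta>/2) \<tau> (conic_pt y) v \<longrightarrow>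
      near \<eta> (\<tau> * l^n) (rotated n y) (rep (spin_rep N l) (replicate n (0, False)) *v v) \<and>
      (\<exists>\<tau>'. near \<eta> \<tau>' axis_vec (rep (spin_rep N l) (replicate n (0, True)) *v v) \<and> \<bar>\<tau>\<bar> * l^n \<le> \<bar>\<tau>'\<bar>))"
      by eventually_elim blast
    from eventually_happens'[OF _ this] obtain l where l: "l \<ge> 2"
      "\<forall>y\<in>params k. \<forall>N n v \<tau>. n \<ge> 1 \<longrightarrow> near (\<eta>/2) \<tau> (conic_pt y) v \<longrightarrow>
      near \<eta> (\<tau> * l^n) (rotated n y) (rep (spin_rep N l) (replicate n (0, False)) *v v) \<and>
      (\<exists>\<tau>'. near \<eta> \<tau>' axis_vec (rep (spin_rep N l) (replicate n (0, True)) *v v) \<and> \<bar>\<tau>\<bar> * l^n \<le> \<bar>\<tau>'\<bar>)"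
      by auto
    have "ping_pong k \<eta> N l"
      unfolding ping_pong_def using elim N l by (intro conjI) auto
    then show ?case by blast
  qed
  from eventually_happens'[OF _ this] show ?thesis by auto
qed

text \<open>The leftmost letter acts last, so the induction prepends letters. A single spiral letter
  does not contract and letterwise errors would accumulate; hence in state \<open>?B\<close> the
  whole leading block is kept unevaluated, with the vector \<open>v\<close> from before the block,
  and is estimated at once when the next hyperbolic letter arrives.\<close>

lemma ping_pong_growth:
  assumes pp: "ping_pong k \<eta> N l" and w: "w \<in> FreeGroup k"
  shows "(\<exists>y\<in>params k. \<exists>\<tau>. (\<forall>x u. w = x # u \<longrightarrow> fst x > 0 \<and> y = attr_node x) \<and> (w = [] \<longrightarrow> y = 10) \<and>
      near (\<eta>/2) \<tau> (conic_pt y) (rep (spin_rep N l) w *v conic_pt 10) \<and> 2 ^ length w \<le> \<bar>\<tau>\<bar>)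
    \<or> (\<exists>b u n v y \<tau>. w = (0, b) # u \<and> n \<ge> 1 \<and> y \<in> params k \<and>
      rep (spin_rep N l) w *v conic_pt 10 = rep (spin_rep N l) (replicate n (0, b)) *v v \<and>
      near (\<eta>/2) \<tau> (conic_pt y) v \<and> 2 ^ length w \<le> \<bar>\<tau>\<bar> * l ^ n)"
    (is "?A w \<or> ?B w")
  using w
proof (induction w)
  case Nil
  have "10 \<in> params k" by (simp add: params_def)
  moreover have "near (\<eta>/2) 1 (conic_pt 10) (conic_pt 10)" using pp by (simp add: near_def ping_pong_def)
  ultimately have "?A []" by (intro bexI[of _ 10] exI[of _ 1]) auto
  then show ?case by blast
next
  case (Cons x w)
  let ?g = "spin_rep N l" and ?v = "rep (spin_rep N l) w *v conic_pt 10"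
  have wF: "w \<in> FreeGroup k" and x: "fst x < k"
    and nc: "\<And>y u. w = y # u \<Longrightarrow> y \<noteq> opp x"
    using Cons.prems by (auto simp: FreeGroup_def cancels_Cons opp_def)
  have eta: "\<eta> > 0" and l: "l \<ge> 2" using pp by (auto simp: ping_pong_def)
  have step: "rep ?g (x # w) *v conic_pt 10 = letter_mat ?g x *v ?v"
    by (simp add: matrix_vector_mul_assoc)
  have b_step: "\<exists>\<tau>'. near (\<eta>/2) \<tau>' (conic_pt (attr_node x)) (letter_mat ?g x *v v) \<and> 2 * \<bar>\<tau>\<bar> \<le> \<bar>\<tau>'\<bar>"
    if "(x, z) \<in> pairs k" "near \<eta> \<tau> z v" for z \<tau> v
    using pp that unfolding ping_pong_def by blast
  have finish: "?A (x # w)" if hyps: "fst x > 0" "(x, z) \<in> pairs k" "near \<eta> \<tau> z ?v" "2 ^ length w \<le> \<bar>\<tau>\<bar>" for z \<tau>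
  proof -
    obtain \<tau>' where "near (\<eta>/2) \<tau>' (conic_pt (attr_node x)) (letter_mat ?g x *v ?v)" "2 * \<bar>\<tau>\<bar> \<le> \<bar>\<tau>'\<bar>"
      using b_step[OF hyps(2,3)] by blast
    then show ?thesis using hyps(1,4) x attr_params[OF hyps(1) x] step
      by (intro bexI[of _ "attr_node x"] exI[of _ \<tau>']) auto
  qed
  from Cons.IH[OF wF] show ?case
  proof
    assume "?A w"
    then obtain y \<tau> where y: "y \<in> params k" "\<And>z u. w = z # u \<Longrightarrow> fst z > 0 \<and> y = attr_node z" "w = [] \<Longrightarrow> y = 10"
      "near (\<eta>/2) \<tau> (conic_pt y) ?v" "2 ^ length w \<le> \<bar>\<tau>\<bar>" by blast
    show ?case
    proof (cases "fst x = 0")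
      case True
      then obtain b where xb: "x = (0, b)" by (cases x) auto
      have "2 ^ length (x # w) \<le> \<bar>\<tau>\<bar> * l ^ 1"
        using mult_mono[OF y(5) l] by (simp add: mult.commute)
      moreover have "rep ?g (x # w) *v conic_pt 10 = rep ?g (replicate 1 (0, b)) *v ?v"
        using step xb by simp
      ultimately have "?B (x # w)" using y(1,4) xb
        by (intro exI[of _ b] exI[of _ w] exI[of _ 1] exI[of _ ?v] exI[of _ y] exI[of _ \<tau>]) auto
      then show ?thesis by blast
    next
      case False
      have "y \<noteq> attr_node (opp x)"
      proof (cases w)
        case Nil then show ?thesis using y(3) by (auto simp: attr_node_def opp_def False)
      next
        case (Cons z u) then show ?thesis using y(2)[OF Cons] nc[OF Cons] attr_inj by blast
      qed
      then have "(x, conic_pt y) \<in> pairs k" using False x y(1) by (cases x) (auto simp: pairs_def)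
      moreover have "near \<eta> \<tau> (conic_pt y) ?v" using y(4) eta by (auto intro: near_mono)
      ultimately have "?A (x # w)" using finish y(5) False by blast
      then show ?thesis by blast
    qed
  next
    assume "?B w"
    then obtain b u n v y \<tau> where B: "w = (0, b) # u" "n \<ge> 1" "y \<in> params k"
      "?v = rep ?g (replicate n (0, b)) *v v"
      "near (\<eta>/2) \<tau> (conic_pt y) v" "2 ^ length w \<le> \<bar>\<tau>\<bar> * l ^ n" by blast
    show ?case
    proof (cases "fst x = 0")
      case True
      then have xb: "x = (0, b)" using nc[OF B(1)] by (cases x) (auto simp: opp_def)
      have "2 ^ length (x # w) \<le> \<bar>\<tau>\<bar> * l ^ Suc n"
        using mult_mono[OF B(6) l] l by (simp add: mult.commute mult.left_commute)
      moreover have "rep ?g (x # w) *v conic_pt 10 = rep ?g (replicate (Suc n) (0, b)) *v v"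
        using step xb B(4) by (simp add: matrix_vector_mul_assoc)
      ultimately have "?B (x # w)" using B(3,5) xb
        by (intro exI[of _ b] exI[of _ w] exI[of _ "Suc n"] exI[of _ v] exI[of _ y] exI[of _ \<tau>]) auto
      then show ?thesis by blast
    next
      case False
      have a_step: "near \<eta> (\<tau> * l^n) (rotated n y) (rep ?g (replicate n (0, False)) *v v) \<and>
        (\<exists>\<tau>'. near \<eta> \<tau>' axis_vec (rep ?g (replicate n (0, True)) *v v) \<and> \<bar>\<tau>\<bar> * l^n \<le> \<bar>\<tau>'\<bar>)"
        using pp B(2,3,5) unfolding ping_pong_def by blast
      have "\<exists>z \<sigma>. (x, z) \<in> pairs k \<and> near \<eta> \<sigma> z ?v \<and> \<bar>\<tau>\<bar> * l^n \<le> \<bar>\<sigma>\<bar>"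
      proof (cases b)
        case True
        have "(x, axis_vec) \<in> pairs k" using False x by (cases x) (auto simp: pairs_def)
        then show ?thesis using a_step B(4) True by auto
      next
        case bF: False
        have "rotated n y \<in> (\<Union>j\<in>{..<3}. rotated j ` params k)"
          using B(3) rotated_mod_3[of n y] by (intro UN_I[of "n mod 3"]) auto
        then have "(x, rotated n y) \<in> pairs k" using False x by (cases x) (auto simp: pairs_def)
        moreover have "\<bar>\<tau>\<bar> * l^n \<le> \<bar>\<tau> * l^n\<bar>" using l by (simp add: abs_mult)
        ultimately show ?thesis using a_step B(4) bF by auto
      qed
      then obtain z \<sigma> where z: "(x, z) \<in> pairs k" "near \<eta> \<sigma> z ?v" "\<bar>\<tau>\<bar> * l^n \<le> \<bar>\<sigma>\<bar>" by blast
      then have "2 ^ length w \<le> \<bar>\<sigma>\<bar>" using B(6) by linarith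
      then have "?A (x # w)" using finish[OF _ z(1,2)] False by blast
      then show ?thesis by blast
    qed
  qed
qed

lemma ping_pong_norm:
  assumes k: "k > 1" and pp: "ping_pong k \<eta> N l" and w: "w \<in> FreeGroup k"
  shows "\<eta> * 2 ^ length w \<le> norm (rep (spin_rep N l) w *v conic_pt 10)"
proof -
  have eta: "\<eta> > 0" and l: "l \<ge> 2" using pp by (auto simp: ping_pong_def)
  have fin: "\<eta> * 2 ^ length w \<le> norm v" if "near \<eta> \<tau> z v" "2 * \<eta> \<le> norm z" "2 ^ length w \<le> \<bar>\<tau>\<bar>" for z v \<tau>
  proof -
    have "\<eta> * 2 ^ length w \<le> (norm z - \<eta>) * \<bar>\<tau>\<bar>" using that eta by (intro mult_mono) auto
    also have "\<dots> \<le> norm v" by (rule near_norm_ge[OF that(1)])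
    finally show ?thesis .
  qed
  \<comment> \<open>Some hyperbolic letter is needed only to read off from \<open>pairs\<close> that
    the axis and the rotated points have norm at least \<open>2 * \<eta>\<close>.\<close>
  have one: "(1, False) \<in> {1..<k} \<times> UNIV" using k by auto
  from ping_pong_growth[OF pp w] show ?thesis
  proof (elim disjE bexE exE conjE)
    fix y \<tau> assume "y \<in> params k" "near (\<eta>/2) \<tau> (conic_pt y) (rep (spin_rep N l) w *v conic_pt 10)" "2 ^ length w \<le> \<bar>\<tau>\<bar>"
    then show ?thesis using pp eta by (intro fin[of \<tau> "conic_pt y"]) (auto simp: ping_pong_def intro: near_mono)
  next
    fix b u n v y \<tau>
    assume B: "n \<ge> 1" "y \<in> params k" "rep (spin_rep N l) w *v conic_pt 10 = rep (spin_rep N l) (replicate n (0, b)) *v v"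
      "near (\<eta>/2) \<tau> (conic_pt y) v" "2 ^ length w \<le> \<bar>\<tau>\<bar> * l ^ n"
    have a_step: "near \<eta> (\<tau> * l^n) (rotated n y) (rep (spin_rep N l) (replicate n (0, False)) *v v) \<and>
      (\<exists>\<tau>'. near \<eta> \<tau>' axis_vec (rep (spin_rep N l) (replicate n (0, True)) *v v) \<and> \<bar>\<tau>\<bar> * l^n \<le> \<bar>\<tau>'\<bar>)"
      using pp B unfolding ping_pong_def by blast
    have nz: "2 * \<eta> \<le> norm z" if "((1, False), z) \<in> pairs k" for z
      using pp that unfolding ping_pong_def by blast
    show ?thesis
    proof (cases b)
      case True
      obtain \<tau>' where "near \<eta> \<tau>' axis_vec (rep (spin_rep N l) w *v conic_pt 10)" "\<bar>\<tau>\<bar> * l^n \<le> \<bar>\<tau>'\<bar>"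
        using a_step B(3) True by auto
      moreover have "2 * \<eta> \<le> norm axis_vec" using one by (intro nz) (auto simp: pairs_def)
      ultimately show ?thesis using B(5) by (intro fin) auto
    next
      case False
      have "rotated n y \<in> (\<Union>j\<in>{..<3}. rotated j ` params k)"
        using B(2) rotated_mod_3[of n y] by (intro UN_I[of "n mod 3"]) auto
      then have "2 * \<eta> \<le> norm (rotated n y)" using one by (intro nz) (auto simp: pairs_def)
      moreover have "\<bar>\<tau>\<bar> * l^n = \<bar>\<tau> * l^n\<bar>" using l by (simp add: abs_mult)
      ultimately show ?thesis using a_step B(3,5) False by (intro fin[of "\<tau> * l^n"]) auto
    qed
  qed
qed

lemma spin_rep_quasi_isometric:
  assumes k: "k > 1" and pp: "ping_pong k \<eta> N l"
  shows "quasi_isometric k (spin_rep N l)"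
proof -
  have eta: "\<eta> > 0" and N: "N > 0" and l: "l > 0" using pp by (auto simp: ping_pong_def)
  have c: "norm (conic_pt 10) > 0" by (auto simp: conic_pt_def vec_eq_iff forall_3)
  define b where "b = max 0 (- ln (\<eta> / norm (conic_pt 10)))"
  have "ln (sv1 (rep (spin_rep N l) w)) \<ge> real (word_len w) / 2 - b" if w: "w \<in> FreeGroup k" for w
  proof -
    have "rep (spin_rep N l) w \<in> SL3"
      using w N l by (intro rep_SL3[OF spin_rep_hom_tuple[of N l k]]) (auto simp: FreeGroup_def)
    then have d: "det (rep (spin_rep N l) w) \<noteq> 0" by (simp add: SL3_def)
    have "\<eta> * 2 ^ length w \<le> sv1 (rep (spin_rep N l) w) * norm (conic_pt 10)"
      using ping_pong_norm[OF k pp w] norm_mult_le_sv1[OF d, of "conic_pt 10"] by linarith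
    then have le: "\<eta> / norm (conic_pt 10) * 2 ^ length w \<le> sv1 (rep (spin_rep N l) w)"
      using c by (simp add: pos_divide_le_eq)
    have pos: "\<eta> / norm (conic_pt 10) > 0" using eta c by simp
    have pos2: "\<eta> / norm (conic_pt 10) * 2 ^ length w > 0" using pos by (intro mult_pos_pos) auto
    have "ln (\<eta> / norm (conic_pt 10) * 2 ^ length w) \<le> ln (sv1 (rep (spin_rep N l) w))"
      using le pos2 by (intro ln_le_cancel_iff[THEN iffD2]) linarith+
    moreover have "ln (\<eta> / norm (conic_pt 10) * 2 ^ length w) = ln (\<eta> / norm (conic_pt 10)) + real (length w) * ln 2"
      using pos by (subst ln_mult_pos) (simp_all add: ln_realpow)
    moreover have "real (length w) * (1 / 2) \<le> real (length w) * ln 2"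
      using ln2_ge_two_thirds by (intro mult_left_mono) auto
    ultimately show ?thesis unfolding b_def word_len_def by linarith
  qed
  then show ?thesis unfolding quasi_isometric_def
    by (intro exI[of _ 2] exI[of _ b]) (auto simp: b_def)
qed

section \<open>Failure of robustness\<close>

lemma spiral_vec_split:
  "spiral x y z *v q = x *\<^sub>R (projV *v q) + y *\<^sub>R (spiral 0 1 0 *v q) + z *\<^sub>R (projL *v q)"
proof -
  have "spiral x y z = x *\<^sub>R projV + y *\<^sub>R spiral 0 1 0 + z *\<^sub>R projL"
    by (simp add: spiral_scale spiral_add)
  then show ?thesis
    by (simp add: matrix_vector_mult_add_rdistrib scaleR_matrix_vector_assoc[symmetric])
qed

lemma polar_form_2pi: "\<exists>\<rho> t. 0 \<le> \<rho> \<and> 0 \<le> t \<and> t < 2 * pi \<and> x = \<rho> * cos t \<and> y = \<rho> * sin t"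
proof (cases "x = 0 \<and> y = 0")
  case True then show ?thesis by (intro exI[of _ 0]) auto
next
  case False
  define \<rho> where "\<rho> = sqrt (x\<^sup>2 + y\<^sup>2)"
  have \<rho>: "\<rho> > 0" using False by (auto simp: \<rho>_def sum_power2_gt_zero_iff)
  have "(x / \<rho>)\<^sup>2 + (y / \<rho>)\<^sup>2 = (x\<^sup>2 + y\<^sup>2) / \<rho>\<^sup>2" by (simp add: power_divide add_divide_distrib)
  also have "\<dots> = 1" using False by (simp add: \<rho>_def sum_power2_eq_zero_iff)
  finally obtain t where "0 \<le> t" "t < 2 * pi" "x / \<rho> = cos t" "y / \<rho> = sin t"
    using sincos_total_2pi by metis
  then show ?thesis using \<rho> by (intro exI[of _ \<rho>] exI[of _ t]) (auto simp: field_simps)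
qed

text \<open>Inside the plane, scaled rotations act like multiplication by complex numbers, so they
  carry any nonzero vector to every other.\<close>

lemma plane_polar:
  fixes v q :: "real^3"
  assumes q: "projV *v q \<noteq> 0" and v: "v$1 + v$2 + v$3 = 0"
  shows "\<exists>\<rho> t. 0 \<le> \<rho> \<and> 0 \<le> t \<and> t < 2 * pi \<and> v = \<rho> *\<^sub>R (spiral (cos t) (sin t) 0 *v q)"
proof -
  define u where "u = projV *v q"
  \<comment> \<open>The cross product of (1,1,1) with \<open>u\<close>: orthogonal to
    \<open>u\<close> in the plane and of squared length 3 times that of \<open>u\<close>, whence the
    factor 1/3 in \<open>id\<close>.\<close>
  define w :: "real^3" where "w = vector [u$3 - u$2, u$1 - u$3, u$2 - u$1]"
  have u3: "u$3 = - u$1 - u$2"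
    by (simp add: u_def spiral_def circulant_def matrix_vector_mult_def sum_3 field_simps)
  have v3: "v$3 = - v$1 - v$2" using v by linarith
  have "circulant 0 a 0 *v (circulant 1 0 0 *v q) = circulant 0 a 0 *v q" for a
    unfolding matrix_vector_mul_assoc circulant_mult by simp
  then have "spiral 0 1 0 *v q = circulant 0 (1 / sqrt 3) 0 *v u" by (simp add: u_def spiral_def)
  also have "\<dots> = (1 / sqrt 3) *\<^sub>R w"
    by (simp add: vec_eq_iff forall_3 w_def circulant_def matrix_vector_mult_def sum_3 field_simps)
  finally have w: "spiral 0 1 0 *v q = (1 / sqrt 3) *\<^sub>R w" .
  have id: "(u \<bullet> u) *\<^sub>R v = (v \<bullet> u) *\<^sub>R u + (1 / 3) *\<^sub>R ((v \<bullet> w) *\<^sub>R w)"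
    by (simp add: vec_eq_iff forall_3 w_def inner_vec_def sum_3 u3 v3 field_simps)
  have uu: "u \<bullet> u \<noteq> 0" using q by (simp add: u_def)
  define x y where "x = (v \<bullet> u) / (u \<bullet> u)" and "y = (v \<bullet> w) / (sqrt 3 * (u \<bullet> u))"
  have "v = (1 / (u \<bullet> u)) *\<^sub>R ((u \<bullet> u) *\<^sub>R v)" using uu by simp
  also have "\<dots> = x *\<^sub>R u + y *\<^sub>R ((1 / sqrt 3) *\<^sub>R w)"
    unfolding id by (simp add: x_def y_def scaleR_add_right)
  finally have vxy: "v = x *\<^sub>R u + y *\<^sub>R (spiral 0 1 0 *v q)" unfolding w .
  obtain \<rho> t where t: "0 \<le> \<rho>" "0 \<le> t" "t < 2 * pi" "x = \<rho> * cos t" "y = \<rho> * sin t"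
    using polar_form_2pi by blast
  have "v = \<rho> *\<^sub>R (spiral (cos t) (sin t) 0 *v q)"
    unfolding vxy spiral_vec_split[of "cos t"] by (simp add: t u_def scaleR_add_right)
  then show ?thesis using t by blast
qed

text \<open>A plane and its preimage under \<open>C\<close> share a line; in coordinates, A cos t +
  B sin t has a zero, read off from the polar form of (B, -A).\<close>

lemma plane_meets_preimage:
  fixes C :: mat3
  shows "\<exists>t. 0 \<le> t \<and> t < 2 * pi \<and> axis_vec \<bullet> (C *v (spiral (cos t) (sin t) 0 *v q)) = 0"
proof -
  define A B where "A = axis_vec \<bullet> (C *v (projV *v q))" and "B = axis_vec \<bullet> (C *v (spiral 0 1 0 *v q))"
  obtain \<rho> t where t: "0 \<le> \<rho>" "0 \<le> t" "t < 2 * pi" "B = \<rho> * cos t" "- A = \<rho> * sin t"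
    using polar_form_2pi by blast
  have "axis_vec \<bullet> (C *v (spiral (cos t) (sin t) 0 *v q)) = cos t * A + sin t * B"
    unfolding spiral_vec_split[of "cos t"]
    by (simp add: matrix_vector_right_distrib matrix_vector_mult_scaleR inner_add_right A_def B_def)
  also have "\<dots> = 0"
  proof -
    have "A = - (\<rho> * sin t)" using t(5) by simp
    then show ?thesis unfolding t(4) by (simp add: algebra_simps)
  qed
  finally show ?thesis using t by blast
qed

definition shear :: "real^3 \<Rightarrow> real^3 \<Rightarrow> mat3" where
  "shear d z = mat 1 + (\<chi> i j. d$i * z$j)"

lemma shear_vec: "shear d z *v v = v + (z \<bullet> v) *\<^sub>R d"
  by (simp add: shear_def vec_eq_iff forall_3 matrix_vector_mult_def sum_3 mat_def inner_vec_def algebra_simps)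

lemma det_shear: "det (shear d z) = 1 + z \<bullet> d"
  by (simp add: shear_def det_3 mat_def inner_vec_def sum_3 algebra_simps)

lemma cancels_replicate_append:
  "fst x \<noteq> fst y \<Longrightarrow> cancels (replicate n x @ y # w) \<longleftrightarrow> cancels (y # w)"
  by (cases "n = 0") (simp_all add: cancels_append not_cancels_replicate del: cancels.simps)

lemma cancels_Cons_replicate:
  "fst y \<noteq> fst x \<Longrightarrow> n \<ge> 1 \<Longrightarrow> cancels (y # replicate n x @ w) \<longleftrightarrow> cancels (replicate n x @ w)"
  by (cases n) auto

text \<open>In the splitting into plane and axis, conjugation by a^j enlarges only the block from
  axis to plane, by l^(3j). That block of \<open>Y\<close> vanishes because \<open>Y\<close>
  preserves the axis, so the conjugates \<open>W j\<close> are uniformly bounded although their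
  length is at least 2j.\<close>

lemma fixed_axis_not_quasi_isometric:
  assumes k: "k > 2" and h: "hom_tuple k h" and l: "l > 1"
    and h0: "h 0 = spin l \<theta>"
    and m: "m \<ge> 1" and n: "n \<ge> 1"
    and fix_line: "h 2 *v (rep h (replicate m (0, False)) *v (matrix_inv (h 1) *v axis_vec))
       = \<kappa> *\<^sub>R (rep h (replicate n (0, False)) *v (matrix_inv (h 1) *v axis_vec))"
  shows "\<not> quasi_isometric k h"
proof
  assume "quasi_isometric k h"
  then obtain a b where a: "a \<ge> 1"
    and qi: "\<And>\<gamma>. \<gamma> \<in> FreeGroup k \<Longrightarrow> ln (sv1 (rep h \<gamma>)) \<ge> real (word_len \<gamma>) / a - b"
    unfolding quasi_isometric_def by blast
  define Y where "Y = [(1, False)] @ replicate n (0, True) @ [(2, False)] @ replicate m (0, False) @ [(1 :: nat, True)]"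
  define W where "W j = replicate j (0, False) @ Y @ replicate j (0 :: nat, True)" for j
  have inv1: "h 1 ** matrix_inv (h 1) = mat 1"
    using h k by (intro matrix_inv_right SL3_invertible) (simp add: hom_tuple_def)
  have canc: "rep h (replicate n (0, True)) ** rep h (replicate n (0, False)) = mat 1"
    using l h0 by (simp add: rep_spin_power[where h = h] rep_spin_inverse_power[where h = h] spiral_mult
        flip: spiral_one distrib_right add_divide_distrib power2_eq_square)
  have Yp: "rep h Y *v axis_vec = \<kappa> *\<^sub>R axis_vec"
  proof -
    have "rep h Y *v axis_vec = h 1 *v (rep h (replicate n (0, True)) *v
        (h 2 *v (rep h (replicate m (0, False)) *v (matrix_inv (h 1) *v axis_vec))))"
      by (simp add: Y_def rep_append letter_mat_def matrix_vector_mul_assoc matrix_mul_assoc)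
    also have "\<dots> = \<kappa> *\<^sub>R (h 1 *v ((rep h (replicate n (0, True)) ** rep h (replicate n (0, False))) *v
        (matrix_inv (h 1) *v axis_vec)))"
      unfolding fix_line by (simp add: matrix_vector_mult_scaleR matrix_vector_mul_assoc matrix_mul_assoc)
    also have "\<dots> = \<kappa> *\<^sub>R axis_vec"
      unfolding canc using inv1 by (simp add: matrix_vector_mul_assoc)
    finally show ?thesis .
  qed
  have Yok: "letters_ok k Y" using k by (simp add: Y_def letters_ok_replicate)
  then have YSL: "rep h Y \<in> SL3" by (rule rep_SL3[OF h])
  then have Yd: "det (rep h Y) \<noteq> 0" by (simp add: SL3_def)
  define C where "C = \<bar>\<kappa>\<bar> + sv1 (rep h Y)"
  have C: "C > 0" using sing_vals_SL3(2)[OF YSL] by (simp add: C_def add_nonneg_pos)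
  have WF: "W j \<in> FreeGroup k" for j
  proof -
    have W: "W j = replicate j (0, False) @ (1, False) # replicate n (0, True) @ (2, False) #
        replicate m (0, False) @ (1, True) # replicate j (0, True)"
      by (simp add: W_def Y_def)
    have "cancels (W j) \<longleftrightarrow> cancels ((1, False) # replicate n (0, True) @ (2, False) #
        replicate m (0, False) @ (1, True) # replicate j (0, True))"
      unfolding W by (rule cancels_replicate_append) simp
    also have "\<dots> \<longleftrightarrow> cancels (replicate n (0, True) @ (2, False) #
        replicate m (0, False) @ (1, True) # replicate j (0, True))"
      by (rule cancels_Cons_replicate[OF _ n]) simp
    also have "\<dots> \<longleftrightarrow> cancels ((2, False) # replicate m (0, False) @ (1, True) # replicate j (0, True))"
      by (rule cancels_replicate_append) simp
    also have "\<dots> \<longleftrightarrow> cancels (replicate m (0, False) @ (1, True) # replicate j (0, True))"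
      by (rule cancels_Cons_replicate[OF _ m]) simp
    also have "\<dots> \<longleftrightarrow> cancels ((1, True) # replicate j (0, True))"
      by (rule cancels_replicate_append) simp
    also have "\<dots> \<longleftrightarrow> False"
      using not_cancels_replicate[of j] by (cases j) auto
    finally have "\<not> cancels (W j)" by simp
    moreover have "letters_ok k (W j)" using Yok k by (simp add: W_def letters_ok_replicate)
    ultimately show ?thesis by (simp add: FreeGroup_def)
  qed
  have bound: "norm (rep h (W j) *v v) \<le> C * norm v" for j v
  proof -
    let ?A = "rep h (replicate j (0, False))" and ?\<phi> = "real j * \<theta>"
    let ?R = "spiral (cos ?\<phi>) (- sin ?\<phi>) 0"
    have lj: "1 \<le> l^j" using l by simp
    have A: "norm (?A *v w) \<le> l^j * norm w" for w
      unfolding rep_spin_power[where h = h, OF h0]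
    proof (rule norm_spiral_le)
      have "(cos ?\<phi>)\<^sup>2 + (sin ?\<phi>)\<^sup>2 = 1" by simp
      then show "(l^j * cos ?\<phi>)\<^sup>2 + (l^j * sin ?\<phi>)\<^sup>2 \<le> (l^j)\<^sup>2"
        unfolding power_mult_distrib distrib_left[symmetric] by simp
      have "1 / l^(2*j) \<le> 1" using l by simp
      then have "1 / l^(2*j) \<le> l^j" using lj by (rule order_trans)
      then show "(1 / l^(2*j))\<^sup>2 \<le> (l^j)\<^sup>2" using l by (intro power_mono) auto
    qed (use l in simp)
    have Ap: "?A *v axis_vec = (1 / l^(2*j)) *\<^sub>R axis_vec"
      unfolding rep_spin_power[where h = h, OF h0] by (rule spiral_axis_vec)
    have split: "rep h (replicate j (0, True)) = l^(2*j) *\<^sub>R projL + (1 / l^j) *\<^sub>R ?R"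
      using l h0 by (simp add: rep_spin_inverse_power[where h = h] spiral_scale spiral_add)
    define c where "c = (v$1 + v$2 + v$3) / 3"
    have pv: "projL *v v = c *\<^sub>R axis_vec" by (simp add: projL_vec c_def)
    have "rep h (W j) *v v = ?A *v (rep h Y *v (rep h (replicate j (0, True)) *v v))"
      by (simp add: W_def rep_append matrix_vector_mul_assoc matrix_mul_assoc)
    also have "\<dots> = ?A *v (rep h Y *v (l^(2*j) *\<^sub>R (c *\<^sub>R axis_vec) + (1 / l^j) *\<^sub>R (?R *v v)))"
      unfolding split matrix_vector_mult_add_rdistrib scaleR_matrix_vector_assoc[symmetric] pv ..
    also have "\<dots> = \<kappa> *\<^sub>R (projL *v v) + (1 / l^j) *\<^sub>R (?A *v (rep h Y *v (?R *v v)))"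
      unfolding matrix_vector_right_distrib matrix_vector_mult_scaleR Yp Ap pv using l by simp
    finally have "norm (rep h (W j) *v v)
        \<le> norm (\<kappa> *\<^sub>R (projL *v v)) + norm ((1 / l^j) *\<^sub>R (?A *v (rep h Y *v (?R *v v))))"
      by (simp only: norm_triangle_ineq)
    also have "\<dots> = \<bar>\<kappa>\<bar> * norm (projL *v v) + (1 / l^j) * norm (?A *v (rep h Y *v (?R *v v)))"
      using l by simp
    also have "\<dots> \<le> \<bar>\<kappa>\<bar> * norm v + (1 / l^j) * (l^j * (sv1 (rep h Y) * norm v))"
    proof (intro add_mono mult_left_mono)
      show "norm (projL *v v) \<le> norm v" using norm_spiral_le[of 0 0 1 1 v] by simp
      have "norm (?R *v v) \<le> norm v"
        using norm_spiral_le[of "cos ?\<phi>" "- sin ?\<phi>" 1 0 v] by simp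
      then have "sv1 (rep h Y) * norm (?R *v v) \<le> sv1 (rep h Y) * norm v"
        using sing_vals_SL3(2)[OF YSL] by (intro mult_left_mono) auto
      then have "norm (rep h Y *v (?R *v v)) \<le> sv1 (rep h Y) * norm v"
        using norm_mult_le_sv1[OF Yd, of "?R *v v"] by linarith
      then have "l^j * norm (rep h Y *v (?R *v v)) \<le> l^j * (sv1 (rep h Y) * norm v)"
        using l by (intro mult_left_mono) auto
      then show "norm (?A *v (rep h Y *v (?R *v v))) \<le> l^j * (sv1 (rep h Y) * norm v)"
        using A[of "rep h Y *v (?R *v v)"] by linarith
    qed (use l in auto)
    also have "\<dots> = C * norm v" using l by (simp add: C_def distrib_right)
    finally show ?thesis .
  qed
  have ineq: "real j / a - b \<le> ln C" for j
  proof -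
    have SL: "rep h (W j) \<in> SL3" using WF[of j] by (intro rep_SL3[OF h]) (simp add: FreeGroup_def)
    have "sv1 (rep h (W j)) \<le> C"
      using sv1_le[OF _ bound] SL by (simp add: SL3_def)
    then have "ln (sv1 (rep h (W j))) \<le> ln C"
      using sing_vals_SL3(2)[OF SL] C by (intro ln_le_cancel_iff[THEN iffD2]) auto
    moreover have "real j / a \<le> real (word_len (W j)) / a"
      using a by (intro divide_right_mono) (auto simp: word_len_def W_def)
    ultimately show ?thesis using qi[OF WF[of j]] by linarith
  qed
  obtain j :: nat where "real j > (ln C + b) * a" using reals_Archimedean2 by blast
  then have "real j / a > ln C + b" using a by (simp add: pos_less_divide_eq)
  then show False using ineq[of j] by linarith
qed

definition angle :: "nat \<Rightarrow> real" where
  "angle n = 2 * pi / 3 + 2 * pi / (3 * real (Suc n))"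

text \<open>Since \<open>3 * angle n\<close> is \<open>2 * pi / Suc n\<close> modulo \<open>2 * pi\<close>, multiples of \<open>angle n\<close> come
  \<open>O(1/n)\<close>-close to any prescribed angle \<open>\<alpha>\<close>.\<close>

definition turns :: "real \<Rightarrow> nat \<Rightarrow> nat" where
  "turns \<alpha> n = 3 * (Suc n + nat \<lfloor>real (Suc n) * \<alpha> / (2 * pi)\<rfloor>)"

text \<open>The summand \<open>Suc n\<close> in \<open>turns\<close> contributes a whole number of
  full turns. It leaves the direction unchanged but sends the exponents to infinity, so that the
  axis component dies out.\<close>

lemma turns_ge: "n < turns \<alpha> n" "turns \<alpha> n \<ge> 1"
  by (simp_all add: turns_def)

lemma angle_tendsto: "angle \<longlonglongrightarrow> 2 * pi / 3"
proof -
  have "(\<lambda>n. 2 * pi / 3 * (1 + inverse (real (Suc n)))) \<longlonglongrightarrow> 2 * pi / 3 * (1 + 0)"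
    by (intro tendsto_intros LIMSEQ_inverse_real_of_nat)
  then show ?thesis by (simp add: angle_def[abs_def] distrib_left inverse_eq_divide)
qed

lemma turns_angle_tendsto:
  assumes "\<alpha> \<ge> 0"
  shows "(\<lambda>n. cos (real (turns \<alpha> n) * angle n)) \<longlonglongrightarrow> cos \<alpha>"
    and "(\<lambda>n. sin (real (turns \<alpha> n) * angle n)) \<longlonglongrightarrow> sin \<alpha>"
proof -
  define F where "F n = nat \<lfloor>real (Suc n) * \<alpha> / (2 * pi)\<rfloor>" for n
  have per: "cos (2 * pi * real m) = 1" "sin (2 * pi * real m) = 0" for m
    using cos_2npi[of m] sin_2npi[of m] by (simp_all add: mult.commute mult.left_commute)
  have eq: "real (turns \<alpha> n) * angle n = 2 * pi * (real F') / real (Suc n) + 2 * pi * real (Suc n + F' + 1)"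
    if "F' = F n" for n F'
  proof -
    have "real (turns \<alpha> n) = 3 * (real (Suc n) + real F')" by (simp add: turns_def F_def that)
    then have "real (turns \<alpha> n) * angle n = (real (Suc n) + real F') * (3 * angle n)" by simp
    also have "3 * angle n = 2 * pi + 2 * pi / real (Suc n)" by (simp add: angle_def field_simps)
    also have "(real (Suc n) + real F') * (2 * pi + 2 * pi / real (Suc n))
        = 2 * pi * (real F') / real (Suc n) + 2 * pi * real (Suc n + F' + 1)"
      by (simp add: field_simps)
    finally show ?thesis .
  qed
  have bounds: "\<bar>2 * pi * real (F n) / real (Suc n) - \<alpha>\<bar> \<le> 2 * pi * inverse (real (Suc n))" for n
  proof -
    let ?y = "real (Suc n) * \<alpha> / (2 * pi)"
    have "real (F n) = of_int \<lfloor>?y\<rfloor>" using assms by (simp add: F_def)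
    then have "\<bar>real (F n) - ?y\<bar> \<le> 1" by linarith
    moreover have "2 * pi * real (F n) / real (Suc n) - \<alpha> = (2 * pi * inverse (real (Suc n))) * (real (F n) - ?y)"
    proof -
      have "2 * pi * f / M - \<alpha> = (2 * pi * inverse M) * (f - M * \<alpha> / (2 * pi))" if "M \<noteq> 0" for f M :: real
        using that by (simp add: field_simps)
      then show ?thesis by simp
    qed
    moreover have "2 * pi * inverse (real (Suc n)) \<ge> 0" by simp
    ultimately show ?thesis
      by (metis abs_mult abs_of_nonneg mult.right_neutral mult_left_mono)
  qed
  have "(\<lambda>n. 2 * pi * inverse (real (Suc n))) \<longlonglongrightarrow> 2 * pi * 0"
    by (intro tendsto_intros LIMSEQ_inverse_real_of_nat)
  then have z: "(\<lambda>n. 2 * pi * inverse (real (Suc n))) \<longlonglongrightarrow> 0" by (simp only: mult_zero_right)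
  have "(\<lambda>n. 2 * pi * real (F n) / real (Suc n) - \<alpha>) \<longlonglongrightarrow> 0"
    by (rule Lim_null_comparison[OF _ z]) (simp only: real_norm_def bounds eventually_True)
  then have lim: "(\<lambda>n. 2 * pi * real (F n) / real (Suc n)) \<longlonglongrightarrow> \<alpha>" by (rule LIM_zero_cancel)
  have "cos (real (turns \<alpha> n) * angle n) = cos (2 * pi * real (F n) / real (Suc n))"
    "sin (real (turns \<alpha> n) * angle n) = sin (2 * pi * real (F n) / real (Suc n))" for n
    unfolding eq[OF refl] cos_add sin_add per by simp_all
  then show "(\<lambda>n. cos (real (turns \<alpha> n) * angle n)) \<longlonglongrightarrow> cos \<alpha>"
    "(\<lambda>n. sin (real (turns \<alpha> n) * angle n)) \<longlonglongrightarrow> sin \<alpha>"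
    using lim by (simp_all add: tendsto_cos tendsto_sin)
qed

text \<open>The matrix is l^(-m) a^m for m = \<open>turns \<alpha> n\<close> and rotation angle
  \<open>angle n\<close>; its axis entry l^(-3m) tends to 0.\<close>

lemma spin_orbit_tendsto:
  assumes l: "l > 1" and "\<alpha> \<ge> 0"
  shows "(\<lambda>n. spiral (cos (real (turns \<alpha> n) * angle n)) (sin (real (turns \<alpha> n) * angle n))
    (1 / l ^ (3 * turns \<alpha> n)) *v q) \<longlonglongrightarrow> spiral (cos \<alpha>) (sin \<alpha>) 0 *v q"
proof -
  have "(\<lambda>n. 1 / l ^ (3 * turns \<alpha> n)) \<longlonglongrightarrow> 0"
  proof (rule Lim_null_comparison)
    show "(\<lambda>n. inverse l ^ n) \<longlonglongrightarrow> 0" using l by (intro LIMSEQ_power_zero) (simp add: inverse_less_1_iff)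
    have "norm (1 / l ^ (3 * turns \<alpha> n)) \<le> inverse l ^ n" for n
    proof -
      have "l ^ n \<le> l ^ (3 * turns \<alpha> n)" using l turns_ge(1)[of n \<alpha>] by (intro power_increasing) auto
      then have "1 / l ^ (3 * turns \<alpha> n) \<le> 1 / l ^ n" using l by (intro divide_left_mono) auto
      then show ?thesis using l by (simp only: power_inverse inverse_eq_divide power_one_over) simp
    qed
    then show "\<forall>\<^sub>F n in sequentially. norm (1 / l ^ (3 * turns \<alpha> n)) \<le> inverse l ^ n" by simp
  qed
  then show ?thesis
    unfolding spiral_vec_split[of "cos _"]
    using turns_angle_tendsto[OF assms(2)] by (intro tendsto_add tendsto_scaleR tendsto_const) auto
qed

lemma hyp_coordinate:
  assumes "s \<noteq> r" "s \<noteq> t" "r \<noteq> t"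
  shows "lag s r t \<bullet> (hyp_mat s r t a b c *v v) = a * (lag s r t \<bullet> v)"
    and "lag r s t \<bullet> (hyp_mat s r t a b c *v v) = b * (lag r s t \<bullet> v)"
  using assms by (simp_all add: hyp_vec inner_add_right lag_conic_pt)

text \<open>Otherwise the axis would be an eigenline of b_1. But the axis vector has nonzero
  coordinates in two eigenlines with eigenvalues N^5 and 1/N, which would force N^6 = 1. This planar
  component is what lets the spiral orbit sweep out all directions.\<close>

lemma inverse_axis_off_axis:
  assumes N: "N > 1"
  shows "projV *v (matrix_inv (spin_rep N l 1) *v axis_vec) \<noteq> 0"
proof
  let ?b = "spin_rep N l 1" and ?q = "matrix_inv (spin_rep N l 1) *v axis_vec"
  assume z: "projV *v ?q = 0"
  have ax: "axis_vec = conic_pt 1" by (simp add: axis_vec_def conic_pt_def)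
  have b: "?b = hyp_mat 13 14 15 (N^5) (1/N) (1/N^4)" by (simp add: spin_rep_def)
  \<comment> \<open>The value \<open>l = 1\<close> is harmless: generator 1 does not depend on
    \<open>l\<close>, and nothing is assumed about \<open>l\<close> here.\<close>
  have "spin_rep N 1 1 \<in> SL3" using spin_rep_hom_tuple[of N 1 2] N unfolding hom_tuple_def by auto
  then have "?b \<in> SL3" by (simp add: spin_rep_def)
  then have "?b *v ?q = axis_vec"
    using matrix_inv_right[OF SL3_invertible] by (simp add: matrix_vector_mul_assoc)
  moreover obtain \<mu> where mu: "?q = \<mu> *\<^sub>R axis_vec"
  proof -
    have "?q = projV *v ?q + projL *v ?q"
      using spiral_vec_split[of 1 0 1 ?q] by (simp add: spiral_one)
    then show ?thesis using z that unfolding projL_vec by simp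
  qed
  ultimately have e: "\<mu> *\<^sub>R (?b *v axis_vec) = axis_vec"
    by (simp add: matrix_vector_mult_scaleR)
  have "\<mu> * (N^5 * (lag 13 14 15 \<bullet> axis_vec)) = lag 13 14 15 \<bullet> axis_vec"
    "\<mu> * (1/N * (lag 14 13 15 \<bullet> axis_vec)) = lag 14 13 15 \<bullet> axis_vec"
    using arg_cong[OF e, of "(\<bullet>) (lag 13 14 15)"] arg_cong[OF e, of "(\<bullet>) (lag 14 13 15)"]
    unfolding b inner_scaleR_right by (simp_all add: hyp_coordinate)
  moreover have "lag 13 14 15 \<bullet> axis_vec \<noteq> 0" "lag 14 13 15 \<bullet> axis_vec \<noteq> 0"
    unfolding ax lag_conic_pt by simp_all
  ultimately have 1: "\<mu> * N^5 = 1" and "\<mu> * (1/N) = 1"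
    by (metis mult.assoc mult_cancel_right1)+
  then have "\<mu> = N" using N by (simp add: field_simps)
  with 1 have "N^6 = 1" by (simp add: eval_nat_numeral)
  moreover have "N^6 > 1" using N by (simp add: one_less_power)
  ultimately show False by simp
qed

text \<open>Choose \<open>v1\<close> and \<open>v2 = c v1\<close> both in the plane. After the
  perturbation of the angle, normalised spiral orbits \<open>x n\<close> and \<open>y n\<close> of q
  = b_1^(-1) (1,1,1) converge to \<open>v1\<close> and to a multiple of \<open>v2\<close>. So
  \<open>c\<close> nearly maps the line of \<open>x n\<close> to that of \<open>y n\<close>, and a
  small shear makes this exact.\<close>

lemma spin_rep_not_robust:
  assumes k: "k > 2" and N: "N > 1" and l: "l > 1"
  shows "\<not> robustly_quasi_isometric k (spin_rep N l)"
proof -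
  let ?g = "spin_rep N l" and ?q = "matrix_inv (spin_rep N l 1) *v axis_vec"
  let ?c = "spin_rep N l 2"
  have g: "hom_tuple k ?g" using N l by (intro spin_rep_hom_tuple) auto
  have cSL: "?c \<in> SL3" using g k by (simp add: hom_tuple_def)
  have q: "projV *v ?q \<noteq> 0" by (rule inverse_axis_off_axis[OF N])
  obtain \<alpha> where \<alpha>: "0 \<le> \<alpha>" and cv1: "axis_vec \<bullet> (?c *v (spiral (cos \<alpha>) (sin \<alpha>) 0 *v ?q)) = 0"
    using plane_meets_preimage[of ?c ?q] by blast
  define v1 where "v1 = spiral (cos \<alpha>) (sin \<alpha>) 0 *v ?q"
  define v2 where "v2 = ?c *v v1"
  have "(norm v1)\<^sup>2 = (norm (projV *v ?q))\<^sup>2"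
    unfolding v1_def norm_spiral[of "cos \<alpha>" "sin \<alpha>" 0] by simp
  then have "v1 \<noteq> 0" using q by auto
  then have v2nz: "v2 \<noteq> 0"
    using SL3_invertible[OF cSL] unfolding v2_def by (metis invertible_left_inverse matrix_left_invertible_ker)
  have "v2$1 + v2$2 + v2$3 = 0"
    using cv1 by (simp add: v2_def v1_def axis_vec_def inner_vec_def sum_3)
  then obtain \<rho> \<beta> where \<beta>: "0 \<le> \<beta>" and v2: "v2 = \<rho> *\<^sub>R (spiral (cos \<beta>) (sin \<beta>) 0 *v ?q)"
    using plane_polar[OF q] by blast
  have \<rho>: "\<rho> \<noteq> 0" using v2 v2nz by auto
  define x where "x n = spiral (cos (real (turns \<alpha> n) * angle n)) (sin (real (turns \<alpha> n) * angle n))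
    (1 / l ^ (3 * turns \<alpha> n)) *v ?q" for n
  define y where "y n = spiral (cos (real (turns \<beta> n) * angle n)) (sin (real (turns \<beta> n) * angle n))
    (1 / l ^ (3 * turns \<beta> n)) *v ?q" for n
  have lx: "x \<longlonglongrightarrow> v1" unfolding x_def v1_def by (rule spin_orbit_tendsto[OF l \<alpha>])
  have ly: "y \<longlonglongrightarrow> (1 / \<rho>) *\<^sub>R v2"
  proof -
    have "(1 / \<rho>) *\<^sub>R v2 = spiral (cos \<beta>) (sin \<beta>) 0 *v ?q" using \<rho> by (simp add: v2)
    then show ?thesis unfolding y_def by (simp only: spin_orbit_tendsto[OF l \<beta>])
  qed
  have lcx: "(\<lambda>n. ?c *v x n) \<longlonglongrightarrow> v2"
    unfolding v2_def by (rule bounded_linear.tendsto[OF _ lx]) (simp add: linear_linear[symmetric])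
  define z1 where "z1 n = v2 \<bullet> y n" for n
  define z2 where "z2 n = v2 \<bullet> (?c *v x n)" for n
  have lz1: "z1 \<longlonglongrightarrow> v2 \<bullet> ((1 / \<rho>) *\<^sub>R v2)" unfolding z1_def by (intro tendsto_intros ly)
  have lz2: "z2 \<longlonglongrightarrow> v2 \<bullet> v2" unfolding z2_def by (intro tendsto_intros lcx)
  have nz: "v2 \<bullet> ((1 / \<rho>) *\<^sub>R v2) \<noteq> 0" "v2 \<bullet> v2 \<noteq> 0" using \<rho> v2nz by auto
  \<comment> \<open>Both terms have inner product 1 with \<open>v2\<close> and converge to the same
    multiple of \<open>v2\<close>. Hence \<open>d n\<close> is orthogonal to \<open>v2\<close>, so
    the shear has determinant 1; it sends \<open>?c *v x n\<close> to a multiple of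
    \<open>y n\<close>; and it tends to the identity.\<close>
  define d where "d n = (1 / z1 n) *\<^sub>R y n - (1 / z2 n) *\<^sub>R (?c *v x n)" for n
  have ld: "d \<longlonglongrightarrow> 0"
  proof -
    have "d \<longlonglongrightarrow> (1 / (v2 \<bullet> ((1 / \<rho>) *\<^sub>R v2))) *\<^sub>R ((1 / \<rho>) *\<^sub>R v2) - (1 / (v2 \<bullet> v2)) *\<^sub>R v2"
      unfolding d_def using nz by (intro tendsto_intros lz1 lz2 ly lcx) auto
    also have "(1 / (v2 \<bullet> ((1 / \<rho>) *\<^sub>R v2))) *\<^sub>R ((1 / \<rho>) *\<^sub>R v2) - (1 / (v2 \<bullet> v2)) *\<^sub>R v2 = 0"
      using \<rho> by simp
    finally show ?thesis .
  qed
  \<comment> \<open>The fallback value keeps every term in SL_3; it is taken only finitely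
    often.\<close>
  define c' where "c' n = (if z1 n \<noteq> 0 \<and> z2 n \<noteq> 0 then shear (d n) v2 ** ?c else ?c)" for n
  have ev: "\<forall>\<^sub>F n in sequentially. z1 n \<noteq> 0 \<and> z2 n \<noteq> 0"
    using tendsto_imp_eventually_ne[OF lz1 nz(1)] tendsto_imp_eventually_ne[OF lz2 nz(2)]
    by (rule eventually_conj)
  have lc: "c' \<longlonglongrightarrow> ?c"
  proof -
    have "(\<lambda>n. shear (d n) v2) \<longlonglongrightarrow> shear 0 v2"
    proof -
      have "(\<lambda>n. d n $ i) \<longlonglongrightarrow> 0 $ i" for i using tendsto_vec_nth[OF ld, of i] .
      from tendsto_add[OF tendsto_const tendsto_mult[OF this tendsto_const]] show ?thesis
        unfolding tendsto_mat3_iff shear_def by simp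
    qed
    moreover have "shear 0 v2 = mat 1" by (simp add: shear_def vec_eq_iff)
    ultimately have "(\<lambda>n. shear (d n) v2 ** ?c) \<longlonglongrightarrow> mat 1 ** ?c"
      by (intro tendsto_matrix_mult) auto
    then have "(\<lambda>n. shear (d n) v2 ** ?c) \<longlonglongrightarrow> ?c" by simp
    moreover have "\<forall>\<^sub>F n in sequentially. c' n = shear (d n) v2 ** ?c"
      using ev by eventually_elim (simp add: c'_def)
    ultimately show ?thesis using tendsto_cong by fastforce
  qed
  define h where "h n i = (if i = 0 then spin l (angle n) else if i = 2 then c' n else ?g i)" for n i
  have c'SL: "c' n \<in> SL3" for n
  proof (cases "z1 n \<noteq> 0 \<and> z2 n \<noteq> 0")
    case True
    then have "v2 \<bullet> d n = 0" by (simp add: d_def inner_diff_right flip: z1_def z2_def)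
    then have "shear (d n) v2 \<in> SL3" by (simp add: SL3_def det_shear)
    then show ?thesis using True cSL by (simp add: c'_def SL3_mult)
  qed (auto simp: c'_def cSL)
  have hom: "hom_tuple k (h n)" for n
    using g l c'SL spin_SL3[of l] by (auto simp: hom_tuple_def h_def)
  show ?thesis
  proof (rule not_robustly_quasi_isometricI[OF g hom])
    fix i
    have g0: "?g 0 = spin l (2 * pi / 3)" by (simp add: spin_rep_def)
    have "(\<lambda>n. spin l (angle n)) \<longlonglongrightarrow> spin l (2 * pi / 3)"
    proof -
      have "spin l t = (l * cos t) *\<^sub>R projV + (l * sin t) *\<^sub>R spiral 0 1 0 + (1 / l\<^sup>2) *\<^sub>R projL" for t
        by (simp add: spin_def spiral_scale spiral_add)
      then show ?thesis by (simp only:) (intro tendsto_intros angle_tendsto)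
    qed
    then show "(\<lambda>n. h n i) \<longlonglongrightarrow> ?g i"
      using lc by (cases "i = 0"; cases "i = 2") (simp_all add: h_def g0)
  next
    show "\<forall>\<^sub>F n in sequentially. \<not> quasi_isometric k (h n)"
      using ev
    proof eventually_elim
      case (elim n)
      have h0: "h n 0 = spin l (angle n)" and h1: "h n 1 = ?g 1" and h2: "h n 2 = shear (d n) v2 ** ?c"
        using elim by (simp_all add: h_def c'_def)
      have orbit: "rep (h n) (replicate (turns \<gamma> n) (0, False)) *v ?q
          = l ^ turns \<gamma> n *\<^sub>R (spiral (cos (real (turns \<gamma> n) * angle n)) (sin (real (turns \<gamma> n) * angle n))
            (1 / l ^ (3 * turns \<gamma> n)) *v ?q)" for \<gamma>
      proof -
        have "l ^ m * (1 / l ^ (3 * m)) = 1 / l ^ (2 * m)" for m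
          using l power_add[of l "2 * m" m] by (simp add: field_simps)
        then show ?thesis
          unfolding rep_spin_power[where h = "h n", OF h0] scaleR_matrix_vector_assoc spiral_scale by simp
      qed
      have "shear (d n) v2 *v (?c *v x n) = (z2 n / z1 n) *\<^sub>R y n"
        unfolding shear_vec z2_def[symmetric] using elim by (simp add: d_def scaleR_diff_right)
      then have "h n 2 *v (rep (h n) (replicate (turns \<alpha> n) (0, False)) *v ?q)
          = l ^ turns \<alpha> n *\<^sub>R ((z2 n / z1 n) *\<^sub>R y n)"
        unfolding orbit h2 x_def[symmetric]
        by (simp add: matrix_vector_mult_scaleR flip: matrix_vector_mul_assoc)
      also have "\<dots> = (l ^ turns \<alpha> n * (z2 n / z1 n) / l ^ turns \<beta> n) *\<^sub>R
          (rep (h n) (replicate (turns \<beta> n) (0, False)) *v ?q)"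
        unfolding orbit y_def[symmetric] using l by simp
      finally show ?case
        using fixed_axis_not_quasi_isometric[OF k hom l h0 turns_ge(2) turns_ge(2)] unfolding h1 by blast
    qed
  qed
qed

section \<open>Zariski density\<close>

definition elem_mat :: "3 \<Rightarrow> 3 \<Rightarrow> real \<Rightarrow> mat3" where
  "elem_mat i j t = (\<chi> a b. (if a = b then 1 else 0) + (if a = i \<and> b = j then t else 0))"

lemma elem_mat_mult: "(elem_mat i j t ** M) $ a $ b = M $ a $ b + (if a = i then t * M $ j $ b else 0)"
proof -
  have "(elem_mat i j t ** M) $ a $ b
      = (\<Sum>c\<in>UNIV. (if a = c then M $ c $ b else 0) + (if c = j then (if a = i then t * M $ c $ b else 0) else 0))"
    unfolding matrix_matrix_mult_def elem_mat_def by (auto simp: algebra_simps intro!: sum.cong)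
  then show ?thesis by (simp add: sum.distrib)
qed

lemma mult_elem_mat: "(M ** elem_mat i j t) $ a $ b = M $ a $ b + (if b = j then t * M $ a $ i else 0)"
proof -
  have "(M ** elem_mat i j t) $ a $ b
      = (\<Sum>c\<in>UNIV. (if c = b then M $ a $ c else 0) + (if c = i then (if b = j then t * M $ a $ c else 0) else 0))"
    unfolding matrix_matrix_mult_def elem_mat_def by (auto simp: algebra_simps intro!: sum.cong)
  then show ?thesis by (simp add: sum.distrib)
qed

lemma elem_mat_inverse:
  assumes "i \<noteq> j" shows "elem_mat i j (- t) ** elem_mat i j t = mat 1"
  using assms by (auto simp: vec_eq_iff elem_mat_mult) (auto simp: elem_mat_def mat_def)

lemma det_elem_mat: assumes "i \<noteq> j" shows "det (elem_mat i j t) = 1"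
proof -
  have "\<forall>i j. i \<noteq> j \<longrightarrow> det (elem_mat i j t) = 1"
    unfolding forall_3 by (simp add: det_3 elem_mat_def)
  then show ?thesis using assms by blast
qed

text \<open>Gaussian elimination with unit pivots, run backwards: \<open>s2\<close> to
  \<open>s6\<close> treat increasingly reduced matrices, and each stage is proved from a later one
  by undoing row or column operations.\<close>

lemma SL3_elementary_induct:
  fixes P :: "mat3 \<Rightarrow> bool"
  assumes mult: "\<And>A B. P A \<Longrightarrow> P B \<Longrightarrow> P (A ** B)"
    and elem: "\<And>i j t. i \<noteq> j \<Longrightarrow> P (elem_mat i j t)"
    and M: "det M = 1"
  shows "P M"
proof -
  have left: "P M" if "P (elem_mat i j t ** M)" "i \<noteq> j" for i j t M
  proof -
    have "M = elem_mat i j (- t) ** (elem_mat i j t ** M)"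
      using elem_mat_inverse[OF that(2)] by (simp add: matrix_mul_assoc)
    then show ?thesis using mult elem that by metis
  qed
  have right: "P M" if "P (M ** elem_mat i j t)" "i \<noteq> j" for i j t M
  proof -
    have "elem_mat i j t ** elem_mat i j (- t) = mat 1"
      using elem_mat_inverse[OF that(2), of "- t"] by simp
    then have "M = (M ** elem_mat i j t) ** elem_mat i j (- t)"
      by (simp add: matrix_mul_assoc[symmetric])
    then show ?thesis using mult elem that by metis
  qed
  have dets: "det (elem_mat i j t ** M) = det M" "det (M ** elem_mat i j t) = det M" if "i \<noteq> j" for i j t M
    using det_elem_mat[OF that] by (simp_all add: det_mul)
  have P1: "P (mat 1)"
    using mult[OF elem[of 1 2 "- 1"] elem[of 1 2 1]] elem_mat_inverse[of 1 2 1] by simp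
  have s6: "P M" if "M$1$1 = 1" "M$1$2 = 0" "M$1$3 = 0" "M$2$1 = 0" "M$3$1 = 0" "M$2$2 = 1" "det M = 1" for M
  proof -
    let ?A = "elem_mat 3 2 (- M$3$2) ** M"
    let ?B = "?A ** elem_mat 2 3 (- M$2$3)"
    have "det ?B = 1" using that by (simp add: dets)
    then have "?B = mat 1" using that
      by (simp add: vec_eq_iff forall_3 mult_elem_mat elem_mat_mult mat_def det_3)
    then have "P ?B" using P1 by simp
    then have "P ?A" by (rule right) simp
    then show ?thesis by (rule left) simp
  qed
  \<comment> \<open>A nonzero entry below the pivot position allows the pivot to be made 1 without
    any scaling; \<open>s4\<close> first creates such an entry if it is missing.\<close>
  have s5: "P M" if "M$1$1 = 1" "M$1$2 = 0" "M$1$3 = 0" "M$2$1 = 0" "M$3$1 = 0" "M$3$2 \<noteq> 0" "det M = 1" for M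
  proof (rule left[of 2 3 "(1 - M$2$2) / M$3$2"])
    show "P (elem_mat 2 3 ((1 - M$2$2) / M$3$2) ** M)"
      using that by (intro s6) (simp_all add: elem_mat_mult dets)
  qed simp
  have s4: "P M" if "M$1$1 = 1" "M$1$2 = 0" "M$1$3 = 0" "M$2$1 = 0" "M$3$1 = 0" "det M = 1" for M
  proof (cases "M$3$2 = 0")
    case False then show ?thesis using that by (intro s5)
  next
    case True
    then have nz: "M$2$2 \<noteq> 0" using that by (auto simp: det_3)
    have "P (elem_mat 3 2 1 ** M)"
      using that nz True by (intro s5) (simp_all add: elem_mat_mult dets)
    then show ?thesis by (rule left) simp
  qed
  have s3: "P M" if "M$1$1 = 1" "det M = 1" for M
  proof -
    let ?A = "elem_mat 2 1 (- M$2$1) ** M"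
    let ?B = "elem_mat 3 1 (- M$3$1) ** ?A"
    let ?C = "?B ** elem_mat 1 2 (- M$1$2)"
    let ?D = "?C ** elem_mat 1 3 (- M$1$3)"
    have "P ?D" using that by (intro s4) (simp_all add: mult_elem_mat elem_mat_mult dets)
    then have "P ?C" by (rule right) simp
    then have "P ?B" by (rule right) simp
    then have "P ?A" by (rule left) simp
    then show ?thesis by (rule left) simp
  qed
  have s2: "P M" if "M$2$1 \<noteq> 0" "det M = 1" for M
  proof (rule left[of 1 2 "(1 - M$1$1) / M$2$1"])
    show "P (elem_mat 1 2 ((1 - M$1$1) / M$2$1) ** M)"
      using that by (intro s3) (simp_all add: elem_mat_mult dets)
  qed simp
  show ?thesis
  proof (cases "M$2$1 = 0")
    case False then show ?thesis using M by (rule s2)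
  next
    case True
    then have "M$1$1 \<noteq> 0 \<or> M$3$1 \<noteq> 0" using M by (auto simp: det_3)
    then show ?thesis
    proof
      assume "M$1$1 \<noteq> 0"
      then have "P (elem_mat 2 1 1 ** M)" using True M by (intro s2) (simp_all add: elem_mat_mult dets)
      then show ?thesis by (rule left) simp
    next
      assume "M$3$1 \<noteq> 0"
      then have "P (elem_mat 2 3 1 ** M)" using True M by (intro s2) (simp_all add: elem_mat_mult dets)
      then show ?thesis by (rule left) simp
    qed
  qed
qed

section \<open>Polynomial functions on lines, on one-parameter groups and under
  differentiation\<close>

lemma matrix_add_rdistr: "(A + B) ** C = A ** C + B ** (C :: mat3)"
  by (simp add: vec_eq_iff matrix_matrix_mult_def sum.distrib distrib_right)

lemma scaleR_matrix_mult: "(c *\<^sub>R A) ** B = c *\<^sub>R (A ** (B :: mat3))"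
  by (simp add: vec_eq_iff matrix_matrix_mult_def sum_distrib_left mult.assoc)

lemma poly_fun_mult_right: "poly_fun p \<Longrightarrow> poly_fun (\<lambda>A. p (A ** M))"
proof (induction rule: poly_fun.induct)
  case (entry i j)
  have "poly_fun (\<lambda>A. A$i$1 * M$1$j + A$i$2 * M$2$j + A$i$3 * M$3$j)"
    by (intro poly_fun.intros)
  then show ?case by (simp add: matrix_matrix_mult_def sum_3)
qed (auto intro: poly_fun.intros)

lemma poly_fun_on_line: "poly_fun p \<Longrightarrow> \<exists>F. \<forall>t. p (A + t *\<^sub>R B) = poly F t"
proof (induction rule: poly_fun.induct)
  case (const c) then show ?case by (intro exI[of _ "[:c:]"]) simp
next
  case (entry i j) then show ?case by (intro exI[of _ "[:A$i$j, B$i$j:]"]) simp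
next
  case (add p q)
  then obtain F G where "\<forall>t. p (A + t *\<^sub>R B) = poly F t" "\<forall>t. q (A + t *\<^sub>R B) = poly G t" by blast
  then show ?case by (intro exI[of _ "F + G"]) simp
next
  case (mult p q)
  then obtain F G where "\<forall>t. p (A + t *\<^sub>R B) = poly F t" "\<forall>t. q (A + t *\<^sub>R B) = poly G t" by blast
  then show ?case by (intro exI[of _ "F * G"]) simp
qed

text \<open>Along such a curve a polynomial function is a Laurent polynomial in the parameter, and
  \<open>z ^ d\<close> clears its denominators.\<close>

lemma poly_fun_laurent:
  "poly_fun p \<Longrightarrow> \<exists>F d. \<forall>z. z \<noteq> 0 \<longrightarrow> z ^ d * p (z *\<^sub>R M + (1 / z\<^sup>2) *\<^sub>R N) = poly F z"
proof (induction rule: poly_fun.induct)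
  case (const c) then show ?case by (intro exI[of _ "[:c:]"] exI[of _ 0]) simp
next
  case (entry i j)
  show ?case
    by (intro exI[of _ "[:N$i$j, 0, 0, M$i$j:]"] exI[of _ 2]) (simp add: field_simps power2_eq_square)
next
  case (add p q)
  then obtain F d G e where F: "\<And>z. z \<noteq> 0 \<Longrightarrow> z ^ d * p (z *\<^sub>R M + (1 / z\<^sup>2) *\<^sub>R N) = poly F z"
    and G: "\<And>z. z \<noteq> 0 \<Longrightarrow> z ^ e * q (z *\<^sub>R M + (1 / z\<^sup>2) *\<^sub>R N) = poly G z" by blast
  have "z ^ (d + e) * (p (z *\<^sub>R M + (1 / z\<^sup>2) *\<^sub>R N) + q (z *\<^sub>R M + (1 / z\<^sup>2) *\<^sub>R N))
      = poly (monom 1 e * F + monom 1 d * G) z" if "z \<noteq> 0" for z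
    using F[OF that, symmetric] G[OF that, symmetric]
    by (simp add: poly_monom power_add distrib_left mult.commute mult.left_commute)
  then show ?case by blast
next
  case (mult p q)
  then obtain F d G e where F: "\<And>z. z \<noteq> 0 \<Longrightarrow> z ^ d * p (z *\<^sub>R M + (1 / z\<^sup>2) *\<^sub>R N) = poly F z"
    and G: "\<And>z. z \<noteq> 0 \<Longrightarrow> z ^ e * q (z *\<^sub>R M + (1 / z\<^sup>2) *\<^sub>R N) = poly G z" by blast
  have "z ^ (d + e) * (p (z *\<^sub>R M + (1 / z\<^sup>2) *\<^sub>R N) * q (z *\<^sub>R M + (1 / z\<^sup>2) *\<^sub>R N))
      = poly (F * G) z" if "z \<noteq> 0" for z
    using F[OF that, symmetric] G[OF that, symmetric]
    by (simp add: power_add mult.commute mult.left_commute)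
  then show ?case by blast
qed

lemma poly_zero_on_powers:
  fixes F :: "real poly"
  assumes l: "l > 1" and z: "\<And>m::nat. poly F (l ^ m) = 0"
  shows "F = 0"
proof (rule ccontr)
  assume "F \<noteq> 0"
  then have "finite {x. poly F x = 0}" by (rule poly_roots_finite)
  moreover have "range (\<lambda>m::nat. l ^ m) \<subseteq> {x. poly F x = 0}" using z by auto
  ultimately have "finite (range (\<lambda>m::nat. l ^ m))" by (rule rev_finite_subset)
  moreover have "inj (\<lambda>m::nat. l ^ m)" using l by (auto simp: inj_on_def)
  ultimately show False using finite_imageD[of "\<lambda>m::nat. l ^ m" UNIV] by simp
qed

text \<open>The points \<open>l ^ m\<close> are infinitely many zeros of the cleared polynomial, so
  it vanishes identically. Thus the powers of one element already determine the whole one-parameter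
  group.\<close>

lemma poly_fun_torus_closure:
  assumes p: "poly_fun p" and l: "l > 1"
    and z: "\<And>m::nat. p (l ^ m *\<^sub>R M + (1 / (l ^ m)\<^sup>2) *\<^sub>R N) = 0" and nz: "x \<noteq> 0"
  shows "p (x *\<^sub>R M + (1 / x\<^sup>2) *\<^sub>R N) = 0"
proof -
  obtain F d where F: "\<And>z. z \<noteq> 0 \<Longrightarrow> z ^ d * p (z *\<^sub>R M + (1 / z\<^sup>2) *\<^sub>R N) = poly F z"
    using poly_fun_laurent[OF p] by blast
  have "poly F (l ^ m) = 0" for m
    using F[of "l ^ m"] z[of m] l by simp
  then have "F = 0" by (rule poly_zero_on_powers[OF l])
  then show ?thesis using F[OF nz] nz by simp
qed

text \<open>Polynomial functions are given here without a polynomial expression, so partial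
  derivatives are characterised by the chain rule along curves. Requiring them to be polynomial
  functions again allows repeated differentiation.\<close>

definition is_gradient :: "(mat3 \<Rightarrow> real) \<Rightarrow> (3 \<Rightarrow> 3 \<Rightarrow> mat3 \<Rightarrow> real) \<Rightarrow> bool" where
  "is_gradient p d \<longleftrightarrow> (\<forall>i j. poly_fun (d i j)) \<and>
    (\<forall>c c' t. (\<forall>i j. ((\<lambda>s. c s $ i $ j) has_real_derivative c' $ i $ j) (at t)) \<longrightarrow>
      ((\<lambda>s. p (c s)) has_real_derivative (\<Sum>i\<in>UNIV. \<Sum>j\<in>UNIV. d i j (c t) * c' $ i $ j)) (at t))"

lemma is_gradientD:
  assumes "is_gradient p d" "\<And>i j. ((\<lambda>s. c s $ i $ j) has_real_derivative c' $ i $ j) (at t)"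
  shows "((\<lambda>s. p (c s)) has_real_derivative (\<Sum>i\<in>UNIV. \<Sum>j\<in>UNIV. d i j (c t) * c' $ i $ j)) (at t)"
  by (rule conjunct2[OF assms(1)[unfolded is_gradient_def], THEN spec[of _ c], THEN spec[of _ c'],
        THEN spec[of _ t], THEN mp]) (intro allI assms(2))

lemma poly_fun_gradient: "poly_fun p \<Longrightarrow> \<exists>d. is_gradient p d"
proof (induction rule: poly_fun.induct)
  case (const c)
  show ?case by (intro exI[of _ "\<lambda>i j A. 0"]) (auto simp: is_gradient_def intro: poly_fun.intros)
next
  case (entry a b)
  have "(\<Sum>i\<in>UNIV. \<Sum>j\<in>UNIV. (if i = a then if j = b then 1 else 0 else 0) * c' $ i $ j) = c' $ a $ b"
    for c' :: mat3
    using exhaust_3[of a] exhaust_3[of b] by (auto simp: sum_3)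
  then show ?case
    by (intro exI[of _ "\<lambda>i j A. if i = a then if j = b then 1 else 0 else 0"])
      (auto simp: is_gradient_def intro: poly_fun.intros)
next
  case (add p q)
  then obtain d e where d: "is_gradient p d" and e: "is_gradient q e" by blast
  then show ?case
    by (intro exI[of _ "\<lambda>i j A. d i j A + e i j A"])
      (auto simp: is_gradient_def distrib_right sum.distrib intro!: poly_fun.intros DERIV_add)
next
  case (mult p q)
  then obtain d e where d: "is_gradient p d" and e: "is_gradient q e" by blast
  have "is_gradient (\<lambda>A. p A * q A) (\<lambda>i j A. d i j A * q A + p A * e i j A)"
    unfolding is_gradient_def
  proof (intro conjI allI impI)
    show "poly_fun (\<lambda>A. d i j A * q A + p A * e i j A)" for i j
      using d e mult.hyps by (auto simp: is_gradient_def intro!: poly_fun.intros)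
    fix c :: "real \<Rightarrow> mat3" and c' t assume c: "\<forall>i j. ((\<lambda>s. c s $ i $ j) has_real_derivative c' $ i $ j) (at t)"
    have "((\<lambda>s. p (c s)) has_real_derivative (\<Sum>i\<in>UNIV. \<Sum>j\<in>UNIV. d i j (c t) * c' $ i $ j)) (at t)"
      "((\<lambda>s. q (c s)) has_real_derivative (\<Sum>i\<in>UNIV. \<Sum>j\<in>UNIV. e i j (c t) * c' $ i $ j)) (at t)"
      using d e c by (auto simp: is_gradient_def)
    from DERIV_mult[OF this]
    show "((\<lambda>s. p (c s) * q (c s)) has_real_derivative
      (\<Sum>i\<in>UNIV. \<Sum>j\<in>UNIV. (d i j (c t) * q (c t) + p (c t) * e i j (c t)) * c' $ i $ j)) (at t)"
      by (simp add: sum_3 algebra_simps)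
  qed
  then show ?case by blast
qed

text \<open>The left-invariant vector field of \<open>E\<close> applied to the function with
  gradient \<open>d\<close>: its derivative at \<open>A\<close> in the direction
  \<open>A ** E\<close>.\<close>

definition along :: "(3 \<Rightarrow> 3 \<Rightarrow> mat3 \<Rightarrow> real) \<Rightarrow> mat3 \<Rightarrow> mat3 \<Rightarrow> real" where
  "along d E A = (\<Sum>i\<in>UNIV. \<Sum>j\<in>UNIV. d i j A * (A ** E) $ i $ j)"

lemma poly_fun_along:
  assumes "is_gradient p d" shows "poly_fun (along d E)"
proof -
  have ent: "poly_fun (\<lambda>A. (A ** E) $ i $ j)" for i j
    using poly_fun_mult_right[OF poly_fun.entry[of i j]] .
  have d: "poly_fun (d i j)" for i j using assms by (simp add: is_gradient_def)
  show ?thesis unfolding along_def sum_3 by (intro poly_fun.add poly_fun.mult ent d)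
qed

text \<open>As \<open>E\<close> squares to zero, the one-parameter group of \<open>E\<close> through
  \<open>A\<close> is a straight line on which \<open>p\<close> is a polynomial F(t). Its derivative
  is \<open>along d E\<close> on the same line, which again vanishes on \<open>S\<close> but has
  lower degree; so F' = 0 by induction, and F(0) = p(A) = 0.\<close>

lemma infinitesimal_invariance:
  assumes E: "E ** E = 0"
    and inv: "\<And>p d A. poly_fun p \<Longrightarrow> \<forall>A\<in>S. p A = 0 \<Longrightarrow> is_gradient p d \<Longrightarrow> A \<in> S \<Longrightarrow> along d E A = 0"
    and p: "poly_fun p" "\<forall>A\<in>S. p A = 0" and A: "A \<in> S"
  shows "p (A + t *\<^sub>R (A ** E)) = 0"
proof -
  have *: "F = 0" if "poly_fun p" "\<forall>A\<in>S. p A = 0" "\<forall>t. p (A + t *\<^sub>R (A ** E)) = poly F t" "degree F \<le> n"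
    for n F p
    using that
  proof (induction n arbitrary: F p)
    case 0
    then obtain c where "F = [:c:]" by (auto elim: degree_eq_zeroE)
    moreover have "poly F 0 = 0" using 0(2) A 0(3)[rule_format, of 0] by simp
    ultimately show ?case by simp
  next
    case (Suc n)
    obtain d where d: "is_gradient p d" using poly_fun_gradient[OF Suc.prems(1)] by blast
    have "along d E (A + t *\<^sub>R (A ** E)) = poly (pderiv F) t" for t
    proof -
      have AE: "(A + t *\<^sub>R (A ** E)) ** E = A ** E"
        using E by (simp add: matrix_add_rdistr scaleR_matrix_mult matrix_mul_assoc[symmetric])
      have der: "((\<lambda>s. (A + s *\<^sub>R (A ** E)) $ i $ j) has_real_derivative (A ** E) $ i $ j) (at t)" for i j
        by (auto intro!: derivative_eq_intros)
      have "((\<lambda>s. p (A + s *\<^sub>R (A ** E))) has_real_derivative along d E (A + t *\<^sub>R (A ** E))) (at t)"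
        unfolding along_def AE
        by (rule is_gradientD[OF d, of "\<lambda>s. A + s *\<^sub>R (A ** E)" "A ** E" t]) (rule der)
      then have "(poly F has_real_derivative along d E (A + t *\<^sub>R (A ** E))) (at t)"
        using Suc.prems(3) by simp
      then show ?thesis using poly_DERIV[of F t] DERIV_unique by blast
    qed
    moreover have "degree (pderiv F) \<le> n" using Suc.prems(4) by (simp add: degree_pderiv)
    moreover have "\<forall>A\<in>S. along d E A = 0" using inv Suc.prems d by blast
    ultimately have "pderiv F = 0" using Suc.IH[OF poly_fun_along[OF d]] by blast
    then have "degree F = 0" by (simp add: pderiv_eq_0_iff)
    then obtain c where "F = [:c:]" by (auto elim: degree_eq_zeroE)
    moreover have "poly F 0 = 0" using Suc.prems(2) A Suc.prems(3)[rule_format, of 0] by simp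
    ultimately show ?case by simp
  qed
  obtain F where "\<forall>t. p (A + t *\<^sub>R (A ** E)) = poly F t" using poly_fun_on_line[OF p(1)] by blast
  then show ?thesis using *[OF p, of F "degree F"] by simp
qed

section \<open>Root vectors in the eigenbasis of the first hyperbolic generator\<close>

definition unit_mat :: "3 \<Rightarrow> 3 \<Rightarrow> mat3" where
  "unit_mat i j = (\<chi> a b. if a = i \<and> b = j then 1 else 0)"

lemma elem_mat_unit: "elem_mat i j t = mat 1 + t *\<^sub>R unit_mat i j"
  by (auto simp: elem_mat_def unit_mat_def mat_def vec_eq_iff)

lemma unit_mat_square: assumes "i \<noteq> j" shows "unit_mat i j ** unit_mat i j = 0"
proof -
  have "\<forall>i j. i \<noteq> j \<longrightarrow> unit_mat i j ** unit_mat i j = 0"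
    unfolding forall_3 by (simp add: vec_eq_iff forall_3 unit_mat_def matrix_matrix_mult_def sum_3)
  then show ?thesis using assms by blast
qed

lemma unit_mat_expansion:
  "Y = (\<Sum>i\<in>UNIV. \<Sum>j\<in>UNIV. Y$i$j *\<^sub>R unit_mat i j)"
  by (simp add: vec_eq_iff forall_3 sum_3 unit_mat_def)

lemma matrix_mult_scaleR: "A ** (c *\<^sub>R B) = c *\<^sub>R (A ** (B :: mat3))"
  by (simp add: vec_eq_iff matrix_matrix_mult_def sum_distrib_left mult.left_commute)

lemma linear_along:
  fixes F G :: mat3
  shows "linear (\<lambda>Y. along d (F ** Y ** G) A)"
  by (rule linearI)
    (simp_all add: along_def matrix_add_ldistrib matrix_add_rdistr matrix_mult_scaleR scaleR_matrix_mult
      distrib_left sum.distrib sum_distrib_left mult.left_commute)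

lemma along_expansion:
  fixes F G :: mat3
  shows "along d (F ** Y ** G) A = (\<Sum>i\<in>UNIV. \<Sum>j\<in>UNIV. Y$i$j * along d (F ** unit_mat i j ** G) A)"
proof -
  have "along d (F ** Y ** G) A = along d (F ** (\<Sum>i\<in>UNIV. \<Sum>j\<in>UNIV. Y$i$j *\<^sub>R unit_mat i j) ** G) A"
    using unit_mat_expansion[of Y] by simp
  also have "\<dots> = (\<Sum>i\<in>UNIV. \<Sum>j\<in>UNIV. Y$i$j * along d (F ** unit_mat i j ** G) A)"
    using linear_add[OF linear_along[of d F G A]] linear_scale[OF linear_along[of d F G A]]
    by (simp add: sum_3)
  finally show ?thesis .
qed

lemma rep_replicate_hyp:
  assumes "h 1 = hyp_mat s r t a b c" and d: "s \<noteq> r" "s \<noteq> t" "r \<noteq> t" and nz: "a \<noteq> 0" "b \<noteq> 0" "c \<noteq> 0"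
  shows "rep h (replicate n (1, False)) = hyp_mat s r t (a^n) (b^n) (c^n)"
    and "rep h (replicate n (1, True)) = hyp_mat s r t ((1/a)^n) ((1/b)^n) ((1/c)^n)"
proof -
  have "letter_mat h (1, False) = hyp_mat s r t a b c" "letter_mat h (1, True) = hyp_mat s r t (1/a) (1/b) (1/c)"
    using assms(1) by (simp_all add: letter_mat_def hyp_inverse[OF d nz])
  then show "rep h (replicate n (1, False)) = hyp_mat s r t (a^n) (b^n) (c^n)"
    "rep h (replicate n (1, True)) = hyp_mat s r t ((1/a)^n) ((1/b)^n) ((1/c)^n)"
    by (induction n) (simp_all add: hyp_one[OF d] hyp_mult[OF d])
qed

text \<open>Multiplied by N^(9n), the sum is a polynomial in N^(3n) that vanishes for all n. The six
  off-diagonal weights give the six distinct exponents other than 3; the diagonal ones all fall on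
  exponent 3 and are not separated.\<close>

lemma sum_weights_zero:
  fixes c :: "3 \<Rightarrow> 3 \<Rightarrow> real"
  assumes N: "N > 1"
    and z: "\<And>n::nat. (\<Sum>i\<in>UNIV. \<Sum>j\<in>UNIV. (vector [(N^5)^n, (1/N)^n, (1/N^4)^n] :: real^3) $ i
      * (vector [(1/N^5)^n, N^n, (N^4)^n] :: real^3) $ j * c i j) = 0"
    and ij: "i \<noteq> j"
  shows "c i j = 0"
proof -
  let ?F = "[:c 3 1, c 2 1, c 3 2, c 1 1 + c 2 2 + c 3 3, c 2 3, c 1 2, c 1 3:]"
  have "poly ?F ((N^3) ^ n) = 0" for n
  proof -
    define y where "y = N ^ n"
    have y: "y \<noteq> 0" using N by (simp add: y_def)
    have p: "(N^5)^n = y^5" "(1/N)^n = 1/y" "(1/N^4)^n = 1/y^4" "(1/N^5)^n = 1/y^5" "(N^4)^n = y^4" "(N^3)^n = y^3"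
      by (simp_all add: y_def power_one_over power_mult[symmetric] mult.commute)
    have "poly ?F (y^3) = y^9 * ((y^5 * (1/y^5) * c 1 1 + y^5 * y * c 1 2 + y^5 * y^4 * c 1 3)
      + (1/y * (1/y^5) * c 2 1 + 1/y * y * c 2 2 + 1/y * y^4 * c 2 3)
      + (1/y^4 * (1/y^5) * c 3 1 + 1/y^4 * y * c 3 2 + 1/y^4 * y^4 * c 3 3))"
      using y by (simp add: field_simps eval_nat_numeral)
    also have "\<dots> = 0"
      using z[of n] unfolding sum_3 vector_3 p y_def[symmetric] by (simp only: mult_zero_right)
    finally show ?thesis by (simp only: p)
  qed
  then have "?F = 0" using N by (intro poly_zero_on_powers[of "N^3"]) (auto intro: one_less_power)
  then have "c 3 1 = 0" "c 2 1 = 0" "c 3 2 = 0" "c 2 3 = 0" "c 1 2 = 0" "c 1 3 = 0" by simp_all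
  then show ?thesis using exhaust_3[of i] exhaust_3[of j] ij by auto
qed

text \<open>Since \<open>spiral 1 0 (-2)\<close> is the identity minus 3 \<open>projL\<close>, an
  off-diagonal entry is, up to sign, a Lagrange polynomial at 1 times 1 + x + x^2 at a node x, and 1
  is not a node.\<close>

lemma conjugated_homology_nonzero:
  assumes "i \<noteq> j"
  shows "(lag_mat 13 14 15 ** spiral 1 0 (-2) ** node_mat 13 14 15) $ i $ j \<noteq> 0"
proof -
  have "\<forall>i j. i \<noteq> j \<longrightarrow> (lag_mat 13 14 15 ** (spiral 1 0 (-2) ** node_mat 13 14 15)) $ i $ j \<noteq> 0"
    unfolding forall_3
    by (simp add: matrix_matrix_mult_def sum_3 lag_mat_def lag_def node_mat_def transpose_def conic_pt_def
        spiral_def circulant_def)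
  then show ?thesis using assms by (simp add: matrix_mul_assoc)
qed

lemma spin_rep_zariski_dense:
  assumes k: "k > 1" and N: "N > 1" and l: "l > 1"
  shows "zariski_dense_SL3 (rep (spin_rep N l) ` FreeGroup k)"
proof -
  let ?g = "spin_rep N l"
  define S where "S = rep ?g ` {w. letters_ok k w}"
  have g: "hom_tuple k ?g" using N l by (intro spin_rep_hom_tuple) auto
  have SF: "rep ?g ` FreeGroup k = S" unfolding S_def by (rule rep_image_FreeGroup[OF g])
  have SSL: "S \<subseteq> SL3" unfolding S_def using rep_SL3[OF g] by auto
  have Smul: "A ** B \<in> S" if AB: "A \<in> S" "B \<in> S" for A B
  proof -
    obtain u w where "letters_ok k u" "A = rep ?g u" "letters_ok k w" "B = rep ?g w"
      using AB by (auto simp: S_def)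
    then show ?thesis unfolding S_def by (intro image_eqI[of _ _ "u @ w"]) (auto simp: rep_append)
  qed
  have S1: "mat 1 \<in> S" unfolding S_def by (rule image_eqI[of _ _ "[]"]) auto
  have Srep: "rep ?g (replicate n x) \<in> S" if "fst x < k" for n x
    unfolding S_def using letters_ok_replicate[OF that] by blast
  let ?Z = "spiral 1 0 (-2)"
  let ?F = "node_mat 13 14 15" and ?G = "lag_mat 13 14 15"
  have FG: "?F ** ?G = mat 1" "?G ** ?F = mat 1" by (simp_all add: node_lag_mat lag_node_mat)
  have g1: "?g 1 = hyp_mat 13 14 15 (N^5) (1/N) (1/N^4)" by (simp add: spin_rep_def)
  define b where "b n = hyp_mat 13 14 15 ((N^5)^n) ((1/N)^n) ((1/N^4)^n)" for n
  define b' where "b' n = hyp_mat 13 14 15 ((1/N^5)^n) (N^n) ((N^4)^n)" for n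
  have bS: "b n \<in> S" "b' n \<in> S" for n
    using Srep[of "(1, False)" n] Srep[of "(1, True)" n] k N
      rep_replicate_hyp[of ?g, OF g1, of n] by (simp_all add: b_def b'_def)
  have bb: "b n ** b' n = mat 1" for n
    unfolding b_def b'_def using N
    by (simp add: hyp_mult power_mult_distrib[symmetric] hyp_one)
  have g0: "?g 0 = spin l (2 * pi / 3)" by (simp add: spin_rep_def)
  have aS: "spiral ((l^3)^m) 0 (1 / ((l^3)^m)\<^sup>2) \<in> S" for m
  proof -
    have "real (3 * m) * (2 * pi / 3) = 2 * real m * pi" by simp
    moreover have "l ^ (3 * m) = (l^3)^m" "l ^ (2 * (3 * m)) = ((l^3)^m)\<^sup>2"
      by (simp_all add: power_mult[symmetric] mult.commute mult.left_commute)
    ultimately have "rep ?g (replicate (3 * m) (0, False)) = spiral ((l^3)^m) 0 (1 / ((l^3)^m)\<^sup>2)"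
      unfolding rep_spin_power[where h = ?g, OF g0] by (simp only: cos_2npi sin_2npi) simp
    then show ?thesis using Srep[of "(0, False)" "3 * m"] k by simp
  qed
  \<comment> \<open>The cube of the spiral generator acts by scalars on plane and axis, so its
    powers, conjugated by b_1^n, lie in a one-parameter group with generator conjugate to
    \<open>?Z\<close>. Functions vanishing on \<open>S\<close> vanish along the translated group,
    hence so does their derivative at its identity.\<close>
  have conj_zero: "along d (b n ** ?Z ** b' n) A = 0"
    if p: "poly_fun p" "\<forall>A\<in>S. p A = 0" and d: "is_gradient p d" and A: "A \<in> S" for p d A n
  proof -
    define M where "M = A ** (b n ** projV ** b' n)"
    define M' where "M' = A ** (b n ** projL ** b' n)"
    have comb: "x *\<^sub>R M + y *\<^sub>R M' = A ** (b n ** spiral x 0 y ** b' n)" for x y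
    proof -
      have "spiral x 0 y = x *\<^sub>R projV + y *\<^sub>R projL" by (simp add: spiral_scale spiral_add)
      then show ?thesis
        by (simp only: M_def M'_def matrix_add_ldistrib matrix_add_rdistr matrix_mult_scaleR scaleR_matrix_mult)
    qed
    have zero: "p (x *\<^sub>R M + (1 / x\<^sup>2) *\<^sub>R M') = 0" if "x \<noteq> 0" for x
    proof (rule poly_fun_torus_closure[OF p(1) _ _ that, of "l^3"])
      show "l^3 > 1" using l by (simp add: one_less_power)
      show "p ((l^3)^m *\<^sub>R M + (1 / ((l^3)^m)\<^sup>2) *\<^sub>R M') = 0" for m
        unfolding comb by (rule p(2)[rule_format]) (intro Smul A bS aS)
    qed
    define c where "c s = exp s *\<^sub>R M + (1 / (exp s)\<^sup>2) *\<^sub>R M'" for s :: real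
    have c0: "c 0 = A"
      using comb[of 1 1] bb[of n] by (simp add: c_def spiral_one)
    have MZ: "M - 2 *\<^sub>R M' = A ** (b n ** ?Z ** b' n)"
      using comb[of 1 "-2"] by simp
    have der: "((\<lambda>s. c s $ i $ j) has_real_derivative (M - 2 *\<^sub>R M') $ i $ j) (at 0)" for i j
      unfolding c_def by (auto intro!: derivative_eq_intros)
    have "((\<lambda>s. p (c s)) has_real_derivative
        (\<Sum>i\<in>UNIV. \<Sum>j\<in>UNIV. d i j (c 0) * (M - 2 *\<^sub>R M') $ i $ j)) (at 0)"
      by (rule is_gradientD[OF d, of c "M - 2 *\<^sub>R M'" 0]) (rule der)
    moreover have "p (c s) = 0" for s unfolding c_def by (rule zero) simp
    ultimately have "((\<lambda>s::real. 0) has_real_derivative along d (b n ** ?Z ** b' n) A) (at 0)"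
      unfolding c0 MZ along_def by (simp only:)
    from DERIV_unique[OF this DERIV_const] show ?thesis .
  qed
  have unit_zero: "along d (?F ** unit_mat i j ** ?G) A = 0"
    if p: "poly_fun p" "\<forall>A\<in>S. p A = 0" and d: "is_gradient p d" and A: "A \<in> S" and ij: "i \<noteq> j" for p d A i j
  proof -
    let ?Z' = "?G ** ?Z ** ?F"
    let ?v = "\<lambda>n. vector [(N^5)^n, (1/N)^n, (1/N^4)^n] :: real^3"
    let ?w = "\<lambda>n. vector [(1/N^5)^n, N^n, (N^4)^n] :: real^3"
    have "?Z' $ i $ j * along d (?F ** unit_mat i j ** ?G) A = 0"
    \<comment> \<open>In the eigenbasis, conjugation by b_1^n multiplies entry (i,j) of
      \<open>?Z'\<close> by the ratio of the i-th and j-th eigenvalues to the power n.\<close>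
    proof (rule sum_weights_zero[OF N _ ij, of "\<lambda>i j. ?Z' $ i $ j * along d (?F ** unit_mat i j ** ?G) A"])
      fix n
      let ?Y = "diag3 ((N^5)^n) ((1/N)^n) ((1/N^4)^n) ** ?Z' ** diag3 ((1/N^5)^n) (N^n) ((N^4)^n)"
      have "b n ** ?Z ** b' n = ?F ** ?Y ** ?G"
        by (simp only: b_def b'_def hyp_mat_def matrix_mul_assoc)
      then have "along d (?F ** ?Y ** ?G) A = 0" using conj_zero[OF p d A, of n] by simp
      moreover have "(diag3 a1 a2 a3 ** X ** diag3 b1 b2 b3) $ i $ j
          = (vector [a1, a2, a3] :: real^3) $ i * (vector [b1, b2, b3] :: real^3) $ j * X $ i $ j"
        for a1 a2 a3 b1 b2 b3 i j and X :: mat3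
        using exhaust_3[of i] exhaust_3[of j]
        by (auto simp: matrix_matrix_mult_def sum_3 diag3_def)
      ultimately show "(\<Sum>i\<in>UNIV. \<Sum>j\<in>UNIV. ?v n $ i * ?w n $ j *
          (?Z' $ i $ j * along d (?F ** unit_mat i j ** ?G) A)) = 0"
        unfolding along_expansion[of d ?F ?Y] by (simp only: mult.assoc)
    qed
    then show ?thesis using conjugated_homology_nonzero[OF ij] by simp
  qed
  \<comment> \<open>Right translations that preserve vanishing on \<open>S\<close>. They visibly
    form a monoid, so no group structure on the Zariski closure has to be established; applying an
    element to the identity in \<open>S\<close> shows that it lies in the closure.\<close>
  define Z where "Z = {M. \<forall>p. poly_fun p \<longrightarrow> (\<forall>A\<in>S. p A = 0) \<longrightarrow> (\<forall>A\<in>S. p (A ** M) = 0)}"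
  have Zmul: "M ** M' \<in> Z" if MM: "M \<in> Z" "M' \<in> Z" for M M'
    unfolding Z_def
  proof (intro CollectI allI impI ballI)
    fix p A assume p: "poly_fun p" "\<forall>A\<in>S. p A = 0" and A: "A \<in> S"
    have "\<forall>A\<in>S. p (A ** M') = 0" using MM(2) p by (auto simp: Z_def)
    then have "p ((A ** M) ** M') = 0"
      using MM(1) A poly_fun_mult_right[OF p(1), of M'] unfolding Z_def by blast
    then show "p (A ** (M ** M')) = 0" by (simp add: matrix_mul_assoc)
  qed
  have Zelem: "?F ** elem_mat i j t ** ?G \<in> Z" if ij: "i \<noteq> j" for i j t
    unfolding Z_def
  proof (intro CollectI allI impI ballI)
    fix p A assume p: "poly_fun p" "\<forall>A\<in>S. p A = 0" and A: "A \<in> S"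
    let ?E = "?F ** unit_mat i j ** ?G"
    have "?E ** ?E = ?F ** (unit_mat i j ** (?G ** ?F) ** unit_mat i j) ** ?G"
      by (simp only: matrix_mul_assoc)
    also have "\<dots> = 0" by (simp add: FG unit_mat_square[OF ij])
    finally have "?E ** ?E = 0" .
    then have "p (A + t *\<^sub>R (A ** ?E)) = 0"
      by (rule infinitesimal_invariance[where S = S, OF _ _ p A]) (use unit_zero ij in blast)
    moreover have "A + t *\<^sub>R (A ** ?E) = A ** (?F ** elem_mat i j t ** ?G)"
      by (simp add: elem_mat_unit matrix_add_ldistrib matrix_add_rdistr matrix_mult_scaleR scaleR_matrix_mult FG)
    ultimately show "p (A ** (?F ** elem_mat i j t ** ?G)) = 0" by simp
  qed
  have all: "?F ** M ** ?G \<in> Z" if "det M = 1" for M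
  proof (rule SL3_elementary_induct[OF _ _ that, of "\<lambda>M. ?F ** M ** ?G \<in> Z"])
    fix A B assume "?F ** A ** ?G \<in> Z" "?F ** B ** ?G \<in> Z"
    then have "(?F ** A ** ?G) ** (?F ** B ** ?G) \<in> Z" by (rule Zmul)
    moreover have "(?F ** A ** ?G) ** (?F ** B ** ?G) = ?F ** (A ** (?G ** ?F) ** B) ** ?G"
      by (simp only: matrix_mul_assoc)
    ultimately show "?F ** (A ** B) ** ?G \<in> Z" by (simp add: FG)
  qed (rule Zelem)
  have "p M = 0" if p: "poly_fun p" "\<forall>A\<in>S. p A = 0" and M: "M \<in> SL3" for p M
  proof -
    have "det ?G * det ?F = 1" using FG(2) by (metis det_mul det_I)
    then have "det (?G ** M ** ?F) = 1" using M by (simp add: det_mul SL3_def mult.commute)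
    then have "?F ** (?G ** M ** ?F) ** ?G \<in> Z" by (rule all)
    moreover have "?F ** (?G ** M ** ?F) ** ?G = (?F ** ?G) ** M ** (?F ** ?G)"
      by (simp only: matrix_mul_assoc)
    ultimately have "M \<in> Z" by (simp add: FG)
    then have "p (mat 1 ** M) = 0" using p S1 unfolding Z_def by blast
    then show ?thesis by simp
  qed
  then show ?thesis unfolding zariski_dense_SL3_def SF using SSL by blast
qed

lemma spin_rep_not_in_closure_anosov:
  assumes "k > 0" "N > 0" "l > 1"
  shows "\<not> in_closure_anosov k (spin_rep N l)"
proof (rule complex_eigenvalues_not_in_closure_anosov)
  have x: "(l * cos (2 * pi / 3))\<^sup>2 + (l * sin (2 * pi / 3))\<^sup>2 = l\<^sup>2"
    unfolding power_mult_distrib distrib_left[symmetric] by simp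
  have c: "cos (2 * pi / 3) = - 1 / 2" using cos_120 by (simp add: mult.commute)
  show "hom_tuple k (spin_rep N l)" using assms by (intro spin_rep_hom_tuple) auto
  show "tr3 (spin_rep N l 0) = 1 / l\<^sup>2 + 2 * (l * cos (2 * pi / 3))"
    by (simp add: spin_rep_def spin_def tr3_spiral)
  show "minors3 (spin_rep N l 0) = 1 / l\<^sup>2 * (2 * (l * cos (2 * pi / 3))) + l\<^sup>2"
    by (simp only: spin_rep_def spin_def minors3_spiral x simp_thms if_True)
  show "1 / l\<^sup>2 * l\<^sup>2 = 1" using assms by simp
  show "l\<^sup>2 > 1" using assms by (simp add: one_less_power)
  show "(2 * (l * cos (2 * pi / 3)))\<^sup>2 < 4 * l\<^sup>2"
    unfolding c using assms by (simp add: power2_eq_square)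
qed (rule assms)

theorem mainTheorem2:
  fixes k :: nat
  assumes "k > 2"
  shows "\<exists>g. hom_tuple k g \<and> quasi_isometric k g
           \<and> zariski_dense_SL3 (rep g ` FreeGroup k)
           \<and> \<not> in_closure_anosov k g
           \<and> \<not> robustly_quasi_isometric k g"
proof -
  obtain \<eta> N l where pp: "ping_pong k \<eta> N l" using exists_ping_pong by blast
  then have "N > 1" "l > 1" by (auto simp: ping_pong_def)
  then show ?thesis
    using assms pp
    by (intro exI[of _ "spin_rep N l"] conjI spin_rep_hom_tuple spin_rep_quasi_isometric
        spin_rep_zariski_dense spin_rep_not_in_closure_anosov spin_rep_not_robust) auto
qed

end
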